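(* Let $K\subset\mathbb{R}^d$ be the invariant set of an iterated function system $\Phi=\{\phi_1,\dots,\phi_N\}$ ($N\ge 2$) of contracting similarities of $\mathbb{R}^d$ with contraction ratios $r_1,\dots,r_N\in(0,1)$ satisfying the strong separation condition. Let $g\colon\mathcal{U}\to\mathbb{R}^d$ be a conformal diffeomorphism on an open domain $\mathcal{U}\supseteq K_{1/2}$ such that $|g'|$ is $\alpha$-H\"older continuous for some $\alpha>0$, and let $F:=g(K)$. Let $\delta$ denote the Minkowski dimension of $K$ (and hence of $F$) and let $\mu_\delta:=\mathcal{H}^\delta|_K/\mathcal{H}^\delta(K)$ be the normalised $\delta$-dimensional Hausdorff measure on $K$. Then the following hold. (i) The average Minkowski contents $\widetilde{\mathcal{M}}(K)$ and $\widetilde{\mathcal{M}}(F)$ always exist and are positive and finite. Moreover, $$\widetilde{\mathcal{M}}(F)=\widetilde{\mathcal{M}}(K)\cdot\int_K|g'|^\delta\,\mathrm{d}\mu_\delta.$$ (ii) If $K$ is Minkowski measurable, then $F$ is Minkowski measurable, and in this case $\mathcal{M}(K)=\widetilde{\mathcal{M}}(K)$ and $\mathcal{M}(F)=\widetilde{\mathcal{M}}(F)$.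
   Context: Setting. $\mathbb{R}^d$ carries the Euclidean metric $\rho$ and $\lambda^d$ is $d$-dimensional Lebesgue measure. For a nonempty compact $Y\subset\mathbb{R}^d$ and $\varepsilon>0$, $Y_\varepsilon:=\{x\in\mathbb{R}^d\mid\rho(Y,x)\le\varepsilon\}$ is the $\varepsilon$-parallel neighbourhood of $Y$. The invariant set $K$ of $\Phi$ is the unique nonempty compact set with $K=\bigcup_{i=1}^N\phi_iK$. The strong separation condition means $\phi_iK\cap\phi_jK=\emptyset$ for all $i\ne j$. Conformal means angle preserving: the Jacobian decomposes as $\mathrm{D}g(x)=f(x)\cdot O(x)$ with $O(x)$ an orthogonal matrix and $f(x)$ a scalar; $|g'(x)|:=|f(x)|$ is the length scaling ratio of $g$ at $x$. The diffeomorphism $g$ is understood as a diffeomorphism onto its image. Minkowski dimension. For nonempty compact $Y$, the upper and lower Minkowski dimensions are $\overline{\dim}_M(Y):=d-\liminf_{\varepsilon\searrow0}\frac{\ln\lambda^d(Y_\varepsilon)}{\ln\varepsilon}$ and $\underline{\dim}_M(Y):=d-\limsup_{\varepsilon\searrow0}\frac{\ln\lambda^d(Y_\varepsilon)}{\ln\varepsilon}$; if they coincide the common value is the Minkowski dimension. It is known that the Minkowski dimensions of $K$ and $F$ exist, are equal, and equal the unique $\delta$ with $\sum_{i=1}^N r_i^\delta=1$. $\mathcal{H}^\delta$ is $\delta$-dimensional Hausdorff measure. Minkowski content. Let $Y$ be nonempty compact with Minkowski dimension $\delta$. The average Minkowski content is $\widetilde{\mathcal{M}}(Y):=\lim_{T\searrow0}|\ln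 T|^{-1}\int_T^1\varepsilon^{\delta-d}\lambda^d(Y_\varepsilon)\frac{\mathrm{d}\varepsilon}{\varepsilon}$, provided the limit exists. The upper and lower Minkowski contents are the $\limsup$ and $\liminf$ of $\varepsilon^{\delta-d}\lambda^d(Y_\varepsilon)$ as $\varepsilon\searrow0$. If they coincide, the common value $\mathcal{M}(Y)$ is the Minkowski content of $Y$ and $Y$ is called Minkowski measurable. *)

theory Defs
  imports "HOL-Analysis.Analysis"
begin

definition similarity :: "real \<Rightarrow> ('a::metric_space \<Rightarrow> 'a) \<Rightarrow> bool" where
  "similarity r \<phi> \<longleftrightarrow> (\<forall>x y. dist (\<phi> x) (\<phi> y) = r * dist x y)"

definition invariant_set :: "nat \<Rightarrow> (nat \<Rightarrow> 'a::metric_space \<Rightarrow> 'a) \<Rightarrow> 'a set \<Rightarrow> bool" where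
  "invariant_set N \<phi> K \<longleftrightarrow> K \<noteq> {} \<and> compact K \<and> K = (\<Union>i\<in>{1..N}. \<phi> i ` K)"

definition strong_separation :: "nat \<Rightarrow> (nat \<Rightarrow> 'a \<Rightarrow> 'a) \<Rightarrow> 'a set \<Rightarrow> bool" where
  "strong_separation N \<phi> K \<longleftrightarrow>
     (\<forall>i\<in>{1..N}. \<forall>j\<in>{1..N}. i \<noteq> j \<longrightarrow> \<phi> i ` K \<inter> \<phi> j ` K = {})"

definition C1_on :: "(real^'d) set \<Rightarrow> (real^'d \<Rightarrow> real^'d) \<Rightarrow> bool" where
  "C1_on U g \<longleftrightarrow>
     (\<forall>x\<in>U. g differentiable (at x)) \<and> continuous_on U (\<lambda>x. jacobian g (at x))"

definition diffeo_onto_image :: "(real^'d) set \<Rightarrow> (real^'d \<Rightarrow> real^'d) \<Rightarrow> bool" where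
  "diffeo_onto_image U g \<longleftrightarrow>
     inj_on g U \<and> open (g ` U) \<and> C1_on U g \<and> C1_on (g ` U) (the_inv_into U g)"

definition conformal_on :: "(real^'d) set \<Rightarrow> (real^'d \<Rightarrow> real^'d) \<Rightarrow> bool" where
  "conformal_on U g \<longleftrightarrow>
     (\<forall>x\<in>U. \<exists>c Q. orthogonal_matrix Q \<and> jacobian g (at x) = c *\<^sub>R Q)"

text \<open>The quantity written \<open>|g'(x)|\<close>. The scalar factor is determined up to its sign, see
  \<open>scaling_ratio_eq\<close> below.\<close>

definition scaling_ratio :: "(real^'d \<Rightarrow> real^'d) \<Rightarrow> real^'d \<Rightarrow> real" where
  "scaling_ratio g x =
     (THE s. \<exists>c Q. orthogonal_matrix Q \<and> jacobian g (at x) = c *\<^sub>R Q \<and> s = \<bar>c\<bar>)"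

lemma orthogonal_matrix_scale_unique:
  fixes P Q :: "real^'d^'d"
  assumes "orthogonal_matrix P" "orthogonal_matrix Q" "b *\<^sub>R P = c *\<^sub>R Q"
  shows "\<bar>b\<bar> = \<bar>c\<bar>"
proof -
  fix i :: 'd
  let ?e = "axis i 1 :: real^'d"
  have "norm (R *v ?e) = 1" if "orthogonal_matrix R" for R :: "real^'d^'d"
  proof -
    have "orthogonal_transformation ((*v) R)"
      using that by (simp add: orthogonal_transformation_matrix)
    then show ?thesis
      by (simp add: orthogonal_transformation_norm)
  qed
  then have "norm (P *v ?e) = 1" "norm (Q *v ?e) = 1"
    using assms(1,2) by auto
  moreover have "b *\<^sub>R (P *v ?e) = c *\<^sub>R (Q *v ?e)"
    using assms(3) by (metis scaleR_matrix_vector_assoc)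
  ultimately show ?thesis
    by (metis norm_scaleR mult.right_neutral)
qed

lemma scaling_ratio_eq:
  assumes "orthogonal_matrix Q" "jacobian g (at x) = c *\<^sub>R Q"
  shows "scaling_ratio g x = \<bar>c\<bar>"
  unfolding scaling_ratio_def
  using assms by (intro the_equality) (auto intro: orthogonal_matrix_scale_unique)

definition holder_on :: "real \<Rightarrow> 'a::metric_space set \<Rightarrow> ('a \<Rightarrow> real) \<Rightarrow> bool" where
  "holder_on \<alpha> U h \<longleftrightarrow> (\<exists>C. \<forall>x\<in>U. \<forall>y\<in>U. \<bar>h x - h y\<bar> \<le> C * dist x y powr \<alpha>)"

definition parallel_nbhd :: "'a::metric_space set \<Rightarrow> real \<Rightarrow> 'a set" where
  "parallel_nbhd Y \<epsilon> = {x. infdist x Y \<le> \<epsilon>}"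

definition upper_minkowski_dim :: "'a::euclidean_space set \<Rightarrow> ereal" where
  "upper_minkowski_dim Y = ereal (real DIM('a)) -
     Liminf (at_right 0) (\<lambda>\<epsilon>. ereal (ln (measure lborel (parallel_nbhd Y \<epsilon>)) / ln \<epsilon>))"

definition lower_minkowski_dim :: "'a::euclidean_space set \<Rightarrow> ereal" where
  "lower_minkowski_dim Y = ereal (real DIM('a)) -
     Limsup (at_right 0) (\<lambda>\<epsilon>. ereal (ln (measure lborel (parallel_nbhd Y \<epsilon>)) / ln \<epsilon>))"

definition has_minkowski_dim :: "'a::euclidean_space set \<Rightarrow> real \<Rightarrow> bool" where
  "has_minkowski_dim Y \<delta> \<longleftrightarrow> upper_minkowski_dim Y = ereal \<delta> \<and> lower_minkowski_dim Y = ereal \<delta>"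

definition minkowski_dim :: "'a::euclidean_space set \<Rightarrow> real" where
  "minkowski_dim Y = (THE \<delta>. has_minkowski_dim Y \<delta>)"

definition rescaled_volume :: "'a::euclidean_space set \<Rightarrow> real \<Rightarrow> real" where
  "rescaled_volume Y \<epsilon> =
     \<epsilon> powr (minkowski_dim Y - real DIM('a)) * measure lborel (parallel_nbhd Y \<epsilon>)"

text \<open>Contents take values in the extended reals, so that their finiteness is a genuine claim.
  They are only meaningful for sets whose Minkowski dimension exists; the existence predicates
  \<open>minkowski_measurable\<close> and \<open>has_average_content\<close> include this.\<close>

definition upper_minkowski_content :: "'a::euclidean_space set \<Rightarrow> ereal" where
  "upper_minkowski_content Y = Limsup (at_right 0) (\<lambda>\<epsilon>. ereal (rescaled_volume Y \<epsilon>))"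

definition lower_minkowski_content :: "'a::euclidean_space set \<Rightarrow> ereal" where
  "lower_minkowski_content Y = Liminf (at_right 0) (\<lambda>\<epsilon>. ereal (rescaled_volume Y \<epsilon>))"

definition minkowski_measurable :: "'a::euclidean_space set \<Rightarrow> bool" where
  "minkowski_measurable Y \<longleftrightarrow> (\<exists>\<delta>. has_minkowski_dim Y \<delta>) \<and>
     upper_minkowski_content Y = lower_minkowski_content Y"

definition minkowski_content :: "'a::euclidean_space set \<Rightarrow> ereal" where
  "minkowski_content Y = (THE M. upper_minkowski_content Y = M \<and> lower_minkowski_content Y = M)"

definition log_average :: "'a::euclidean_space set \<Rightarrow> real \<Rightarrow> real" where
  "log_average Y T = inverse \<bar>ln T\<bar> * (LBINT \<epsilon>:{T..1}. rescaled_volume Y \<epsilon> / \<epsilon>)"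

definition has_average_content :: "'a::euclidean_space set \<Rightarrow> bool" where
  "has_average_content Y \<longleftrightarrow> (\<exists>\<delta>. has_minkowski_dim Y \<delta>) \<and>
     (\<exists>M. ((\<lambda>T. ereal (log_average Y T)) \<longlongrightarrow> M) (at_right 0))"

definition average_content :: "'a::euclidean_space set \<Rightarrow> ereal" where
  "average_content Y = Lim (at_right 0) (\<lambda>T. ereal (log_average Y T))"

text \<open>The weight \<open>(diam U)^s\<close>, with the usual conventions that the empty set has weight 0 and
  that any other set has weight 1 when \<open>s = 0\<close> (whereas \<open>0 powr 0 = 0\<close>).\<close>

definition hausdorff_weight :: "real \<Rightarrow> 'a::metric_space set \<Rightarrow> ennreal" where
  "hausdorff_weight s U =
     (if U = {} then 0 else if s = 0 then 1 else ennreal (diameter U powr s))"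

text \<open>Covering sets are required to be bounded because \<open>diameter\<close> is meaningless on
  unbounded sets.\<close>

definition hausdorff_pre :: "real \<Rightarrow> real \<Rightarrow> 'a::metric_space set \<Rightarrow> ennreal" where
  "hausdorff_pre s \<eta> A =
     (INF U \<in> {U :: nat \<Rightarrow> 'a set. A \<subseteq> (\<Union>i. U i) \<and> (\<forall>i. bounded (U i) \<and> diameter (U i) \<le> \<eta>)}.
        \<Sum>i. hausdorff_weight s (U i))"

definition hausdorff_outer :: "real \<Rightarrow> 'a::metric_space set \<Rightarrow> ennreal" where
  "hausdorff_outer s A = (SUP \<eta>\<in>{0<..}. hausdorff_pre s \<eta> A)"

definition hausdorff_measure :: "real \<Rightarrow> 'a::metric_space measure" where
  "hausdorff_measure s = measure_of UNIV (sets borel) (hausdorff_outer s)"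

text \<open>The normalised restriction of the Hausdorff measure to \<open>K\<close>; \<open>uniform_measure\<close> extends
  it by zero to all Borel sets.\<close>

definition normalised_hausdorff :: "real \<Rightarrow> 'a::metric_space set \<Rightarrow> 'a measure" where
  "normalised_hausdorff s K = uniform_measure (hausdorff_measure s) K"

end

theory Submission
  imports Defs
begin

text \<open>Write \<open>D\<close> for the dimension of the space, \<open>V\<^sub>Y(\<epsilon>)\<close> for the volume of the \<open>\<epsilon>\<close>-parallel neighbourhood of
\<open>Y\<close>, \<open>r\<^sub>i\<close> for the contraction ratios and \<open>\<delta>\<close> for the solution of \<open>\<Sum>\<^sub>i r\<^sub>i\<^sup>\<delta> = 1\<close>.  Everything is read off from the
function \<open>Z(t) = \<epsilon>\<^sup>\<delta>\<^sup>-\<^sup>D V\<^sub>K(\<epsilon>)\<close> with \<open>\<epsilon> = e\<^sup>-\<^sup>t\<close>: the average Minkowski content of \<open>K\<close> is the mean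
of \<open>Z\<close> over \<open>[0, L]\<close> in the limit \<open>L \<rightarrow> \<infinity>\<close>, and the Minkowski content is the limit of \<open>Z\<close> at infinity.

\<^bold>\<open>The content of \<open>K\<close>.\<close>  The pieces \<open>\<phi>\<^sub>i K\<close> are disjoint and compact, so for small \<open>\<epsilon>\<close> the parallel
neighbourhood of \<open>K\<close> is the disjoint union of those of the pieces, and scaling turns this into the
exact equation \<open>Z(t) = \<Sum>\<^sub>i p\<^sub>i Z(t - s\<^sub>i)\<close> with the probabilities \<open>p\<^sub>i = r\<^sub>i\<^sup>\<delta>\<close> and the shifts \<open>s\<^sub>i = - ln r\<^sub>i > 0\<close>
(\<open>renewal_equation\<close>).  A function that is an average of its own earlier values never leaves the
range of its initial segment; hence \<open>Z\<close> lies between positive constants, which makes \<open>\<delta>\<close> the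
Minkowski dimension.  The mean comes from a conserved quantity: if \<open>G\<close> is a primitive of \<open>Z\<close>, then
\<open>G(t) - \<Sum>\<^sub>i p\<^sub>i G(t - s\<^sub>i)\<close> is a constant \<open>q\<close>, so with \<open>m = \<Sum>\<^sub>i p\<^sub>i s\<^sub>i\<close> the function \<open>G(t) - (q / m) t\<close>
solves the averaging equation as well and is therefore bounded.  Thus \<open>G(t) / t\<close> tends to \<open>q / m\<close>
(\<open>averaging_has_mean\<close>).

\<^bold>\<open>The content of \<open>F\<close>.\<close>  Cut \<open>K\<close> into cylinders \<open>K\<^sub>w = \<phi>\<^sub>w K\<close> so small that \<open>|g'|\<close> varies on each of them by
a factor less than \<open>\<theta>\<close>, say between \<open>m\<^sub>w\<close> and \<open>\<theta> m\<^sub>w\<close>.  Close to \<open>K\<^sub>w\<close> the map \<open>g\<close> is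
\<open>\<theta> m\<^sub>w\<close>-Lipschitz and its inverse is \<open>1 / m\<^sub>w\<close>-Lipschitz, and a Lipschitz map with constant \<open>M\<close>
increases volumes at most by the factor \<open>M\<^sup>D\<close> (\<open>measure_lipschitz_image_le\<close>, from the Vitali covering
theorem).  This compares \<open>V\<close> for \<open>g K\<^sub>w\<close> with \<open>V\<close> for \<open>K\<^sub>w\<close> (\<open>conformal_parallel_nbhd_bounds\<close>).
Summing over \<open>w\<close> encloses the analogue of \<open>Z\<close> for \<open>F\<close>, at large arguments, between two positive
combinations of translates of \<open>Z\<close> (\<open>log_volume_image_sandwich\<close>).  Translates have the same mean and
the same limit as \<open>Z\<close>, and both sums of coefficients approach \<open>\<integral>\<^sub>K |g'|\<^sup>\<delta> d\<mu>\<close> as \<open>\<theta>\<close> decreases to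
\<open>1\<close>, because \<open>\<mu>(K\<^sub>w) = r\<^sub>w\<^sup>\<delta>\<close>.  So means and limits are both multiplied by that integral.

\<^bold>\<open>The measure \<open>\<mu>\<close>.\<close>  That the normalised Hausdorff measure satisfies \<open>\<mu>(K\<^sub>w) = r\<^sub>w\<^sup>\<delta>\<close> requires that
the Hausdorff outer measure is countably additive on Borel sets (\<open>measure_space_hausdorff\<close>, by
Caratheodory's criterion) and that \<open>\<H>\<^sup>\<delta>(K)\<close> is finite and positive.  Scaling then gives
\<open>\<H>\<^sup>\<delta>(K\<^sub>w) \<le> r\<^sub>w\<^sup>\<delta> \<H>\<^sup>\<delta>(K)\<close>, and both sides have the same finite sum over the words \<open>w\<close> of a fixed length.\<close>

section \<open>Lipschitz images and parallel neighbourhoods\<close>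

text \<open>The distance is controlled only between points whose connecting segment lies in \<open>V\<close>.  This is what
the mean value theorem gives on a set that need not be convex, and it is all that the arguments
below use: a point of a parallel neighbourhood is joined to a nearest point by a segment inside it.\<close>

definition lipschitz_on_segments :: "real \<Rightarrow> 'a::euclidean_space set \<Rightarrow> ('a \<Rightarrow> 'a) \<Rightarrow> bool" where
  "lipschitz_on_segments M V g \<longleftrightarrow>
     0 \<le> M \<and> (\<forall>x y. closed_segment x y \<subseteq> V \<longrightarrow> dist (g x) (g y) \<le> M * dist x y)"

lemma lipschitz_on_segments_ball:
  assumes "lipschitz_on_segments M V g" "ball c r \<subseteq> V" "x \<in> ball c r" "y \<in> ball c r"
  shows "dist (g x) (g y) \<le> M * dist x y"
proof -
  have "closed_segment x y \<subseteq> ball c r"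
    using assms by (intro closed_segment_subset) auto
  then show ?thesis
    using assms unfolding lipschitz_on_segments_def by blast
qed

lemma lipschitz_on_segments_continuous_on:
  assumes g: "lipschitz_on_segments M V g" and V: "open V"
  shows "continuous_on V g"
proof (rule continuous_at_imp_continuous_on, rule ballI)
  fix x assume "x \<in> V"
  then obtain r where r: "r > 0" "ball x r \<subseteq> V"
    using V by (meson openE)
  have "M-lipschitz_on (ball x r) g"
    using g lipschitz_on_segments_ball[OF g r(2)]
    by (auto simp: lipschitz_on_def lipschitz_on_segments_def)
  then have "continuous_on (ball x r) g"
    by (rule lipschitz_on_continuous_on)
  then show "isCont g x"
    using r by (simp add: continuous_on_eq_continuous_at)
qed

text \<open>By the Vitali covering theorem, \<open>T\<close> is a disjoint union of balls up to a null set.  The map sends a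
ball into a ball with \<open>M\<close> times the radius, and null sets to null sets.  The enclosing set \<open>B\<close> avoids
the question whether the image of \<open>T\<close> is measurable.\<close>

lemma emeasure_lipschitz_image_le_open:
  fixes g :: "'a::euclidean_space \<Rightarrow> 'a"
  assumes g: "lipschitz_on_segments M V g" and T: "open T" "T \<subseteq> V"
  shows "\<exists>B. B \<in> sets lebesgue \<and> g ` T \<subseteq> B \<and>
           emeasure lebesgue B \<le> ennreal (M ^ DIM('a)) * emeasure lborel T"
proof -
  define K where "K = {(x, r). 0 < r \<and> ball x r \<subseteq> T}"
  have M: "M \<ge> 0"
    using g by (simp add: lipschitz_on_segments_def)
  obtain C where C: "countable C" "C \<subseteq> K"
     "pairwise (\<lambda>i j. disjnt (ball (fst i) (snd i)) (ball (fst j) (snd j))) C"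
     "negligible (T - (\<Union>i \<in> C. ball (fst i) (snd i)))"
  proof (rule Vitali_covering_theorem_balls[of T K fst snd])
    fix x and d :: real assume "x \<in> T" "0 < d"
    moreover then obtain r where "r > 0" "ball x r \<subseteq> T"
      using T by (meson openE)
    ultimately have "(x, min r (d / 2)) \<in> K \<and> x \<in> ball x (min r (d / 2)) \<and> min r (d / 2) < d"
      by (auto simp: K_def)
    then show "\<exists>i. i \<in> K \<and> x \<in> ball (fst i) (snd i) \<and> snd i < d"
      by force
  qed blast
  \<comment> \<open>The countable family is enumerated by \<open>nat\<close>; unused indices get radius \<open>0\<close>, that is, an empty ball.\<close>
  define I where "I = to_nat_on C ` C"
  define c where "c n = fst (from_nat_into C n)" for n
  define \<rho> where "\<rho> n = (if n \<in> I then snd (from_nat_into C n) else 0)" for n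
  have in_C: "from_nat_into C n \<in> C" if "n \<in> I" for n
    using that C(1) by (auto simp: I_def)
  have \<rho>: "\<rho> n \<ge> 0" and sub: "ball (c n) (\<rho> n) \<subseteq> T" for n
    using in_C[of n] C(2)
    by (cases "from_nat_into C n"; auto simp: \<rho>_def c_def K_def less_imp_le subset_iff; blast)+
  have disj: "disjoint_family (\<lambda>n. ball (c n) (\<rho> n))"
    unfolding disjoint_family_on_def
  proof (intro ballI impI)
    fix m n :: nat assume "m \<noteq> n"
    show "ball (c m) (\<rho> m) \<inter> ball (c n) (\<rho> n) = {}"
    proof (cases "m \<in> I \<and> n \<in> I")
      case True
      then have "from_nat_into C m \<noteq> from_nat_into C n"
        using \<open>m \<noteq> n\<close> C(1) by (auto simp: I_def)
      then show ?thesis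
        using True C(3) in_C by (auto simp: pairwise_def disjnt_def c_def \<rho>_def)
    qed (auto simp: \<rho>_def)
  qed
  have Un: "(\<Union>i \<in> C. ball (fst i) (snd i)) \<subseteq> (\<Union>n. ball (c n) (\<rho> n))"
  proof (rule UN_least)
    fix i assume "i \<in> C"
    then have "ball (fst i) (snd i) = ball (c (to_nat_on C i)) (\<rho> (to_nat_on C i))"
      using C(1) by (auto simp: c_def \<rho>_def I_def)
    then show "ball (fst i) (snd i) \<subseteq> (\<Union>n. ball (c n) (\<rho> n))"
      by blast
  qed
  define Z where "Z = T - (\<Union>i \<in> C. ball (fst i) (snd i))"
  have "negligible (g ` Z)"
  proof (rule negligible_locally_Lipschitz_image)
    fix x assume "x \<in> Z"
    then obtain r where r: "r > 0" "ball x r \<subseteq> V"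
      using T by (metis Diff_iff Z_def openE subset_trans)
    have "\<forall>y\<in>Z \<inter> ball x r. norm (g y - g x) \<le> M * norm (y - x)"
      using lipschitz_on_segments_ball[OF g r(2)] r(1) by (auto simp: dist_norm)
    then show "\<exists>T B. open T \<and> x \<in> T \<and> (\<forall>y\<in>Z \<inter> T. norm (g y - g x) \<le> B * norm (y - x))"
      using r(1) by (intro exI[of _ "ball x r"] exI[of _ M]) auto
  qed (use C(4) in \<open>auto simp: Z_def\<close>)
  then have Z0: "g ` Z \<in> null_sets lebesgue"
    by (simp add: negligible_iff_null_sets)
  define B where "B = g ` Z \<union> (\<Union>n. cball (g (c n)) (M * \<rho> n))"
  have meas: "(\<Union>n. cball (g (c n)) (M * \<rho> n)) \<in> sets lebesgue"
    by (intro sets.countable_UN) auto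
  have "g ` T \<subseteq> B"
  proof
    fix y assume "y \<in> g ` T"
    then obtain x where x: "x \<in> T" "y = g x" by blast
    show "y \<in> B"
    proof (cases "x \<in> Z")
      case True
      then show ?thesis using x by (simp add: B_def)
    next
      case False
      then obtain n where n: "x \<in> ball (c n) (\<rho> n)"
        using x subsetD[OF Un, of x] by (auto simp: Z_def simp del: UN_iff)
      then have "c n \<in> ball (c n) (\<rho> n)"
        using dist_not_less_zero[of "c n" x] by (simp add: le_less_trans[OF zero_le_dist])
      with n have "dist (g (c n)) (g x) \<le> M * dist (c n) x"
        using lipschitz_on_segments_ball[OF g, of "c n" "\<rho> n" "c n" x] sub[of n] T by blast
      also have "\<dots> \<le> M * \<rho> n"
        using n M by (intro mult_left_mono) auto
      finally show ?thesis
        using x by (auto simp: B_def)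
    qed
  qed
  moreover have "emeasure lebesgue B \<le> ennreal (M ^ DIM('a)) * emeasure lborel T"
  proof -
    have "emeasure lebesgue B = emeasure lebesgue (\<Union>n. cball (g (c n)) (M * \<rho> n))"
      unfolding B_def using emeasure_Un_null_set[OF meas Z0] by (simp add: Un_commute)
    also have "\<dots> \<le> (\<Sum>n. emeasure lebesgue (cball (g (c n)) (M * \<rho> n)))"
      by (intro emeasure_subadditive_countably) auto
    also have "\<dots> = (\<Sum>n. ennreal (M ^ DIM('a)) * emeasure lborel (ball (c n) (\<rho> n)))"
    proof (intro suminf_cong)
      fix n
      show "emeasure lebesgue (cball (g (c n)) (M * \<rho> n)) =
              ennreal (M ^ DIM('a)) * emeasure lborel (ball (c n) (\<rho> n))"
        using \<rho>[of n] M
        by (simp add: emeasure_cball emeasure_ball power_mult_distrib ennreal_mult'[symmetric] mult_ac)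
    qed
    also have "\<dots> = ennreal (M ^ DIM('a)) * (\<Sum>n. emeasure lborel (ball (c n) (\<rho> n)))"
      by simp
    also have "(\<Sum>n. emeasure lborel (ball (c n) (\<rho> n))) = emeasure lborel (\<Union>n. ball (c n) (\<rho> n))"
      using disj by (intro suminf_emeasure) auto
    also have "ennreal (M ^ DIM('a)) * \<dots> \<le> ennreal (M ^ DIM('a)) * emeasure lborel T"
      using sub T by (intro mult_left_mono emeasure_mono) auto
    finally show ?thesis .
  qed
  moreover have "B \<in> sets lebesgue"
    using Z0 meas by (auto simp: B_def)
  ultimately show ?thesis by blast
qed

text \<open>A compact set has open neighbourhoods of almost the same volume, so the bound for open sets passes
to the limit.\<close>

lemma measure_lipschitz_image_le:
  fixes g :: "'a::euclidean_space \<Rightarrow> 'a"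
  assumes g: "lipschitz_on_segments M V g" and V: "open V" and A: "compact A" "A \<subseteq> V"
  shows "measure lborel (g ` A) \<le> M ^ DIM('a) * measure lborel A"
proof -
  have M: "M \<ge> 0"
    using g by (simp add: lipschitz_on_segments_def)
  have gA: "compact (g ` A)"
    using A lipschitz_on_segments_continuous_on[OF g V]
    by (metis compact_continuous_image continuous_on_subset)
  have bd: "emeasure lborel (g ` A) \<le> ennreal (M ^ DIM('a) * (measure lborel A + e))" if "e > 0" for e
  proof -
    obtain T where T: "open T" "A \<subseteq> T" "(T - A) \<in> lmeasurable" "emeasure lebesgue (T - A) < ennreal e"
      using sets_lebesgue_outer_open[OF fmeasurableD[OF lmeasurable_compact[OF A(1)]] \<open>e > 0\<close>] by blast
    define S where "S = T \<inter> V"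
    have "open S" "S \<subseteq> V" using T V by (auto simp: S_def)
    from emeasure_lipschitz_image_le_open[OF g this]
    obtain B where B: "B \<in> sets lebesgue" "g ` S \<subseteq> B"
      "emeasure lebesgue B \<le> ennreal (M ^ DIM('a)) * emeasure lborel S"
      by blast
    have gB: "emeasure lborel (g ` A) \<le> emeasure lebesgue B"
    proof -
      have "g ` A \<subseteq> B" using A T B by (auto simp: S_def)
      then show ?thesis
        using emeasure_mono[of "g ` A" B lebesgue] B(1) gA
        by (simp add: borel_compact)
    qed
    have S: "emeasure lborel S \<le> ennreal (measure lborel A + e)"
    proof -
      have "emeasure lborel S \<le> emeasure lborel (A \<union> (T - A))"
        using A T by (intro emeasure_mono) (auto simp: S_def borel_compact)
      also have "\<dots> \<le> emeasure lborel A + emeasure lborel (T - A)"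
        using A T by (intro emeasure_subadditive) (auto simp: borel_compact)
      also have "\<dots> \<le> ennreal (measure lborel A) + ennreal e"
      proof (rule add_mono)
        show "emeasure lborel A \<le> ennreal (measure lborel A)"
          using emeasure_compact_finite[OF A(1)] by (simp add: emeasure_eq_ennreal_measure)
        show "emeasure lborel (T - A) \<le> ennreal e"
        proof -
          have "T - A \<in> sets lborel"
            using T A by (auto simp: borel_compact)
          then show ?thesis
            using T(4) by (simp add: less_imp_le)
        qed
      qed
      finally show ?thesis
        using \<open>e > 0\<close> by (simp add: ennreal_plus)
    qed
    note gB
    also note B(3)
    also have "ennreal (M ^ DIM('a)) * emeasure lborel S \<le> ennreal (M ^ DIM('a)) * ennreal (measure lborel A + e)"
      using S by (rule mult_left_mono) simp
    also have "\<dots> = ennreal (M ^ DIM('a) * (measure lborel A + e))"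
      using M \<open>e > 0\<close> by (simp add: ennreal_mult')
    finally show ?thesis .
  qed
  have "measure lborel (g ` A) \<le> M ^ DIM('a) * (measure lborel A + e)" if "e > 0" for e
  proof -
    have "0 \<le> M ^ DIM('a) * (measure lborel A + e)" using M that by simp
    then show ?thesis
      using bd[OF that] emeasure_compact_finite[OF gA]
      by (simp add: emeasure_eq_ennreal_measure)
  qed
  then have ev: "\<forall>\<^sub>F e in at_right 0. measure lborel (g ` A) \<le> M ^ DIM('a) * (measure lborel A + e)"
    by (simp add: eventually_at_right_less eventually_at_filter)
  have "((\<lambda>e. M ^ DIM('a) * (measure lborel A + e)) \<longlongrightarrow> M ^ DIM('a) * (measure lborel A + 0)) (at_right 0)"
    by (intro tendsto_intros)
  then show ?thesis
    using tendsto_le[OF _ _ tendsto_const ev] by (simp add: trivial_limit_at_right_real)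
qed

lemma parallel_nbhd_iff:
  fixes Y :: "'a::heine_borel set"
  assumes "compact Y" "Y \<noteq> {}"
  shows "x \<in> parallel_nbhd Y \<epsilon> \<longleftrightarrow> (\<exists>y\<in>Y. dist y x \<le> \<epsilon>)"
proof
  assume "x \<in> parallel_nbhd Y \<epsilon>"
  moreover obtain y where "y \<in> Y" "infdist x Y = dist x y"
    using infdist_attains_inf[OF compact_imp_closed[OF assms(1)] assms(2)] by blast
  ultimately show "\<exists>y\<in>Y. dist y x \<le> \<epsilon>"
    by (auto simp: parallel_nbhd_def dist_commute)
qed (auto simp: parallel_nbhd_def dist_commute intro: infdist_le2)

lemma parallel_nbhd_mono: "a \<le> b \<Longrightarrow> parallel_nbhd Y a \<subseteq> parallel_nbhd Y b"
  by (auto simp: parallel_nbhd_def)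

lemma compact_parallel_nbhd:
  fixes Y :: "'a::heine_borel set"
  assumes "compact Y" "Y \<noteq> {}" 
  shows "compact (parallel_nbhd Y \<epsilon>)"
proof -
  have "compact (parallel_nbhd Y (max \<epsilon> 1))"
    using assms compact_infdist_le[of Y "max \<epsilon> 1"] by (simp add: parallel_nbhd_def)
  moreover have "parallel_nbhd Y \<epsilon> = parallel_nbhd Y (max \<epsilon> 1) \<inter> {x. infdist x Y \<le> \<epsilon>}"
    by (auto simp: parallel_nbhd_def)
  moreover have "closed {x. infdist x Y \<le> \<epsilon>}"
    by (intro closed_Collect_le continuous_intros)
  ultimately show ?thesis
    by (metis compact_Int_closed)
qed

lemma measure_lborel_mono:
  fixes A B :: "'a::euclidean_space set"
  assumes "A \<subseteq> B" "compact A" "compact B"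
  shows "measure lborel A \<le> measure lborel B"
  using assms emeasure_compact_finite[of B] 
  by (intro measure_mono_fmeasurable) (auto simp: borel_compact fmeasurable_def less_top)

lemma measure_parallel_nbhd_mono:
  fixes Y :: "'a::euclidean_space set"
  assumes "compact Y" "Y \<noteq> {}" "a \<le> b"
  shows "measure lborel (parallel_nbhd Y a) \<le> measure lborel (parallel_nbhd Y b)"
  using assms by (intro measure_lborel_mono compact_parallel_nbhd parallel_nbhd_mono)

lemma measure_parallel_nbhd_pos:
  fixes Y :: "'a::euclidean_space set"
  assumes "compact Y" "Y \<noteq> {}" "0 < \<epsilon>"
  shows "0 < measure lborel (parallel_nbhd Y \<epsilon>)"
proof -
  obtain y where "y \<in> Y" using assms by blast
  then have "cball y \<epsilon> \<subseteq> parallel_nbhd Y \<epsilon>"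
    using assms by (auto simp: parallel_nbhd_iff[OF assms(1,2)])
  then have "measure lborel (cball y \<epsilon>) \<le> measure lborel (parallel_nbhd Y \<epsilon>)"
    using assms by (intro measure_lborel_mono compact_parallel_nbhd) auto
  moreover have "0 < measure lborel (cball y \<epsilon>)"
    using content_cball_pos[OF assms(3), of y] by simp
  ultimately show ?thesis by linarith
qed

lemma eventually_parallel_nbhd_subset:
  fixes Y V :: "'a::euclidean_space set"
  assumes "compact Y" "Y \<noteq> {}" "open V" "Y \<subseteq> V" "c > 0"
  shows "\<forall>\<^sub>F \<epsilon> in at_right 0. parallel_nbhd Y (\<epsilon> / c) \<subseteq> V"
proof -
  obtain e where e: "e > 0" "(\<Union>x\<in>Y. cball x e) \<subseteq> V"
    using compact_subset_open_imp_cball_epsilon_subset assms by metis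
  have "\<forall>\<^sub>F \<epsilon> in at_right 0. \<epsilon> < e * c"
    using e assms eventually_at_right[of 0 "1::real"]  by (intro eventually_at_rightI[of 0 "e * c"]) auto
  then show ?thesis
  proof eventually_elim
    case (elim \<epsilon>)
    then have "\<epsilon> / c < e" using assms by (simp add: divide_simps)
    then show ?case
      using e(2) by (auto simp: parallel_nbhd_iff[OF assms(1,2)] subset_iff) (metis less_imp_le order_trans)
  qed
qed

text \<open>Disjoint compact sets have disjoint open neighbourhoods, which contain all small parallel
neighbourhoods.\<close>

lemma separated_parallel_nbhds_Un:
  fixes X Y :: "'a::euclidean_space set"
  assumes X: "compact X" "X \<noteq> {}" and Y: "compact Y" "Y \<noteq> {}" and disj: "X \<inter> Y = {}"
  shows "\<forall>\<^sub>F \<epsilon> in at_right 0. measure lborel (parallel_nbhd (X \<union> Y) \<epsilon>) =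
           measure lborel (parallel_nbhd X \<epsilon>) + measure lborel (parallel_nbhd Y \<epsilon>)"
proof -
  obtain U V where UV: "open U" "open V" "X \<subseteq> U" "Y \<subseteq> V" "U \<inter> V = {}"
    using separation_normal[of X Y] assms by (auto simp: compact_imp_closed)
  have "\<forall>\<^sub>F \<epsilon> in at_right 0. parallel_nbhd X (\<epsilon> / 1) \<subseteq> U"
    "\<forall>\<^sub>F \<epsilon> in at_right 0. parallel_nbhd Y (\<epsilon> / 1) \<subseteq> V"
    using UV assms by (intro eventually_parallel_nbhd_subset; simp)+
  then show ?thesis
  proof eventually_elim
    case (elim \<epsilon>)
    have "parallel_nbhd (X \<union> Y) \<epsilon> = parallel_nbhd X \<epsilon> \<union> parallel_nbhd Y \<epsilon>"
      by (auto simp: parallel_nbhd_def infdist_Un_min[OF X(2) Y(2)] min_def)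
    moreover have "parallel_nbhd X \<epsilon> \<inter> parallel_nbhd Y \<epsilon> = {}"
      using elim UV by auto
    moreover have "parallel_nbhd Z \<epsilon> \<in> fmeasurable lborel" if "compact Z" "Z \<noteq> {}" for Z :: "'a set"
      using compact_parallel_nbhd[OF that] emeasure_compact_finite
      by (auto simp: fmeasurable_def borel_compact less_top)
    ultimately show ?case
      using measure_Un3[of "parallel_nbhd X \<epsilon>" lborel "parallel_nbhd Y \<epsilon>"] assms by simp
  qed
qed

lemma separated_parallel_nbhds_UN:
  fixes Y :: "'i \<Rightarrow> 'a::euclidean_space set"
  assumes "finite I" "I \<noteq> {}" "\<And>i. i \<in> I \<Longrightarrow> compact (Y i)" "\<And>i. i \<in> I \<Longrightarrow> Y i \<noteq> {}"
    and "disjoint_family_on Y I"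
  shows "\<forall>\<^sub>F \<epsilon> in at_right 0. measure lborel (parallel_nbhd (\<Union>i\<in>I. Y i) \<epsilon>) =
           (\<Sum>i\<in>I. measure lborel (parallel_nbhd (Y i) \<epsilon>))"
  using assms
proof (induction I rule: finite_ne_induct)
  case (singleton x)
  then show ?case by simp
next
  case (insert i I)
  have 1: "\<forall>\<^sub>F \<epsilon> in at_right 0. measure lborel (parallel_nbhd (\<Union>i\<in>I. Y i) \<epsilon>) =
           (\<Sum>i\<in>I. measure lborel (parallel_nbhd (Y i) \<epsilon>))"
    using insert by (intro insert.IH) (auto simp: disjoint_family_on_def)
  have 2: "\<forall>\<^sub>F \<epsilon> in at_right 0. measure lborel (parallel_nbhd (Y i \<union> (\<Union>i\<in>I. Y i)) \<epsilon>) =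
           measure lborel (parallel_nbhd (Y i) \<epsilon>) + measure lborel (parallel_nbhd (\<Union>i\<in>I. Y i) \<epsilon>)"
    using insert by (intro separated_parallel_nbhds_Un compact_UN) (auto simp: disjoint_family_on_def)
  show ?case
    using 1 2 by eventually_elim (use insert in simp)
qed

lemma image_parallel_nbhd_subset:
  fixes Y V :: "'a::euclidean_space set"
  assumes g: "lipschitz_on_segments M V g" and Y: "compact Y" "Y \<noteq> {}" "Y \<subseteq> V"
    and V: "open V" "parallel_nbhd Y \<epsilon> \<subseteq> V"
  shows "g ` parallel_nbhd Y \<epsilon> \<subseteq> parallel_nbhd (g ` Y) (M * \<epsilon>)"
proof
  have gY: "compact (g ` Y)" "g ` Y \<noteq> {}"
    using Y V lipschitz_on_segments_continuous_on[OF g V(1)]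
    by (auto intro: compact_continuous_image continuous_on_subset)
  fix z assume "z \<in> g ` parallel_nbhd Y \<epsilon>"
  then obtain x y where xy: "z = g x" "y \<in> Y" "dist y x \<le> \<epsilon>"
    using parallel_nbhd_iff[OF Y(1,2)] by auto
  have "0 \<le> \<epsilon>" using xy(3) zero_le_dist[of y x] by linarith
  then have "closed_segment y x \<subseteq> cball y \<epsilon>"
    using xy by (intro closed_segment_subset) auto
  also have "\<dots> \<subseteq> parallel_nbhd Y \<epsilon>"
    using xy by (auto simp: parallel_nbhd_iff[OF Y(1,2)])
  finally have "dist (g y) (g x) \<le> M * dist y x"
    using g V by (auto simp: lipschitz_on_segments_def)
  also have "\<dots> \<le> M * \<epsilon>"
    using g xy by (intro mult_left_mono) (auto simp: lipschitz_on_segments_def)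
  finally show "z \<in> parallel_nbhd (g ` Y) (M * \<epsilon>)"
    using xy by (auto simp: parallel_nbhd_iff[OF gY])
qed

text \<open>The first bound comes from applying the inverse \<open>h\<close> to the \<open>\<epsilon>\<close>-neighbourhood of \<open>g Y\<close>, which lands in
the \<open>\<epsilon> / m\<close>-neighbourhood of \<open>Y\<close>; the second one from applying \<open>g\<close> to the \<open>\<epsilon> / M\<close>-neighbourhood
of \<open>Y\<close>.  In each case the other map controls the volume.\<close>

lemma measure_parallel_nbhd_image_bounds:
  fixes Y V W :: "'a::euclidean_space set"
  assumes g: "lipschitz_on_segments M V g" and h: "lipschitz_on_segments (1 / m) W h"
    and VW: "open V" "open W" "g ` V = W" "\<And>x. x \<in> V \<Longrightarrow> h (g x) = x"
    and m: "0 < m" "m \<le> M" and Y: "compact Y" "Y \<noteq> {}" "Y \<subseteq> V"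
    and \<epsilon>: "0 < \<epsilon>" "parallel_nbhd Y (\<epsilon> / m) \<subseteq> V" "parallel_nbhd (g ` Y) \<epsilon> \<subseteq> W"
  shows "measure lborel (parallel_nbhd (g ` Y) \<epsilon>) \<le> M ^ DIM('a) * measure lborel (parallel_nbhd Y (\<epsilon> / m))"
    and "m ^ DIM('a) * measure lborel (parallel_nbhd Y (\<epsilon> / M)) \<le> measure lborel (parallel_nbhd (g ` Y) \<epsilon>)"
proof -
  have cg: "continuous_on V g"
    using lipschitz_on_segments_continuous_on g VW by blast
  have gY: "compact (g ` Y)" "g ` Y \<noteq> {}" "g ` Y \<subseteq> W"
    using Y VW continuous_on_subset[OF cg] by (auto intro: compact_continuous_image)
  have hgY: "h ` g ` Z = Z" if "Z \<subseteq> V" for Z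
    using that VW(4) by (force simp: image_iff)
  have "h ` parallel_nbhd (g ` Y) \<epsilon> \<subseteq> parallel_nbhd (h ` g ` Y) (1 / m * \<epsilon>)"
    using gY VW \<epsilon> by (intro image_parallel_nbhd_subset[OF h]) auto
  then have "h ` parallel_nbhd (g ` Y) \<epsilon> \<subseteq> parallel_nbhd Y (\<epsilon> / m)"
    using hgY[of Y] Y by simp
  moreover have "g (h y) = y" if "y \<in> W" for y
    using that VW(3,4) by auto
  ultimately have sub: "parallel_nbhd (g ` Y) \<epsilon> \<subseteq> g ` parallel_nbhd Y (\<epsilon> / m)"
    using \<epsilon>(3) by (intro subsetI) (force intro: rev_image_eqI)
  have "measure lborel (parallel_nbhd (g ` Y) \<epsilon>) \<le> measure lborel (g ` parallel_nbhd Y (\<epsilon> / m))"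
    using gY Y \<epsilon> continuous_on_subset[OF cg]
    by (intro measure_lborel_mono[OF sub] compact_parallel_nbhd compact_continuous_image)
  also have "\<dots> \<le> M ^ DIM('a) * measure lborel (parallel_nbhd Y (\<epsilon> / m))"
    using Y VW \<epsilon> by (intro measure_lipschitz_image_le[OF g]) (auto intro: compact_parallel_nbhd)
  finally show "measure lborel (parallel_nbhd (g ` Y) \<epsilon>) \<le> M ^ DIM('a) * measure lborel (parallel_nbhd Y (\<epsilon> / m))" .
  define Q where "Q = parallel_nbhd Y (\<epsilon> / M)"
  have "\<epsilon> / M \<le> \<epsilon> / m" using m \<epsilon> by (intro divide_left_mono) auto
  then have Q: "compact Q" "Q \<subseteq> V" "compact (g ` Q)" "g ` Q \<subseteq> W"
    using parallel_nbhd_mono[of "\<epsilon> / M" "\<epsilon> / m" Y] \<epsilon> Y VW continuous_on_subset[OF cg]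
    by (auto simp: Q_def intro!: compact_parallel_nbhd compact_continuous_image)
  have "measure lborel Q = measure lborel (h ` g ` Q)"
    using hgY Q by simp
  also have "\<dots> \<le> (1 / m) ^ DIM('a) * measure lborel (g ` Q)"
    using Q VW by (intro measure_lipschitz_image_le[OF h]) auto
  finally have "m ^ DIM('a) * measure lborel Q \<le> measure lborel (g ` Q)"
    using m by (simp add: power_divide field_simps)
  also have "g ` Q \<subseteq> parallel_nbhd (g ` Y) (M * (\<epsilon> / M))"
    unfolding Q_def using Y VW Q by (intro image_parallel_nbhd_subset[OF g]) (auto simp: Q_def)
  then have "measure lborel (g ` Q) \<le> measure lborel (parallel_nbhd (g ` Y) \<epsilon>)"
    using Q gY m by (intro measure_lborel_mono compact_parallel_nbhd) auto
  finally show "m ^ DIM('a) * measure lborel (parallel_nbhd Y (\<epsilon> / M)) \<le> measure lborel (parallel_nbhd (g ` Y) \<epsilon>)"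
    by (simp add: Q_def)
qed

section \<open>Means of functions at infinity and averaging equations\<close>

definition has_mean :: "(real \<Rightarrow> real) \<Rightarrow> real \<Rightarrow> bool" where
  "has_mean Z x \<longleftrightarrow> ((\<lambda>L. integral {0..L} Z / L) \<longlongrightarrow> x) at_top"

definition locally_integrable :: "(real \<Rightarrow> real) \<Rightarrow> bool" where
  "locally_integrable Z \<longleftrightarrow> (\<forall>a b. Z integrable_on {a..b})"

lemma locally_integrableD: "locally_integrable Z \<Longrightarrow> Z integrable_on {a..b}"
  by (simp add: locally_integrable_def)

lemma has_integral_shift_real:
  fixes Z :: "real \<Rightarrow> real"
  assumes "(Z has_integral i) {a - s..b - s}"
  shows "((\<lambda>t. Z (t - s)) has_integral i) {a..b}"
  using has_integral_affinity[of Z i "a - s" "b - s" 1 "- s"] assms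
  by (simp add: image_add_atLeastAtMost')

lemma locally_integrable_shift:
  "locally_integrable Z \<Longrightarrow> locally_integrable (\<lambda>t. Z (t - s))"
  unfolding locally_integrable_def integrable_on_def using has_integral_shift_real by blast

lemma integral_shift_real:
  fixes Z :: "real \<Rightarrow> real"
  assumes "locally_integrable Z"
  shows "integral {a..b} (\<lambda>t. Z (t - s)) = integral {a - s..b - s} Z"
  using has_integral_shift_real[OF integrable_integral[OF locally_integrableD[OF assms]]]
  by (rule integral_unique)

lemma integral_split:
  assumes "locally_integrable Z" "a \<le> b" "b \<le> c"
  shows "integral {a..c} Z = integral {a..b} Z + integral {b..c} Z"
  using assms by (simp add: Henstock_Kurzweil_Integration.integral_combine locally_integrableD)

lemma tendsto_divide_at_top: "((\<lambda>L::real. c / L) \<longlongrightarrow> 0) at_top"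
  by (intro tendsto_divide_0[OF tendsto_const] filterlim_at_top_imp_at_infinity filterlim_ident)

lemma has_mean_from:
  assumes Z: "locally_integrable Z" and m: "has_mean Z x"
  shows "((\<lambda>L. integral {a..L} Z / L) \<longlongrightarrow> x) at_top"
proof -
  define c where "c = integral {min 0 a..0} Z - integral {min 0 a..a} Z"
  have c: "integral {a..L} Z = integral {0..L} Z + c" if "L \<ge> max 0 a" for L
    using integral_split[OF Z, of "min 0 a" 0 L] integral_split[OF Z, of "min 0 a" a L] that
    by (simp add: c_def)
  have "\<forall>\<^sub>F L in at_top. integral {0..L} Z / L + c / L = integral {a..L} Z / L"
    using eventually_ge_at_top[of "max 0 a"] by eventually_elim (simp only: c add_divide_distrib)
  moreover have "((\<lambda>L. integral {0..L} Z / L + c / L) \<longlongrightarrow> x + 0) at_top"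
    using m unfolding has_mean_def by (intro tendsto_add tendsto_divide_at_top)
  ultimately show ?thesis
    by (simp add: Lim_transform_eventually)
qed

lemma has_mean_const: "has_mean (\<lambda>t. c) c"
  unfolding has_mean_def
proof (rule tendsto_eventually)
  show "\<forall>\<^sub>F L in at_top. integral {0..L} (\<lambda>t. c) / L = c"
    using eventually_gt_at_top[of 0] by eventually_elim simp
qed

lemma has_mean_cmult: "has_mean Z x \<Longrightarrow> has_mean (\<lambda>t. c * Z t) (c * x)"
  unfolding has_mean_def using tendsto_mult_left[of "\<lambda>L. integral {0..L} Z / L" x at_top c] by simp

lemma has_mean_sum:
  assumes "finite I" "\<And>i. i \<in> I \<Longrightarrow> locally_integrable (Z i)" "\<And>i. i \<in> I \<Longrightarrow> has_mean (Z i) (x i)"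
  shows "has_mean (\<lambda>t. \<Sum>i\<in>I. Z i t) (\<Sum>i\<in>I. x i)"
proof -
  have "((\<lambda>L. \<Sum>i\<in>I. integral {0..L} (Z i) / L) \<longlongrightarrow> (\<Sum>i\<in>I. x i)) at_top"
    using assms by (intro tendsto_sum) (auto simp: has_mean_def)
  moreover have "integral {0..L} (\<lambda>t. \<Sum>i\<in>I. Z i t) = (\<Sum>i\<in>I. integral {0..L} (Z i))" for L
    using assms by (intro integral_sum) (auto simp: locally_integrable_def)
  ultimately show ?thesis
    by (simp add: has_mean_def sum_divide_distrib)
qed

lemma locally_integrable_sum:
  assumes "finite I" "\<And>i. i \<in> I \<Longrightarrow> locally_integrable (Z i)"
  shows "locally_integrable (\<lambda>t. \<Sum>i\<in>I. c i * Z i t)"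
  using assms unfolding locally_integrable_def
  by (intro allI integrable_sum) (auto intro: integrable_on_mult_right)

text \<open>Shifting the argument changes the integral over \<open>[0, L]\<close> only through boundary terms, which are of
smaller order than \<open>L\<close> because the means converge.\<close>

lemma has_mean_shift:
  assumes Z: "locally_integrable Z" and m: "has_mean Z x"
  shows "has_mean (\<lambda>t. Z (t - s)) x"
proof -
  have shift: "filterlim (\<lambda>L. L - s) at_top at_top"
    using filterlim_tendsto_add_at_top[OF tendsto_const[of "- s"] filterlim_ident] by simp
  have "((\<lambda>L. integral {-s..L - s} Z / (L - s)) \<longlongrightarrow> x) at_top"
    using filterlim_compose[OF has_mean_from[OF Z m, of "-s"] shift] .
  moreover have "((\<lambda>L. 1 - s / L) \<longlongrightarrow> 1 - 0) at_top"
    by (intro tendsto_diff tendsto_const tendsto_divide_at_top)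
  ultimately have "((\<lambda>L. (integral {-s..L - s} Z / (L - s)) * (1 - s / L)) \<longlongrightarrow> x * (1 - 0)) at_top"
    by (rule tendsto_mult)
  moreover have "\<forall>\<^sub>F L in at_top. (integral {-s..L - s} Z / (L - s)) * (1 - s / L)
      = integral {0..L} (\<lambda>t. Z (t - s)) / L"
    using eventually_gt_at_top[of s] eventually_gt_at_top[of 0]
  proof eventually_elim
    case (elim L)
    then have "1 - s / L = (L - s) / L"
      by (simp add: diff_divide_distrib)
    with elim show ?case
      by (simp add: integral_shift_real[OF Z])
  qed
  ultimately show ?thesis
    unfolding has_mean_def by (simp add: Lim_transform_eventually)
qed

lemma integral_mean_le:
  assumes X: "locally_integrable X" and Y: "locally_integrable Y" and le: "\<forall>\<^sub>F t in at_top. X t \<le> Y t"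
  obtains c where "\<forall>\<^sub>F L in at_top. integral {0..L} X / L \<le> integral {0..L} Y / L + c / L"
proof -
  obtain a where a: "\<And>t. t \<ge> a \<Longrightarrow> X t \<le> Y t"
    using le by (auto simp: eventually_at_top_linorder)
  define b where "b = max a 1"
  define c where "c = integral {0..b} X - integral {0..b} Y"
  have "\<forall>\<^sub>F L in at_top. integral {0..L} X / L \<le> integral {0..L} Y / L + c / L"
    using eventually_ge_at_top[of b]
  proof eventually_elim
    case (elim L)
    have "integral {b..L} X \<le> integral {b..L} Y"
      using X Y a by (intro integral_le) (auto simp: locally_integrable_def b_def)
    then have "integral {0..L} X \<le> integral {0..L} Y + c"
      using integral_split[OF X, of 0 b L] integral_split[OF Y, of 0 b L] elim
      by (simp add: b_def c_def)
    then have "integral {0..L} X / L \<le> (integral {0..L} Y + c) / L"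
      using elim by (intro divide_right_mono) (auto simp: b_def)
    then show ?case
      by (simp add: add_divide_distrib)
  qed
  then show ?thesis by (rule that)
qed

lemma has_mean_mono:
  assumes X: "locally_integrable X" "has_mean X x" and Y: "locally_integrable Y" "has_mean Y y"
    and le: "\<forall>\<^sub>F t in at_top. X t \<le> Y t"
  shows "x \<le> y"
proof -
  obtain c where c: "\<forall>\<^sub>F L in at_top. integral {0..L} X / L \<le> integral {0..L} Y / L + c / L"
    using integral_mean_le[OF X(1) Y(1) le] by blast
  have "((\<lambda>L. integral {0..L} Y / L + c / L) \<longlongrightarrow> y + 0) at_top"
    using Y(2) unfolding has_mean_def by (intro tendsto_add tendsto_divide_at_top)
  from tendsto_le[OF _ this X(2)[unfolded has_mean_def] c] show ?thesis
    by simp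
qed

lemma tendsto_squeeze_approx:
  fixes f :: "'a \<Rightarrow> real"
  assumes "\<And>\<eta>. \<eta> > 0 \<Longrightarrow> \<exists>l u x y. (l \<longlongrightarrow> x) F \<and> (u \<longlongrightarrow> y) F \<and> c - \<eta> \<le> x \<and> y \<le> c + \<eta> \<and>
             (\<forall>\<^sub>F t in F. l t \<le> f t \<and> f t \<le> u t)"
  shows "(f \<longlongrightarrow> c) F"
proof (rule tendstoI)
  fix e :: real assume "e > 0"
  then obtain l u x y where *: "(l \<longlongrightarrow> x) F" "(u \<longlongrightarrow> y) F" "c - e / 2 \<le> x" "y \<le> c + e / 2"
    "\<forall>\<^sub>F t in F. l t \<le> f t \<and> f t \<le> u t"
    using assms[of "e / 2"] by auto
  have "\<forall>\<^sub>F t in F. c - e < l t" "\<forall>\<^sub>F t in F. u t < c + e"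
    using * \<open>e > 0\<close> by (auto intro: order_tendstoD)
  then show "\<forall>\<^sub>F t in F. dist (f t) c < e"
    using *(5) by eventually_elim (auto simp: dist_real_def)
qed

text \<open>The bounding functions may depend on the tolerance \<open>\<eta>\<close>, and they need to enclose \<open>Z\<close> only from some
point on: an initial segment contributes \<open>c / L\<close> to the mean.\<close>

lemma has_mean_squeeze:
  assumes Z: "locally_integrable Z"
    and approx: "\<And>\<eta>. \<eta> > 0 \<Longrightarrow> \<exists>l u x y. locally_integrable l \<and> locally_integrable u \<and>
        has_mean l x \<and> has_mean u y \<and> c - \<eta> \<le> x \<and> y \<le> c + \<eta> \<and> (\<forall>\<^sub>F t in at_top. l t \<le> Z t \<and> Z t \<le> u t)"
  shows "has_mean Z c"
  unfolding has_mean_def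
proof (rule tendsto_squeeze_approx)
  fix \<eta> :: real assume "\<eta> > 0"
  then obtain l u x y where *: "locally_integrable l" "locally_integrable u"
        "has_mean l x" "has_mean u y" "c - \<eta> \<le> x" "y \<le> c + \<eta>" 
        "\<forall>\<^sub>F t in at_top. l t \<le> Z t \<and> Z t \<le> u t"
    using approx[OF \<open>\<eta> > 0\<close>] by blast
  have ev: "\<forall>\<^sub>F t in at_top. l t \<le> Z t" "\<forall>\<^sub>F t in at_top. Z t \<le> u t"
    using *(7) by (auto elim: eventually_mono)
  obtain a where a: "\<forall>\<^sub>F L in at_top. integral {0..L} l / L \<le> integral {0..L} Z / L + a / L"
    using integral_mean_le[OF *(1) Z ev(1)] by blast
  obtain b where b: "\<forall>\<^sub>F L in at_top. integral {0..L} Z / L \<le> integral {0..L} u / L + b / L"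
    using integral_mean_le[OF Z *(2) ev(2)] by blast
  define l' where "l' L = integral {0..L} l / L - a / L" for L
  define u' where "u' L = integral {0..L} u / L + b / L" for L
  have "(l' \<longlongrightarrow> x - 0) at_top"
    using *(3) unfolding has_mean_def l'_def by (intro tendsto_diff tendsto_divide_at_top)
  moreover have "(u' \<longlongrightarrow> y + 0) at_top"
    using *(4) unfolding has_mean_def u'_def by (intro tendsto_add tendsto_divide_at_top)
  moreover have "\<forall>\<^sub>F L in at_top. l' L \<le> integral {0..L} Z / L \<and> integral {0..L} Z / L \<le> u' L"
    using a b unfolding l'_def u'_def by eventually_elim linarith
  ultimately show "\<exists>l u x y. (l \<longlongrightarrow> x) at_top \<and> (u \<longlongrightarrow> y) at_top \<and> c - \<eta> \<le> x \<and> y \<le> c + \<eta> \<and>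
     (\<forall>\<^sub>F L in at_top. l L \<le> integral {0..L} Z / L \<and> integral {0..L} Z / L \<le> u L)"
    using *(5,6) by auto
qed

lemma tendsto_imp_has_mean:
  assumes Z: "locally_integrable Z" and y: "(Z \<longlongrightarrow> y) at_top"
  shows "has_mean Z y"
proof (rule has_mean_squeeze[OF Z])
  fix \<eta> :: real assume "0 < \<eta>"
  then have "y - \<eta> < y" "y < y + \<eta>" by simp_all
  from order_tendstoD(1)[OF y this(1)] order_tendstoD(2)[OF y this(2)]
  have "\<forall>\<^sub>F t in at_top. y - \<eta> \<le> Z t \<and> Z t \<le> y + \<eta>"
    by eventually_elim auto
  then show "\<exists>l u x z. locally_integrable l \<and> locally_integrable u \<and> has_mean l x \<and> has_mean u z \<and>
      y - \<eta> \<le> x \<and> z \<le> y + \<eta> \<and> (\<forall>\<^sub>F t in at_top. l t \<le> Z t \<and> Z t \<le> u t)"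
    by (intro exI[of _ "\<lambda>t. y - \<eta>"] exI[of _ "\<lambda>t. y + \<eta>"] exI[of _ "y - \<eta>"] exI[of _ "y + \<eta>"])
      (auto simp: locally_integrable_def intro: has_mean_const)
qed

text \<open>Each value for \<open>t \<ge> t1\<close> is an average of values that are at least \<open>a\<close> and at most \<open>b\<close> earlier.  So a
bound on the initial window \<open>[t1 - b, t1]\<close> propagates by steps of length \<open>a\<close>.\<close>

lemma averaging_le:
  fixes E :: "real \<Rightarrow> real"
  assumes I: "finite I" and p: "\<And>i. i \<in> I \<Longrightarrow> 0 \<le> p i" "(\<Sum>i\<in>I. p i) = 1"
    and s: "\<And>i. i \<in> I \<Longrightarrow> a \<le> s i \<and> s i \<le> b" "0 < a"
    and eq: "\<And>t. t \<ge> t1 \<Longrightarrow> E t = (\<Sum>i\<in>I. p i * E (t - s i))"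
    and init: "\<And>t. t1 - b \<le> t \<Longrightarrow> t \<le> t1 \<Longrightarrow> E t \<le> B"
    and t: "t1 - b \<le> t"
  shows "E t \<le> B"
proof -
  have "E t \<le> B" if "t1 - b \<le> t" "t \<le> t1 + real n * a" for n t
    using that
  proof (induction n arbitrary: t)
    case 0
    then show ?case using init by simp
  next
    case (Suc n)
    show ?case
    proof (cases "t \<le> t1")
      case True
      then show ?thesis using init Suc.prems by simp
    next
      case False
      have "E t = (\<Sum>i\<in>I. p i * E (t - s i))"
        using eq False by simp
      also have "\<dots> \<le> (\<Sum>i\<in>I. p i * B)"
      proof (intro sum_mono mult_left_mono)
        fix i assume "i \<in> I"
        then show "E (t - s i) \<le> B"
          using Suc.prems False s(1)[of i] by (intro Suc.IH) (auto simp: algebra_simps)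
      qed (use p in auto)
      also have "\<dots> = B"
        using p by (simp flip: sum_distrib_right)
      finally show ?thesis .
    qed
  qed
  moreover obtain n where "(t - t1) / a \<le> real n"
    using real_arch_simple by blast
  then have "t \<le> t1 + real n * a"
    using s(2) by (simp add: field_simps)
  ultimately show ?thesis
    using t by blast
qed

lemma averaging_ge:
  fixes E :: "real \<Rightarrow> real"
  assumes I: "finite I" and p: "\<And>i. i \<in> I \<Longrightarrow> 0 \<le> p i" "(\<Sum>i\<in>I. p i) = 1"
    and s: "\<And>i. i \<in> I \<Longrightarrow> a \<le> s i \<and> s i \<le> b" "0 < a"
    and eq: "\<And>t. t \<ge> t1 \<Longrightarrow> E t = (\<Sum>i\<in>I. p i * E (t - s i))"
    and init: "\<And>t. t1 - b \<le> t \<Longrightarrow> t \<le> t1 \<Longrightarrow> B \<le> E t"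
    and t: "t1 - b \<le> t"
  shows "B \<le> E t"
  using averaging_le[OF I p s, where E = "\<lambda>t. - E t" and B = "- B" and ?t1.0 = t1 and t = t]
    eq init t by (simp add: sum_negf)

text \<open>Integrating the equation shows that the primitive \<open>G\<close> satisfies \<open>G(t) = q + \<Sum>\<^sub>i p\<^sub>i G(t - s\<^sub>i)\<close> with a
constant \<open>q\<close>.  The linear function of slope \<open>q / m\<close>, where \<open>m = \<Sum>\<^sub>i p\<^sub>i s\<^sub>i\<close>, satisfies the same
inhomogeneous equation, so the difference \<open>E\<close> of the two solves the homogeneous one and is bounded.
Hence \<open>q / m\<close> is the mean.\<close>

theorem averaging_has_mean:
  fixes Z :: "real \<Rightarrow> real"
  assumes I: "finite I" and p: "\<And>i. i \<in> I \<Longrightarrow> 0 < p i" "(\<Sum>i\<in>I. p i) = 1"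
    and s: "\<And>i. i \<in> I \<Longrightarrow> 0 < s i"
    and Z: "locally_integrable Z"
    and eq: "\<And>t. t \<ge> t1 \<Longrightarrow> Z t = (\<Sum>i\<in>I. p i * Z (t - s i))"
  shows "\<exists>x. has_mean Z x"
proof -
  have "I \<noteq> {}" using p(2) by auto
  define a where "a = Min (s ` I)"
  define b where "b = Max (s ` I)"
  have ab: "a \<le> s i \<and> s i \<le> b" if "i \<in> I" for i
    using that I by (auto simp: a_def b_def)
  have "0 < a"
    using s I \<open>I \<noteq> {}\<close> by (auto simp: a_def)
  define c where "c = t1 - b"
  define G where "G t = integral {c..t} Z" for t
  define m where "m = (\<Sum>i\<in>I. p i * s i)"
  have "m > 0"
    unfolding m_def using p s I \<open>I \<noteq> {}\<close> by (intro sum_pos) auto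
  define q where "q = G t1 - (\<Sum>i\<in>I. p i * G (t1 - s i))"
  define E where "E t = G t - q / m * t" for t
  have G: "G t = q + (\<Sum>i\<in>I. p i * G (t - s i))" if "t \<ge> t1" for t
  proof -
    have "integral {t1..t} Z = integral {t1..t} (\<lambda>u. \<Sum>i\<in>I. p i * Z (u - s i))"
      using eq by (intro integral_cong) auto
    also have "\<dots> = (\<Sum>i\<in>I. integral {t1..t} (\<lambda>u. p i * Z (u - s i)))"
      using I locally_integrable_shift[OF Z]
      by (intro integral_sum) (auto intro!: integrable_on_mult_right simp: locally_integrable_def)
    also have "\<dots> = (\<Sum>i\<in>I. p i * (G (t - s i) - G (t1 - s i)))"
    proof (intro sum.cong refl)
      fix i assume "i \<in> I"
      then have "G (t - s i) = G (t1 - s i) + integral {t1 - s i..t - s i} Z"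
        unfolding G_def using ab that by (intro integral_split[OF Z]) (auto simp: c_def)
      then show "integral {t1..t} (\<lambda>u. p i * Z (u - s i)) = p i * (G (t - s i) - G (t1 - s i))"
        by (simp add: integral_shift_real[OF Z])
    qed
    finally have "integral {t1..t} Z = (\<Sum>i\<in>I. p i * G (t - s i)) - (\<Sum>i\<in>I. p i * G (t1 - s i))"
      by (simp add: right_diff_distrib sum_subtractf)
    moreover have "0 \<le> b"
      using ab \<open>0 < a\<close> \<open>I \<noteq> {}\<close> by fastforce
    then have "G t = G t1 + integral {t1..t} Z"
      unfolding G_def using that by (intro integral_split[OF Z]) (auto simp: c_def)
    ultimately show ?thesis
      by (simp add: q_def)
  qed
  have E: "E t = (\<Sum>i\<in>I. p i * E (t - s i))" if "t \<ge> t1" for t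
  proof -
    have "(\<Sum>i\<in>I. p i * E (t - s i))
        = (\<Sum>i\<in>I. p i * G (t - s i) - p i * (q / m * t) + q / m * (p i * s i))"
      by (intro sum.cong refl) (simp add: E_def algebra_simps)
    also have "\<dots> = (\<Sum>i\<in>I. p i * G (t - s i)) - (\<Sum>i\<in>I. p i) * (q / m * t) + q / m * m"
      by (simp only: sum.distrib sum_subtractf sum_distrib_right sum_distrib_left m_def)
    also have "\<dots> = E t"
      using G[OF that] p(2) \<open>m > 0\<close> by (simp add: E_def)
    finally show ?thesis ..
  qed
  have "continuous_on {c..t1} E"
    unfolding E_def G_def using Z
    by (intro continuous_intros indefinite_integral_continuous_1 locally_integrableD)
  then have "bounded (E ` {c..t1})"
    by (intro compact_imp_bounded compact_continuous_image) auto
  then obtain B where B: "\<forall>t\<in>{c..t1}. \<bar>E t\<bar> \<le> B"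
    unfolding bounded_iff by auto
  have bound: "\<bar>E t\<bar> \<le> B" if "t \<ge> c" for t
  proof -
    have "E t \<le> B"
    proof (rule averaging_le[OF I less_imp_le[OF p(1)] p(2) ab \<open>0 < a\<close> E])
      show "E u \<le> B" if "t1 - b \<le> u" "u \<le> t1" for u
      proof -
        have "u \<in> {c..t1}" using that by (simp add: c_def)
        with B have "\<bar>E u\<bar> \<le> B" by blast
        then show ?thesis by linarith
      qed
    qed (use that in \<open>auto simp: c_def\<close>)
    moreover have "- B \<le> E t"
    proof (rule averaging_ge[OF I less_imp_le[OF p(1)] p(2) ab \<open>0 < a\<close> E])
      show "- B \<le> E u" if "t1 - b \<le> u" "u \<le> t1" for u
      proof -
        have "u \<in> {c..t1}" using that by (simp add: c_def)
        with B have "\<bar>E u\<bar> \<le> B" by blast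
        then show ?thesis by linarith
      qed
    qed (use that in \<open>auto simp: c_def\<close>)
    ultimately show ?thesis by linarith
  qed
  have "((\<lambda>t. E t / t) \<longlongrightarrow> 0) at_top"
  proof (rule Lim_null_comparison[OF _ tendsto_divide_at_top[of B]])
    show "\<forall>\<^sub>F t in at_top. norm (E t / t) \<le> B / t"
      using eventually_ge_at_top[of c] eventually_gt_at_top[of 0]
      by eventually_elim (use bound in \<open>auto intro: divide_right_mono\<close>)
  qed
  then have "((\<lambda>t. q / m + E t / t) \<longlongrightarrow> q / m + 0) at_top"
    by (intro tendsto_add tendsto_const)
  moreover have "\<forall>\<^sub>F t in at_top. q / m + E t / t = integral {c..t} Z / t"
    using eventually_gt_at_top[of 0]
    by eventually_elim (simp add: E_def G_def diff_divide_distrib)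
  ultimately have "((\<lambda>t. integral {c..t} Z / t) \<longlongrightarrow> q / m) at_top"
    by (simp add: Lim_transform_eventually)
  moreover define k where "k = integral {min 0 c..c} Z - integral {min 0 c..0} Z"
  ultimately have "((\<lambda>t. integral {c..t} Z / t + k / t) \<longlongrightarrow> q / m + 0) at_top"
    by (intro tendsto_add tendsto_divide_at_top)
  moreover have "\<forall>\<^sub>F t in at_top. integral {c..t} Z / t + k / t = integral {0..t} Z / t"
    using eventually_ge_at_top[of "max 0 c"]
  proof eventually_elim
    case (elim t)
    then have "integral {0..t} Z = integral {c..t} Z + k"
      using integral_split[OF Z, of "min 0 c" 0 t] integral_split[OF Z, of "min 0 c" c t]
      by (simp add: k_def)
    then show ?case by (simp add: add_divide_distrib)
  qed
  ultimately show ?thesis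
    unfolding has_mean_def by (auto intro: Lim_transform_eventually)
qed

section \<open>Minkowski contents on the logarithmic scale\<close>

text \<open>The same quantity as \<open>rescaled_volume\<close>, but with the exponent as a parameter: it can be studied
before \<open>\<delta>\<close> is known to be the Minkowski dimension of \<open>Y\<close>.\<close>

definition scaled_volume :: "real \<Rightarrow> 'a::euclidean_space set \<Rightarrow> real \<Rightarrow> real" where
  "scaled_volume \<delta> Y \<epsilon> = \<epsilon> powr (\<delta> - real DIM('a)) * measure lborel (parallel_nbhd Y \<epsilon>)"

definition log_volume :: "real \<Rightarrow> 'a::euclidean_space set \<Rightarrow> real \<Rightarrow> real" where
  "log_volume \<delta> Y t = scaled_volume \<delta> Y (exp (- t))"

lemma filterlim_exp_minus_at_right: "filterlim (\<lambda>t::real. exp (- t)) (at_right 0) at_top"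
  unfolding filterlim_at using filterlim_compose[OF exp_at_bot filterlim_uminus_at_bot_at_top] by simp

lemma filterlim_minus_ln_at_top: "filterlim (\<lambda>\<epsilon>::real. - ln \<epsilon>) at_top (at_right 0)"
  using ln_at_0 by (simp add: filterlim_uminus_at_top)

lemma set_integrable_continuous_times_mono:
  fixes h V :: "real \<Rightarrow> real"
  assumes h: "continuous_on {a..b} h" and V: "mono V"
  shows "set_integrable lborel {a..b} (\<lambda>x. h x * V x)"
proof -
  have "bounded (h ` {a..b})"
    using h by (intro compact_imp_bounded compact_continuous_image) auto
  then obtain B where B: "\<forall>x\<in>{a..b}. \<bar>h x\<bar> \<le> B"
    unfolding bounded_iff by auto
  define C where "C = \<bar>V a\<bar> + \<bar>V b\<bar>"
  have C: "\<bar>V x\<bar> \<le> C" if "x \<in> {a..b}" for x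
    using monoD[OF V, of a x] monoD[OF V, of x b] that by (auto simp: C_def)
  have meas: "(\<lambda>x. indicator {a..b} x *\<^sub>R h x) \<in> borel_measurable borel"
    using h by (intro borel_measurable_continuous_on_indicator) auto
  have V': "V \<in> borel_measurable borel"
    using V by (rule borel_measurable_mono)
  have "(\<lambda>x. (indicator {a..b} x *\<^sub>R h x) * V x) \<in> borel_measurable borel"
    using meas V' by (rule borel_measurable_times)
  then have meas': "(\<lambda>x. indicator {a..b} x *\<^sub>R (h x * V x)) \<in> borel_measurable lborel"
    by (simp add: mult_ac)
  have "norm (indicator {a..b} x *\<^sub>R (h x * V x)) \<le> B * C" if x: "x \<in> {a..b}" for x
  proof -
    have "\<bar>h x\<bar> * \<bar>V x\<bar> \<le> B * C"
      using B C[OF x] x by (intro mult_mono) (auto intro: order_trans[OF abs_ge_zero])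
    then show ?thesis
      using x by (simp add: abs_mult)
  qed
  then show ?thesis
    unfolding set_integrable_def
    by (intro integrableI_bounded_set[where A = "{a..b}" and B = "B * C"] meas' emeasure_compact_finite)
      (auto simp: indicator_def)
qed

lemma mono_measure_parallel_nbhd:
  fixes Y :: "'a::euclidean_space set"
  assumes "compact Y" "Y \<noteq> {}"
  shows "mono (\<lambda>\<epsilon>. measure lborel (parallel_nbhd Y \<epsilon>))"
  using measure_parallel_nbhd_mono[OF assms] by (rule monoI)

lemma locally_integrable_log_volume:
  fixes Y :: "'a::euclidean_space set"
  assumes "compact Y" "Y \<noteq> {}"
  shows "locally_integrable (log_volume \<delta> Y)"
  unfolding locally_integrable_def
proof (intro allI)
  fix a b :: real
  have "mono (\<lambda>t. - measure lborel (parallel_nbhd Y (exp (- t))))"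
    by (rule monoI) (simp add: measure_parallel_nbhd_mono[OF assms])
  then have "set_integrable lborel {a..b}
      (\<lambda>t. - (exp (- t) powr (\<delta> - real DIM('a))) * - measure lborel (parallel_nbhd Y (exp (- t))))"
    by (intro set_integrable_continuous_times_mono continuous_intros) auto
  then show "log_volume \<delta> Y integrable_on {a..b}"
    using set_borel_integral_eq_integral(1) by (simp add: log_volume_def[abs_def] scaled_volume_def)
qed

text \<open>The substitution \<open>\<epsilon> = e\<^sup>-\<^sup>t\<close> turns \<open>d\<epsilon> / \<epsilon>\<close> into \<open>dt\<close>.\<close>

lemma log_average_eq:
  fixes Y :: "'a::euclidean_space set"
  assumes Y: "compact Y" "Y \<noteq> {}" and dim: "minkowski_dim Y = \<delta>" and T: "0 < T" "T < 1"
  shows "log_average Y T = integral {0..- ln T} (log_volume \<delta> Y) / (- ln T)"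
proof -
  define L where "L = - ln T"
  have L: "L > 0" "exp (- L) = T" using T by (auto simp: L_def)
  define f where "f = (\<lambda>\<epsilon>. rescaled_volume Y \<epsilon> / \<epsilon>)"
  have "set_integrable lborel {exp (- L)..exp 0}
      (\<lambda>\<epsilon>. (\<epsilon> powr (\<delta> - real DIM('a)) / \<epsilon>) * measure lborel (parallel_nbhd Y \<epsilon>))"
    using Y T L
    by (intro set_integrable_continuous_times_mono mono_measure_parallel_nbhd continuous_intros) auto
  then have int: "set_integrable lborel {exp (- L)..exp 0} f"
    by (simp add: f_def rescaled_volume_def dim)
  note sub = integral_substitution[where g = exp and g' = exp, OF int]
  have fexp: "f (exp x) * exp x = log_volume \<delta> Y (- x)" for x
    by (simp add: f_def rescaled_volume_def dim log_volume_def scaled_volume_def)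
  have 1: "set_integrable lborel {- L..0} (\<lambda>x. log_volume \<delta> Y (- x))"
    using sub(1) L continuous_on_exp[OF continuous_on_id, of "{- L..0}"]
    by (auto simp: fexp intro!: derivative_eq_intros)
  have "(LBINT \<epsilon>:{T..1}. f \<epsilon>) = (LBINT x. f x * indicator {exp (- L)..exp 0} x)"
    by (simp add: set_lebesgue_integral_def L(2) mult.commute)
  also have "\<dots> = (LBINT x. f (exp x) * exp x * indicator {- L..0} x)"
    using L by (intro sub(2)) (auto intro!: derivative_eq_intros continuous_intros)
  also have "\<dots> = (LBINT x:{- L..0}. log_volume \<delta> Y (- x))"
    unfolding set_lebesgue_integral_def by (simp only: fexp real_scaleR_def) (simp only: mult.commute)
  also have "\<dots> = integral {- L..- 0} (\<lambda>x. log_volume \<delta> Y (- x))"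
    using set_borel_integral_eq_integral(2)[OF 1] by simp
  also have "\<dots> = integral {0..L} (log_volume \<delta> Y)"
    by (rule Henstock_Kurzweil_Integration.integral_reflect_real)
  finally show ?thesis
    using L T by (simp add: log_average_def f_def L_def divide_simps)
qed

lemma eventually_scaled_volume_bounds:
  assumes "\<forall>\<^sub>F t in at_top. a \<le> log_volume \<delta> Y t \<and> log_volume \<delta> Y t \<le> b"
  shows "\<forall>\<^sub>F \<epsilon> in at_right 0. a \<le> scaled_volume \<delta> Y \<epsilon> \<and> scaled_volume \<delta> Y \<epsilon> \<le> b"
proof -
  have "\<forall>\<^sub>F \<epsilon>::real in at_right 0. 0 < \<epsilon>"
    by (rule eventually_at_right_less)
  with eventually_compose_filterlim[OF assms filterlim_minus_ln_at_top] show ?thesis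
    by eventually_elim (simp add: log_volume_def)
qed

text \<open>If \<open>q(\<epsilon>) = \<epsilon>\<^sup>\<delta>\<^sup>-\<^sup>D V(\<epsilon>)\<close> stays between positive constants, then
\<open>ln V(\<epsilon>) / ln \<epsilon> = (D - \<delta>) + ln q(\<epsilon>) / ln \<epsilon>\<close>, where the last term tends to \<open>0\<close>.\<close>

lemma has_minkowski_dimI:
  fixes Y :: "'a::euclidean_space set"
  assumes Y: "compact Y" "Y \<noteq> {}" and a: "a > 0"
    and bd: "\<forall>\<^sub>F \<epsilon> in at_right 0. a \<le> scaled_volume \<delta> Y \<epsilon> \<and> scaled_volume \<delta> Y \<epsilon> \<le> b"
  shows "has_minkowski_dim Y \<delta>"
proof -
  define D where "D = real DIM('a)"
  define C where "C = \<bar>ln a\<bar> + \<bar>ln b\<bar>"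
  have small: "\<forall>\<^sub>F \<epsilon>::real in at_right 0. 0 < \<epsilon> \<and> \<epsilon> < 1"
    by (rule eventually_at_rightI[of 0 1]) auto
  have "((\<lambda>\<epsilon>. ln (scaled_volume \<delta> Y \<epsilon>) / ln \<epsilon>) \<longlongrightarrow> 0) (at_right 0)"
  proof (rule Lim_null_comparison)
    show "((\<lambda>\<epsilon>. C / - ln \<epsilon>) \<longlongrightarrow> 0) (at_right 0)"
      by (rule filterlim_compose[OF tendsto_divide_at_top filterlim_minus_ln_at_top])
    show "\<forall>\<^sub>F \<epsilon> in at_right 0. norm (ln (scaled_volume \<delta> Y \<epsilon>) / ln \<epsilon>) \<le> C / - ln \<epsilon>"
      using bd small
    proof eventually_elim
      case (elim \<epsilon>)
      have "ln a \<le> ln (scaled_volume \<delta> Y \<epsilon>)" "ln (scaled_volume \<delta> Y \<epsilon>) \<le> ln b"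
        using elim a by auto
      then have "\<bar>ln (scaled_volume \<delta> Y \<epsilon>)\<bar> \<le> C"
        by (auto simp: C_def)
      moreover have "ln \<epsilon> < 0" using elim by simp
      ultimately show ?case
        by (simp add: abs_divide divide_right_mono_neg divide_simps)
    qed
  qed
  then have "((\<lambda>\<epsilon>. ln (scaled_volume \<delta> Y \<epsilon>) / ln \<epsilon> + (D - \<delta>)) \<longlongrightarrow> 0 + (D - \<delta>)) (at_right 0)"
    by (intro tendsto_intros)
  moreover have "\<forall>\<^sub>F \<epsilon> in at_right 0. ln (scaled_volume \<delta> Y \<epsilon>) / ln \<epsilon> + (D - \<delta>) =
      ln (measure lborel (parallel_nbhd Y \<epsilon>)) / ln \<epsilon>"
    using small
  proof eventually_elim
    case (elim \<epsilon>)
    have "ln (scaled_volume \<delta> Y \<epsilon>) = (\<delta> - D) * ln \<epsilon> + ln (measure lborel (parallel_nbhd Y \<epsilon>))"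
      using measure_parallel_nbhd_pos[OF Y, of \<epsilon>] elim
      by (simp add: scaled_volume_def D_def ln_mult ln_powr)
    then show ?case
      using elim by (simp add: add_divide_distrib)
  qed
  ultimately have "((\<lambda>\<epsilon>. ln (measure lborel (parallel_nbhd Y \<epsilon>)) / ln \<epsilon>) \<longlongrightarrow> D - \<delta>) (at_right 0)"
    by (simp add: Lim_transform_eventually)
  then have "((\<lambda>\<epsilon>. ereal (ln (measure lborel (parallel_nbhd Y \<epsilon>)) / ln \<epsilon>)) \<longlongrightarrow> ereal (D - \<delta>)) (at_right 0)"
    by (intro tendsto_ereal)
  from lim_imp_Liminf[OF trivial_limit_at_right_real this] lim_imp_Limsup[OF trivial_limit_at_right_real this]
  show ?thesis
    unfolding has_minkowski_dim_def upper_minkowski_dim_def lower_minkowski_dim_def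
    by (simp add: D_def)
qed

lemma minkowski_dim_eq: "has_minkowski_dim Y \<delta> \<Longrightarrow> minkowski_dim Y = \<delta>"
  unfolding minkowski_dim_def by (rule the_equality) (auto simp: has_minkowski_dim_def)

lemma average_contentI:
  fixes Y :: "'a::euclidean_space set"
  assumes Y: "compact Y" "Y \<noteq> {}" and dim: "has_minkowski_dim Y \<delta>" and m: "has_mean (log_volume \<delta> Y) x"
  shows "has_average_content Y" "average_content Y = ereal x"
proof -
  have "((\<lambda>T. integral {0..- ln T} (log_volume \<delta> Y) / (- ln T)) \<longlongrightarrow> x) (at_right 0)"
    using m unfolding has_mean_def by (rule filterlim_compose[OF _ filterlim_minus_ln_at_top])
  moreover have "\<forall>\<^sub>F T in at_right 0. integral {0..- ln T} (log_volume \<delta> Y) / (- ln T) = log_average Y T"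
    using log_average_eq[OF Y minkowski_dim_eq[OF dim]] by (intro eventually_at_rightI[of 0 1]) auto
  ultimately have "(log_average Y \<longlongrightarrow> x) (at_right 0)"
    by (rule Lim_transform_eventually)
  then have lim: "((\<lambda>T. ereal (log_average Y T)) \<longlongrightarrow> ereal x) (at_right 0)"
    by (intro tendsto_ereal)
  then show "has_average_content Y"
    using dim by (auto simp: has_average_content_def)
  show "average_content Y = ereal x"
    unfolding average_content_def by (rule tendsto_Lim[OF trivial_limit_at_right_real lim])
qed

lemma rescaled_volume_eq: "has_minkowski_dim Y \<delta> \<Longrightarrow> rescaled_volume Y = scaled_volume \<delta> Y"
  by (simp add: fun_eq_iff rescaled_volume_def scaled_volume_def minkowski_dim_eq)

lemma minkowski_contentI:
  fixes Y :: "'a::euclidean_space set"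
  assumes dim: "has_minkowski_dim Y \<delta>" and lim: "(log_volume \<delta> Y \<longlongrightarrow> x) at_top"
  shows "minkowski_measurable Y" "minkowski_content Y = ereal x"
proof -
  have "((\<lambda>\<epsilon>. log_volume \<delta> Y (- ln \<epsilon>)) \<longlongrightarrow> x) (at_right 0)"
    using lim by (rule filterlim_compose[OF _ filterlim_minus_ln_at_top])
  moreover have "\<forall>\<^sub>F \<epsilon> in at_right 0. log_volume \<delta> Y (- ln \<epsilon>) = rescaled_volume Y \<epsilon>"
    by (intro eventually_at_rightI[of 0 1]) (auto simp: log_volume_def rescaled_volume_eq[OF dim])
  ultimately have "(rescaled_volume Y \<longlongrightarrow> x) (at_right 0)"
    by (rule Lim_transform_eventually)
  then have lim: "((\<lambda>\<epsilon>. ereal (rescaled_volume Y \<epsilon>)) \<longlongrightarrow> ereal x) (at_right 0)"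
    by (intro tendsto_ereal)
  have "upper_minkowski_content Y = ereal x" "lower_minkowski_content Y = ereal x"
    unfolding upper_minkowski_content_def lower_minkowski_content_def
    using lim_imp_Liminf[OF trivial_limit_at_right_real lim] lim_imp_Limsup[OF trivial_limit_at_right_real lim]
    by auto
  then show "minkowski_measurable Y" "minkowski_content Y = ereal x"
    using dim unfolding minkowski_measurable_def minkowski_content_def by auto
qed

text \<open>The bounds exclude an infinite common value of the upper and the lower content.\<close>

lemma minkowski_measurable_imp_tendsto:
  fixes Y :: "'a::euclidean_space set"
  assumes dim: "has_minkowski_dim Y \<delta>" and meas: "minkowski_measurable Y"
    and bd: "\<forall>\<^sub>F \<epsilon> in at_right 0. a \<le> scaled_volume \<delta> Y \<epsilon> \<and> scaled_volume \<delta> Y \<epsilon> \<le> b"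
  shows "\<exists>x. (log_volume \<delta> Y \<longlongrightarrow> x) at_top"
proof -
  define c where "c = upper_minkowski_content Y"
  have lim: "((\<lambda>\<epsilon>. ereal (scaled_volume \<delta> Y \<epsilon>)) \<longlongrightarrow> c) (at_right 0)"
    using meas unfolding minkowski_measurable_def
    by (intro Liminf_eq_Limsup)
      (auto simp: c_def upper_minkowski_content_def lower_minkowski_content_def rescaled_volume_eq[OF dim])
  have "ereal a \<le> c"
    using bd by (intro tendsto_lowerbound[OF lim]) (auto elim: eventually_mono)
  moreover have "c \<le> ereal b"
    using bd by (intro tendsto_upperbound[OF lim]) (auto elim: eventually_mono)
  ultimately obtain x where "c = ereal x"
    by (cases c) auto
  then have "(scaled_volume \<delta> Y \<longlongrightarrow> x) (at_right 0)"
    using lim by simp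
  then have "(log_volume \<delta> Y \<longlongrightarrow> x) at_top"
    unfolding log_volume_def[abs_def] by (rule filterlim_compose[OF _ filterlim_exp_minus_at_right])
  then show ?thesis by blast
qed

section \<open>Hausdorff measure as a Borel measure\<close>

lemma hausdorff_weight_empty [simp]: "hausdorff_weight s {} = 0"
  by (simp add: hausdorff_weight_def)

lemma hausdorff_pre_le:
  assumes "A \<subseteq> (\<Union>i. U i)" "\<And>i. bounded (U i)" "\<And>i. diameter (U i) \<le> \<eta>"
  shows "hausdorff_pre s \<eta> A \<le> (\<Sum>i::nat. hausdorff_weight s (U i))"
  unfolding hausdorff_pre_def using assms by (intro INF_lower) auto

lemma le_hausdorff_pre:
  assumes "\<And>U. A \<subseteq> (\<Union>i::nat. U i) \<Longrightarrow> (\<And>i. bounded (U i)) \<Longrightarrow> (\<And>i. diameter (U i) \<le> \<eta>) \<Longrightarrow>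
             c \<le> (\<Sum>i. hausdorff_weight s (U i))"
  shows "c \<le> hausdorff_pre s \<eta> A"
  unfolding hausdorff_pre_def using assms by (intro INF_greatest) auto

lemma hausdorff_pre_mono: "A \<subseteq> B \<Longrightarrow> hausdorff_pre s \<eta> A \<le> hausdorff_pre s \<eta> B"
  by (intro le_hausdorff_pre hausdorff_pre_le) auto

lemma hausdorff_pre_antimono: "\<eta> \<le> \<eta>' \<Longrightarrow> hausdorff_pre s \<eta>' A \<le> hausdorff_pre s \<eta> A"
  by (intro le_hausdorff_pre hausdorff_pre_le) (auto intro: order_trans)

lemma hausdorff_pre_le_outer: "0 < \<eta> \<Longrightarrow> hausdorff_pre s \<eta> A \<le> hausdorff_outer s A"
  unfolding hausdorff_outer_def by (intro SUP_upper) auto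

lemma hausdorff_outer_leI:
  "(\<And>\<eta>. 0 < \<eta> \<Longrightarrow> hausdorff_pre s \<eta> A \<le> c) \<Longrightarrow> hausdorff_outer s A \<le> c"
  unfolding hausdorff_outer_def by (intro SUP_least) auto

lemma hausdorff_outer_mono: "A \<subseteq> B \<Longrightarrow> hausdorff_outer s A \<le> hausdorff_outer s B"
  by (meson hausdorff_outer_leI hausdorff_pre_le_outer hausdorff_pre_mono order_trans)

lemma hausdorff_outer_empty [simp]: "hausdorff_outer s {} = 0"
proof -
  have "hausdorff_pre s \<eta> ({} :: 'a set) \<le> 0" if "\<eta> > 0" for \<eta>
    using hausdorff_pre_le[of "{}" "\<lambda>_. {}" \<eta> s] that by (simp add: diameter_def)
  then have "hausdorff_outer s ({} :: 'a set) \<le> 0"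
    by (rule hausdorff_outer_leI)
  then show ?thesis by simp
qed

lemma hausdorff_pre_cover_close:
  assumes "hausdorff_pre s \<eta> A < c"
  shows "\<exists>U. A \<subseteq> (\<Union>i::nat. U i) \<and> (\<forall>i. bounded (U i) \<and> diameter (U i) \<le> \<eta>) \<and>
           (\<Sum>i. hausdorff_weight s (U i)) < c"
  using assms unfolding hausdorff_pre_def by (subst (asm) INF_less_iff) auto

text \<open>Covers of the sets \<open>A n\<close> that are optimal up to \<open>\<epsilon> / 2\<^sup>n\<^sup>+\<^sup>1\<close> are merged into one sequence.\<close>

lemma hausdorff_pre_UN_le:
  fixes A :: "nat \<Rightarrow> 'a::metric_space set"
  assumes "\<eta> > 0"
  shows "hausdorff_pre s \<eta> (\<Union>n. A n) \<le> (\<Sum>n. hausdorff_pre s \<eta> (A n))"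
proof (cases "(\<Sum>n. hausdorff_pre s \<eta> (A n)) = top")
  case False
  then have fin: "hausdorff_pre s \<eta> (A n) < top" for n
    by (metis ennreal_suminf_lessD less_top)
  show ?thesis
  proof (rule ennreal_le_epsilon)
    fix e :: real assume "e > 0"
    define d where "d n = e * (1 / 2) ^ Suc n" for n
    have d: "d n > 0" for n using \<open>e > 0\<close> by (simp add: d_def)
    have "d sums (e * 1)"
      unfolding d_def by (intro sums_mult power_half_series)
    then have d_sum: "(\<Sum>n. ennreal (d n)) = ennreal e"
      using d by (simp add: suminf_ennreal2 sums_iff less_imp_le)
    have "\<exists>U. A n \<subseteq> (\<Union>i::nat. U i) \<and> (\<forall>i. bounded (U i) \<and> diameter (U i) \<le> \<eta>) \<and>
           (\<Sum>i. hausdorff_weight s (U i)) < hausdorff_pre s \<eta> (A n) + ennreal (d n)" for n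
    proof (rule hausdorff_pre_cover_close)
      obtain q where "hausdorff_pre s \<eta> (A n) = ennreal q" "0 \<le> q"
        using fin[of n] by (cases "hausdorff_pre s \<eta> (A n)") auto
      then show "hausdorff_pre s \<eta> (A n) < hausdorff_pre s \<eta> (A n) + ennreal (d n)"
        using d[of n] by (simp add: ennreal_plus[symmetric] ennreal_less_iff del: ennreal_plus)
    qed
    then obtain U where U: "\<And>n. A n \<subseteq> (\<Union>i::nat. U n i)" "\<And>n i. bounded (U n i)"
      "\<And>n i. diameter (U n i) \<le> \<eta>"
      "\<And>n. (\<Sum>i. hausdorff_weight s (U n i)) < hausdorff_pre s \<eta> (A n) + ennreal (d n)"
      by metis
    define V where "V k = (case prod_decode k of (n, i) \<Rightarrow> U n i)" for k
    have "(\<Union>n. A n) \<subseteq> (\<Union>k. V k)"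
    proof
      fix x assume "x \<in> (\<Union>n. A n)"
      then obtain n i where "x \<in> U n i" using U(1) by blast
      then have "x \<in> V (prod_encode (n, i))" by (simp add: V_def)
      then show "x \<in> (\<Union>k. V k)" by blast
    qed
    then have "hausdorff_pre s \<eta> (\<Union>n. A n) \<le> (\<Sum>k. hausdorff_weight s (V k))"
      using U by (intro hausdorff_pre_le) (auto simp: V_def split: prod.split)
    also have "\<dots> = (\<Sum>k. (\<lambda>(n, i). hausdorff_weight s (U n i)) (prod_decode k))"
      by (intro suminf_cong) (auto simp: V_def split: prod.split)
    also have "\<dots> = (\<Sum>n. \<Sum>i. hausdorff_weight s (U n i))"
      by (rule suminf_ennreal_2dimen) simp
    also have "\<dots> \<le> (\<Sum>n. hausdorff_pre s \<eta> (A n) + ennreal (d n))"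
      using U(4) by (intro suminf_le) (auto intro: less_imp_le)
    also have "\<dots> = (\<Sum>n. hausdorff_pre s \<eta> (A n)) + (\<Sum>n. ennreal (d n))"
      by (intro suminf_add[symmetric]) auto
    finally show "hausdorff_pre s \<eta> (\<Union>n. A n) \<le> (\<Sum>n. hausdorff_pre s \<eta> (A n)) + ennreal e"
      by (simp add: d_sum)
  qed
qed simp

lemma hausdorff_outer_UN_le:
  "hausdorff_outer s (\<Union>n::nat. A n) \<le> (\<Sum>n. hausdorff_outer s (A n))"
proof (rule hausdorff_outer_leI)
  fix \<eta> :: real assume \<eta>: "\<eta> > 0"
  have "hausdorff_pre s \<eta> (\<Union>n. A n) \<le> (\<Sum>n. hausdorff_pre s \<eta> (A n))"
    by (rule hausdorff_pre_UN_le[OF \<eta>])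
  also have "\<dots> \<le> (\<Sum>n. hausdorff_outer s (A n))"
    by (intro suminf_le hausdorff_pre_le_outer[OF \<eta>]) auto
  finally show "hausdorff_pre s \<eta> (\<Union>n. A n) \<le> (\<Sum>n. hausdorff_outer s (A n))" .
qed

lemma outer_measure_space_hausdorff_outer: "outer_measure_space (Pow UNIV) (hausdorff_outer s)"
  unfolding outer_measure_space_def positive_def increasing_def countably_subadditive_def
  by (auto intro: hausdorff_outer_mono hausdorff_outer_UN_le)

lemma hausdorff_outer_Un_le: "hausdorff_outer s (A \<union> B) \<le> hausdorff_outer s A + hausdorff_outer s B"
proof -
  have "A \<union> B = (\<Union>n. binaryset A B n)" by (simp add: UN_binaryset_eq)
  then have "hausdorff_outer s (A \<union> B) \<le> (\<Sum>n. hausdorff_outer s (binaryset A B n))"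
    by (metis hausdorff_outer_UN_le)
  also have "\<dots> = hausdorff_outer s A + hausdorff_outer s B"
    by (simp add: suminf_binaryset_eq)
  finally show ?thesis .
qed

text \<open>A set of diameter less than \<open>\<rho>\<close> cannot meet both \<open>A\<close> and \<open>B\<close>, so a fine cover of the union splits
into a cover of \<open>A\<close> and one of \<open>B\<close>.\<close>

lemma hausdorff_outer_separated:
  fixes A B :: "'a::metric_space set"
  assumes "\<rho> > 0" and sep: "\<And>x y. x \<in> A \<Longrightarrow> y \<in> B \<Longrightarrow> \<rho> \<le> dist x y"
  shows "hausdorff_outer s A + hausdorff_outer s B \<le> hausdorff_outer s (A \<union> B)"
proof -
  have pre: "hausdorff_pre s \<eta> A + hausdorff_pre s \<eta> B \<le> hausdorff_pre s \<eta> (A \<union> B)" if \<eta>: "0 < \<eta>" "\<eta> < \<rho>" for \<eta>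
  proof (rule le_hausdorff_pre)
    fix U :: "nat \<Rightarrow> 'a set"
    assume U: "A \<union> B \<subseteq> (\<Union>i. U i)" "\<And>i. bounded (U i)" "\<And>i. diameter (U i) \<le> \<eta>"
    define V where "V i = (if U i \<inter> A = {} then {} else U i)" for i
    define W where "W i = (if U i \<inter> A = {} then U i else {})" for i
    have "A \<subseteq> (\<Union>i. V i)"
    proof
      fix x assume "x \<in> A"
      then obtain i where "x \<in> U i" using U(1) by blast
      then show "x \<in> (\<Union>i. V i)" using \<open>x \<in> A\<close> by (auto simp: V_def)
    qed
    moreover have "B \<subseteq> (\<Union>i. W i)"
    proof
      fix y assume "y \<in> B"
      then obtain i where i: "y \<in> U i" using U(1) by blast
      have "U i \<inter> A = {}"
      proof (rule ccontr)
        assume "U i \<inter> A \<noteq> {}"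
        then obtain x where "x \<in> A" "x \<in> U i" by blast
        then have "\<rho> \<le> dist x y" "dist x y \<le> diameter (U i)"
          using sep \<open>y \<in> B\<close> i diameter_bounded_bound[OF U(2)] by auto
        then show False using U(3)[of i] \<eta> by linarith
      qed
      then show "y \<in> (\<Union>i. W i)" using i by (auto simp: W_def)
    qed
    ultimately have "hausdorff_pre s \<eta> A + hausdorff_pre s \<eta> B \<le>
        (\<Sum>i. hausdorff_weight s (V i)) + (\<Sum>i. hausdorff_weight s (W i))"
      using U \<eta> by (intro add_mono hausdorff_pre_le) (auto simp: V_def W_def)
    also have "\<dots> = (\<Sum>i. hausdorff_weight s (V i) + hausdorff_weight s (W i))"
      by (intro suminf_add) auto
    also have "\<dots> = (\<Sum>i. hausdorff_weight s (U i))"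
      by (intro suminf_cong) (auto simp: V_def W_def)
    finally show "hausdorff_pre s \<eta> A + hausdorff_pre s \<eta> B \<le> (\<Sum>i. hausdorff_weight s (U i))" .
  qed
  have "hausdorff_outer s A + hausdorff_outer s B =
      (SUP \<eta>\<in>{0<..}. hausdorff_pre s \<eta> A + hausdorff_pre s \<eta> B)"
    unfolding hausdorff_outer_def
  proof (rule SUP_add_directed_ennreal[symmetric])
    fix \<eta> \<eta>' :: real assume "\<eta> \<in> {0<..}" "\<eta>' \<in> {0<..}"
    then show "\<exists>\<eta>''\<in>{0<..}. hausdorff_pre s \<eta> A + hausdorff_pre s \<eta>' B
        \<le> hausdorff_pre s \<eta>'' A + hausdorff_pre s \<eta>'' B"
      by (intro bexI[of _ "min \<eta> \<eta>'"] add_mono hausdorff_pre_antimono) auto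
  qed
  also have "\<dots> \<le> hausdorff_outer s (A \<union> B)"
  proof (rule SUP_least)
    fix \<eta> :: real assume "\<eta> \<in> {0<..}"
    define \<eta>' where "\<eta>' = min \<eta> (\<rho> / 2)"
    have "hausdorff_pre s \<eta> A + hausdorff_pre s \<eta> B \<le> hausdorff_pre s \<eta>' A + hausdorff_pre s \<eta>' B"
      by (intro add_mono hausdorff_pre_antimono) (auto simp: \<eta>'_def)
    also have "\<dots> \<le> hausdorff_pre s \<eta>' (A \<union> B)"
      using \<open>\<eta> \<in> {0<..}\<close> \<open>\<rho> > 0\<close> by (intro pre) (auto simp: \<eta>'_def)
    also have "\<dots> \<le> hausdorff_outer s (A \<union> B)"
      using \<open>\<eta> \<in> {0<..}\<close> \<open>\<rho> > 0\<close> by (intro hausdorff_pre_le_outer) (auto simp: \<eta>'_def)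
    finally show "hausdorff_pre s \<eta> A + hausdorff_pre s \<eta> B \<le> hausdorff_outer s (A \<union> B)" .
  qed
  finally show ?thesis .
qed

lemma ennreal_suminf_tail_less:
  fixes f :: "nat \<Rightarrow> ennreal"
  assumes "(\<Sum>n. f n) < top" "e > 0"
  shows "\<exists>k. (\<Sum>n. f (n + k)) < ennreal e"
proof -
  define r where "r n = enn2real (f n)" for n
  have fr: "f n = ennreal (r n)" for n
    using ennreal_suminf_lessD[OF assms(1), of n] by (simp add: r_def)
  have r0: "0 \<le> r n" for n by (simp add: r_def)
  have sm: "summable r"
    using assms(1) by (intro summable_suminf_not_top) (auto simp: fr r0)
  obtain k where k: "norm (\<Sum>n. r (n + k)) < e"
    using suminf_exist_split[OF assms(2) sm] by blast
  have "(\<Sum>n. f (n + k)) = ennreal (\<Sum>n. r (n + k))"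
    using sm r0 by (simp add: fr suminf_ennreal2 summable_iff_shift)
  also have "\<dots> < ennreal e"
    using k assms(2) by (intro ennreal_lessI) auto
  finally show ?thesis by blast
qed

text \<open>Caratheodory's criterion for metric outer measures.  The part \<open>A\<^sub>k\<close> of \<open>E\<close> at distance at least
\<open>1 / k\<close> from \<open>C\<close> is separated from \<open>E \<inter> C\<close>, so additivity holds for these two, and it remains to see that
\<open>A\<^sub>k\<close> exhausts \<open>E - C\<close> in outer measure.  The shells \<open>B\<^sub>k = A\<^sub>k\<^sub>+\<^sub>1 - A\<^sub>k\<close> are separated from each other
if their indices differ by at least two.  Hence the measures of every second shell sum up to at most
that of \<open>E\<close>, and the tails of the series over all shells tend to \<open>0\<close>.\<close>

lemma closed_hausdorff_caratheodory:
  fixes C E :: "'a::metric_space set"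
  assumes C: "closed C"
  shows "hausdorff_outer s (E \<inter> C) + hausdorff_outer s (E - C) \<le> hausdorff_outer s E"
proof (cases "C = {} \<or> hausdorff_outer s E = top")
  case True
  then show ?thesis by auto
next
  case False
  then have "C \<noteq> {}" and fin: "hausdorff_outer s E < top"
    by (auto simp: less_top)
  define A where "A k = {x \<in> E. 1 \<le> real k * infdist x C}" for k :: nat
  define B where "B k = A (Suc k) - A k" for k
  have mono: "A k \<subseteq> A (Suc k)" for k
  proof
    fix x assume "x \<in> A k"
    moreover have "real k * infdist x C \<le> real (Suc k) * infdist x C"
      by (intro mult_right_mono infdist_nonneg) simp
    ultimately show "x \<in> A (Suc k)" by (auto simp: A_def)
  qed
  have AE: "A k \<subseteq> E" for k by (auto simp: A_def)
  have sep: "hausdorff_outer s (A k) + hausdorff_outer s S \<le> hausdorff_outer s (A k \<union> S)"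
    if S: "S \<subseteq> {y. real (Suc k) * infdist y C < 1}" for k S
  proof (cases "k = 0")
    case True
    then show ?thesis by (simp add: A_def)
  next
    case False
    show ?thesis
    proof (rule hausdorff_outer_separated)
      show "0 < 1 / real k - 1 / real (Suc k)"
        using False by (simp add: divide_strict_left_mono)
      fix x y assume "x \<in> A k" "y \<in> S"
      then have "1 / real k \<le> infdist x C" "infdist y C < 1 / real (Suc k)"
        using False S by (auto simp: A_def field_simps)
      then show "1 / real k - 1 / real (Suc k) \<le> dist x y"
        using infdist_triangle[of x C y] by linarith
    qed
  qed
  \<comment> \<open>Taking \<open>q = 0\<close> and \<open>q = 1\<close> covers the shells of odd and of even index, except \<open>B 0\<close>.\<close>
  have alt: "(\<Sum>j<n. hausdorff_outer s (B (2 * j + 1 + q))) \<le> hausdorff_outer s (A (2 * n + q))" for n q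
  proof (induction n)
    case (Suc n)
    have "(\<Sum>j<Suc n. hausdorff_outer s (B (2 * j + 1 + q)))
        \<le> hausdorff_outer s (A (2 * n + q)) + hausdorff_outer s (B (2 * n + 1 + q))"
      using Suc by (simp add: add_right_mono)
    also have "\<dots> \<le> hausdorff_outer s (A (2 * n + q) \<union> B (2 * n + 1 + q))"
      by (intro sep) (auto simp: B_def A_def not_le)
    also have "\<dots> \<le> hausdorff_outer s (A (2 * Suc n + q))"
      using mono[of "2 * n + q"] mono[of "2 * n + q + 1"]
      by (intro hausdorff_outer_mono) (auto simp: B_def)
    finally show ?case .
  qed simp
  have pairs: "(\<Sum>j<2 * n. f j) = (\<Sum>j<n. f (2 * j)) + (\<Sum>j<n. f (2 * j + 1))" for f :: "nat \<Rightarrow> ennreal" and n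
    by (induction n) (simp_all add: add_ac)
  define f where "f j = hausdorff_outer s (B (Suc j))" for j
  have "(\<Sum>j. f j) \<le> hausdorff_outer s E + hausdorff_outer s E"
  proof (subst suminf_eq_SUP, rule SUP_least)
    fix n
    have "(\<Sum>j<n. f j) \<le> (\<Sum>j<2 * n. f j)"
      by (intro sum_mono2) auto
    also have "\<dots> = (\<Sum>j<n. f (2 * j)) + (\<Sum>j<n. f (2 * j + 1))"
      by (rule pairs)
    also have "\<dots> \<le> hausdorff_outer s (A (2 * n)) + hausdorff_outer s (A (2 * n + 1))"
      using alt[of 0 n] alt[of 1 n] by (intro add_mono) (auto simp: f_def)
    also have "\<dots> \<le> hausdorff_outer s E + hausdorff_outer s E"
      by (intro add_mono hausdorff_outer_mono AE)
    finally show "(\<Sum>j<n. f j) \<le> hausdorff_outer s E + hausdorff_outer s E" .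
  qed
  also have "\<dots> < top" using fin by (simp add: ennreal_add_less_top)
  finally have sum_fin: "(\<Sum>j. f j) < top" .
  show ?thesis
  proof (rule ennreal_le_epsilon)
    fix e :: real assume "e > 0"
    then obtain k where k: "(\<Sum>j. f (j + k)) < ennreal e"
      using ennreal_suminf_tail_less[OF sum_fin] by blast
    have "E - C \<subseteq> A (Suc k) \<union> (\<Union>j. B (Suc (j + k)))"
    proof
      fix x assume x: "x \<in> E - C"
      then have "infdist x C > 0"
        using C \<open>C \<noteq> {}\<close> by (intro infdist_pos_not_in_closed) auto
      then obtain m where "1 < real m * infdist x C"
        using reals_Archimedean3 by blast
      then have ex: "x \<in> A m" using x by (auto simp: A_def)
      define n where "n = (LEAST m. x \<in> A m)"
      have n: "x \<in> A n" unfolding n_def by (rule LeastI[of "\<lambda>m. x \<in> A m", OF ex])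
      show "x \<in> A (Suc k) \<union> (\<Union>j. B (Suc (j + k)))"
      proof (cases "n \<le> Suc k")
        case True
        have "A n \<subseteq> A (Suc k)"
          using True mono by (rule lift_Suc_mono_le[rotated])
        with n show ?thesis by blast
      next
        case False
        then obtain j where j: "n = Suc (Suc (j + k))"
          by (metis add.commute add_Suc_right less_imp_Suc_add not_le)
        have "x \<notin> A (Suc (j + k))"
          using j not_less_Least[of "Suc (j + k)" "\<lambda>m. x \<in> A m"] by (auto simp: n_def)
        with n j show ?thesis by (auto simp: B_def)
      qed
    qed
    then have "hausdorff_outer s (E - C) \<le> hausdorff_outer s (A (Suc k) \<union> (\<Union>j. B (Suc (j + k))))"
      by (rule hausdorff_outer_mono)
    also have "\<dots> \<le> hausdorff_outer s (A (Suc k)) + hausdorff_outer s (\<Union>j. B (Suc (j + k)))"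
      by (rule hausdorff_outer_Un_le)
    also have "hausdorff_outer s (\<Union>j. B (Suc (j + k))) \<le> (\<Sum>j. f (j + k))"
      unfolding f_def by (rule hausdorff_outer_UN_le)
    also have "\<dots> \<le> ennreal e" using k by simp
    finally have "hausdorff_outer s (E - C) \<le> hausdorff_outer s (A (Suc k)) + ennreal e"
      by (simp add: add_left_mono)
    then have "hausdorff_outer s (E \<inter> C) + hausdorff_outer s (E - C)
        \<le> hausdorff_outer s (E \<inter> C) + (hausdorff_outer s (A (Suc k)) + ennreal e)"
      by (rule add_left_mono)
    also have "\<dots> = (hausdorff_outer s (A (Suc k)) + hausdorff_outer s (E \<inter> C)) + ennreal e"
      by (simp add: add_ac)
    also have "hausdorff_outer s (A (Suc k)) + hausdorff_outer s (E \<inter> C)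
        \<le> hausdorff_outer s (A (Suc k) \<union> (E \<inter> C))"
      by (intro sep) auto
    also have "\<dots> \<le> hausdorff_outer s E"
      using AE by (intro hausdorff_outer_mono) auto
    finally show "hausdorff_outer s (E \<inter> C) + hausdorff_outer s (E - C) \<le> hausdorff_outer s E + ennreal e"
      by (simp add: add_right_mono)
  qed
qed

theorem measure_space_hausdorff:
  "measure_space UNIV (sets borel) (hausdorff_outer s :: 'a::metric_space set \<Rightarrow> ennreal)"
proof -
  let ?L = "lambda_system UNIV (Pow UNIV) (hausdorff_outer s :: 'a set \<Rightarrow> ennreal)"
  interpret P: sigma_algebra UNIV "Pow (UNIV :: 'a set)"
    by (rule sigma_algebra_Pow)
  have L: "measure_space UNIV ?L (hausdorff_outer s)"
    by (rule P.caratheodory_lemma[OF outer_measure_space_hausdorff_outer])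
  then have sL: "sigma_algebra UNIV ?L"
    by (simp add: measure_space_def)
  have "C \<in> ?L" if "closed C" for C
  proof -
    have "hausdorff_outer s (E \<inter> C) + hausdorff_outer s (E - C) = hausdorff_outer s E" for E
    proof (rule antisym[OF closed_hausdorff_caratheodory[OF that]])
      show "hausdorff_outer s E \<le> hausdorff_outer s (E \<inter> C) + hausdorff_outer s (E - C)"
        using hausdorff_outer_Un_le[of s "E \<inter> C" "E - C"] by (simp add: Int_Diff_Un)
    qed
    then show ?thesis
      unfolding P.lambda_system_eq by auto
  qed
  then have "sets borel \<subseteq> ?L"
    unfolding borel_eq_closed using sigma_algebra.sigma_sets_subset[OF sL, of "{S. closed S}"] by auto
  then show ?thesis
    using measure_down[OF L] sets.sigma_algebra_axioms[of "borel :: 'a measure"] by simp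
qed

lemma sets_hausdorff_measure [simp, measurable_cong]: "sets (hausdorff_measure s) = sets borel"
  unfolding hausdorff_measure_def using sets.sets_measure_of_eq[of borel] by simp

lemma emeasure_hausdorff_measure:
  assumes "A \<in> sets borel"
  shows "emeasure (hausdorff_measure s) A = hausdorff_outer s A"
proof -
  have "emeasure (measure_of UNIV (sets borel) (hausdorff_outer s)) A = hausdorff_outer s A"
    using measure_space_hausdorff[of s] assms
    by (intro emeasure_measure_of_sigma) (auto simp: measure_space_def)
  then show ?thesis by (simp add: hausdorff_measure_def)
qed

section \<open>Parallel neighbourhoods under conformal maps\<close>

lemma lipschitz_on_segments_differentiable:
  fixes f :: "'a::euclidean_space \<Rightarrow> 'a"
  assumes der: "\<And>x. x \<in> V \<Longrightarrow> (f has_derivative f' x) (at x)"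
    and bd: "\<And>x v. x \<in> V \<Longrightarrow> norm (f' x v) \<le> M * norm v" and "0 \<le> M"
  shows "lipschitz_on_segments M V f"
  unfolding lipschitz_on_segments_def
proof (intro conjI allI impI)
  fix x y assume V: "closed_segment x y \<subseteq> V"
  have "norm (f x - f y) \<le> M * norm (x - y)"
  proof (rule differentiable_bound[of "closed_segment x y" f f'])
    fix z assume "z \<in> closed_segment x y"
    then have z: "z \<in> V" using V by blast
    show "(f has_derivative f' z) (at z within closed_segment x y)"
      using der[OF z] by (rule has_derivative_at_withinI)
    show "onorm (f' z) \<le> M"
      using bd[OF z] by (rule onorm_bound[OF \<open>0 \<le> M\<close>])
  qed auto
  then show "dist (f x) (f y) \<le> M * dist x y"
    by (simp add: dist_norm)
qed (rule assms)

lemma norm_jacobian_conformal: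
  assumes "conformal_on U g" "x \<in> U"
  shows "norm (jacobian g (at x) *v v) = scaling_ratio g x * norm v"
proof -
  obtain c Q where Q: "orthogonal_matrix Q" "jacobian g (at x) = c *\<^sub>R Q"
    using assms unfolding conformal_on_def by blast
  then have "orthogonal_transformation ((*v) Q)"
    by (simp add: orthogonal_transformation_matrix)
  then have "norm (Q *v v) = norm v"
    by (rule orthogonal_transformation_norm)
  then show ?thesis
    using scaling_ratio_eq[OF Q] Q(2) by (simp flip: scaleR_matrix_vector_assoc)
qed

lemma scaling_ratio_nonneg:
  assumes "conformal_on U g" "x \<in> U"
  shows "0 \<le> scaling_ratio g x"
proof -
  obtain c Q where Q: "orthogonal_matrix Q" "jacobian g (at x) = c *\<^sub>R Q"
    using assms unfolding conformal_on_def by blast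
  then show ?thesis
    using scaling_ratio_eq[OF Q] by simp
qed

lemma C1_on_has_derivative:
  "C1_on U g \<Longrightarrow> x \<in> U \<Longrightarrow> (g has_derivative (\<lambda>v. jacobian g (at x) *v v)) (at x)"
  by (simp add: C1_on_def flip: jacobian_works)

lemma continuous_on_scaling_ratio:
  fixes g :: "real^'d \<Rightarrow> real^'d"
  assumes conf: "conformal_on U g" and C1: "C1_on U g"
  shows "continuous_on U (scaling_ratio g)"
proof -
  fix i :: 'd
  have "continuous_on U (\<lambda>x. norm (\<chi> j. jacobian g (at x) $ j $ i))"
    using C1 unfolding C1_on_def
    by (intro continuous_on_norm continuous_on_vec_lambda continuous_on_component) auto
  moreover have "norm (\<chi> j. jacobian g (at x) $ j $ i) = scaling_ratio g x" if "x \<in> U" for x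
    using norm_jacobian_conformal[OF conf that, of "axis i 1"]
    by (simp add: matrix_vector_mult_basis column_def)
  ultimately show ?thesis
    by (simp cong: continuous_on_cong)
qed

lemma diffeo_inverse_jacobian:
  fixes g :: "real^'d \<Rightarrow> real^'d"
  assumes U: "open U" and diff: "diffeo_onto_image U g" and x: "x \<in> U"
  shows "jacobian g (at x) ** jacobian (the_inv_into U g) (at (g x)) = mat 1"
proof -
  define h where "h = the_inv_into U g"
  have g: "inj_on g U" "C1_on U g" "C1_on (g ` U) h"
    using diff by (auto simp: diffeo_onto_image_def h_def)
  have dg: "(g has_derivative (\<lambda>v. jacobian g (at x) *v v)) (at x)"
    by (rule C1_on_has_derivative[OF g(2) x])
  have dh: "(h has_derivative (\<lambda>v. jacobian h (at (g x)) *v v)) (at (g x))"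
    using x by (intro C1_on_has_derivative[OF g(3)]) auto
  have "(h \<circ> g has_derivative (\<lambda>v. jacobian h (at (g x)) *v v) \<circ> (\<lambda>v. jacobian g (at x) *v v)) (at x)"
    by (rule diff_chain_at[OF dg dh])
  moreover have "(h \<circ> g has_derivative id) (at x)"
  proof (rule has_derivative_transform_within_open[OF _ U x])
    show "(id has_derivative id) (at x)" by (simp add: id_def)
    show "id y = (h \<circ> g) y" if "y \<in> U" for y
      using the_inv_into_f_f[OF g(1) that] by (simp add: h_def)
  qed
  ultimately have "(\<lambda>v. jacobian h (at (g x)) *v v) \<circ> (\<lambda>v. jacobian g (at x) *v v) = id"
    by (rule has_derivative_unique)
  then have "(jacobian h (at (g x)) ** jacobian g (at x)) *v v = mat 1 *v v" for v
    by (simp add: fun_eq_iff matrix_vector_mul_assoc)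
  then have "jacobian h (at (g x)) ** jacobian g (at x) = mat 1"
    by (simp add: matrix_eq)
  then show ?thesis
    unfolding h_def using matrix_left_right_inverse by blast
qed

text \<open>The two Jacobians are inverse to each other and that of \<open>g\<close> multiplies all norms by its scaling
ratio, so that of the inverse divides them by it.\<close>

lemma norm_inverse_jacobian:
  fixes g :: "real^'d \<Rightarrow> real^'d"
  assumes U: "open U" and diff: "diffeo_onto_image U g" and conf: "conformal_on U g" and x: "x \<in> U"
  shows "scaling_ratio g x * norm (jacobian (the_inv_into U g) (at (g x)) *v w) = norm w"
  using norm_jacobian_conformal[OF conf x, of "jacobian (the_inv_into U g) (at (g x)) *v w"]
  by (simp add: matrix_vector_mul_assoc diffeo_inverse_jacobian[OF U diff x])

lemma scaling_ratio_pos: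
  fixes g :: "real^'d \<Rightarrow> real^'d"
  assumes U: "open U" and diff: "diffeo_onto_image U g" and conf: "conformal_on U g" and x: "x \<in> U"
  shows "0 < scaling_ratio g x"
proof -
  fix i :: 'd
  have "norm (axis i 1 :: real^'d) = 1" by simp
  then have "scaling_ratio g x \<noteq> 0"
    using norm_inverse_jacobian[OF assms, of "axis i 1"] by auto
  with scaling_ratio_nonneg[OF conf x] show ?thesis by simp
qed

text \<open>The strict bounds on the scaling ratio persist on an open neighbourhood \<open>V\<close> of \<open>Y\<close>.  There \<open>g\<close> is
\<open>M\<close>-Lipschitz along segments, and its inverse is \<open>1 / m\<close>-Lipschitz along segments in the open set
\<open>g V\<close>.  For small \<open>\<epsilon>\<close> all parallel neighbourhoods in question lie inside \<open>V\<close> and \<open>g V\<close>.\<close>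

theorem conformal_parallel_nbhd_bounds:
  fixes g :: "real^'d \<Rightarrow> real^'d"
  assumes U: "open U" and diff: "diffeo_onto_image U g" and conf: "conformal_on U g"
    and Y: "compact Y" "Y \<noteq> {}" "Y \<subseteq> U" and m: "0 < m"
    and s: "\<And>x. x \<in> Y \<Longrightarrow> m < scaling_ratio g x \<and> scaling_ratio g x < M"
  shows "\<forall>\<^sub>F \<epsilon> in at_right 0.
      m ^ CARD('d) * measure lborel (parallel_nbhd Y (\<epsilon> / M)) \<le> measure lborel (parallel_nbhd (g ` Y) \<epsilon>) \<and>
      measure lborel (parallel_nbhd (g ` Y) \<epsilon>) \<le> M ^ CARD('d) * measure lborel (parallel_nbhd Y (\<epsilon> / m))"
proof -
  define h where "h = the_inv_into U g"
  define V where "V = U \<inter> scaling_ratio g -` {m<..<M}"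
  have g: "inj_on g U" "C1_on U g" "C1_on (g ` U) h" "open (g ` U)"
    using diff by (auto simp: diffeo_onto_image_def h_def)
  obtain y where "y \<in> Y" using Y by blast
  then have "m \<le> M" using s[of y] by linarith
  have V: "open V" "V \<subseteq> U" "Y \<subseteq> V"
    using Y s continuous_on_scaling_ratio[OF conf g(2)] U
    by (auto simp: V_def intro!: continuous_open_preimage)
  have hg: "h (g x) = x" if "x \<in> U" for x
    using the_inv_into_f_f[OF g(1) that] by (simp add: h_def)
  have lip_g: "lipschitz_on_segments M V g"
  proof (rule lipschitz_on_segments_differentiable)
    fix x v assume "x \<in> V"
    then show "(g has_derivative (\<lambda>v. jacobian g (at x) *v v)) (at x)"
      using V by (intro C1_on_has_derivative[OF g(2)]) auto
    show "norm (jacobian g (at x) *v v) \<le> M * norm v"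
      using norm_jacobian_conformal[OF conf, of x v] \<open>x \<in> V\<close>
      by (auto simp: V_def intro!: mult_right_mono)
  qed (use m \<open>m \<le> M\<close> in auto)
  have lip_h: "lipschitz_on_segments (1 / m) (g ` V) h"
  proof (rule lipschitz_on_segments_differentiable)
    fix z v assume "z \<in> g ` V"
    then obtain x where x: "z = g x" "x \<in> U" "m < scaling_ratio g x"
      by (auto simp: V_def)
    then show "(h has_derivative (\<lambda>v. jacobian h (at z) *v v)) (at z)"
      by (intro C1_on_has_derivative[OF g(3)]) auto
    have "m * norm (jacobian h (at z) *v v) \<le> scaling_ratio g x * norm (jacobian h (at z) *v v)"
      using x by (intro mult_right_mono) auto
    also have "\<dots> = norm v"
      using norm_inverse_jacobian[OF U diff conf x(2)] by (simp add: x h_def)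
    finally show "norm (jacobian h (at z) *v v) \<le> 1 / m * norm v"
      using m by (simp add: field_simps)
  qed (use m in auto)
  have "continuous_on (g ` U) h"
    using g(3) unfolding C1_on_def
    by (intro continuous_at_imp_continuous_on ballI differentiable_imp_continuous_within) auto
  then have "open (g ` U \<inter> h -` V)"
    using g(4) V(1) by (rule continuous_open_preimage)
  also have "g ` U \<inter> h -` V = g ` V"
    using V(2) hg by force
  finally have W: "open (g ` V)" .
  have gY: "compact (g ` Y)"
    using Y V continuous_on_subset[OF lipschitz_on_segments_continuous_on[OF lip_g V(1)]]
    by (intro compact_continuous_image) auto
  have "\<forall>\<^sub>F \<epsilon> in at_right 0. parallel_nbhd Y (\<epsilon> / m) \<subseteq> V"
    by (rule eventually_parallel_nbhd_subset[OF Y(1,2) V(1,3) m])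
  moreover have "\<forall>\<^sub>F \<epsilon> in at_right 0. parallel_nbhd (g ` Y) (\<epsilon> / 1) \<subseteq> g ` V"
    using V Y gY by (intro eventually_parallel_nbhd_subset W) auto
  moreover have "\<forall>\<^sub>F \<epsilon> in at_right 0. 0 < (\<epsilon>::real)"
    by (rule eventually_at_right_less)
  ultimately show ?thesis
  proof eventually_elim
    case (elim \<epsilon>)
    have "h (g x) = x" if "x \<in> V" for x using hg V(2) that by blast
    note b = measure_parallel_nbhd_image_bounds[OF lip_g lip_h V(1) W refl this m \<open>m \<le> M\<close> Y(1,2) V(3)]
    from b[of \<epsilon>] elim show ?case by simp
  qed
qed

section \<open>Self-similar sets with strong separation\<close>

lemma similarity_lipschitz:
  assumes "similarity r f" "0 \<le> r"
  shows "lipschitz_on_segments r UNIV f"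
  using assms by (simp add: similarity_def lipschitz_on_segments_def)

lemma similarity_inj:
  assumes f: "similarity r f" and r: "0 < r"
  shows "inj f"
proof (rule injI)
  fix x y assume "f x = f y"
  moreover have "dist (f x) (f y) = r * dist x y"
    using f by (simp add: similarity_def)
  ultimately show "x = y" using r by simp
qed

text \<open>Dividing by the ratio and translating yields an isometry that fixes the origin; such a map is
orthogonal.\<close>

lemma similarity_surj:
  fixes f :: "'a::euclidean_space \<Rightarrow> 'a"
  assumes f: "similarity r f" and r: "0 < r"
  shows "surj f"
proof -
  define h where "h x = (f x - f 0) /\<^sub>R r" for x
  have "dist (h x) (h y) = dist x y" for x y
  proof -
    have "h x - h y = (f x - f y) /\<^sub>R r"
      by (simp add: h_def scaleR_diff_right)
    then show ?thesis
      using f r by (simp add: dist_norm similarity_def)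
  qed
  then have "orthogonal_transformation h"
    by (simp add: orthogonal_transformation_isometry h_def)
  then have "surj h"
    by (rule orthogonal_transformation_surj)
  then have "\<exists>x. y = f x" for y
    using r by (metis diff_add_cancel h_def inverse_nonzero_iff_nonzero less_irrefl scaleR_cancel_left surjD)
  then show ?thesis by (auto simp: surj_def)
qed

lemma similarity_comp: "similarity a f \<Longrightarrow> similarity b g \<Longrightarrow> similarity (a * b) (f \<circ> g)"
  by (simp add: similarity_def)

lemma similarity_inv:
  fixes f :: "'a::euclidean_space \<Rightarrow> 'a"
  assumes f: "similarity r f" and r: "0 < r"
  shows "similarity (1 / r) (inv f)"
  unfolding similarity_def
proof (intro allI)
  fix x y
  have "dist x y = r * dist (inv f x) (inv f y)"
    using f surj_f_inv_f[OF similarity_surj[OF f r]] by (metis similarity_def)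
  then show "dist (inv f x) (inv f y) = 1 / r * dist x y"
    using r by simp
qed

lemma continuous_on_similarity: "similarity r (f :: 'a::euclidean_space \<Rightarrow> 'a) \<Longrightarrow> 0 \<le> r \<Longrightarrow> continuous_on A f"
  using lipschitz_on_segments_continuous_on[OF similarity_lipschitz] continuous_on_subset by blast

lemma measure_parallel_nbhd_similarity:
  fixes f :: "'a::euclidean_space \<Rightarrow> 'a"
  assumes f: "similarity r f" and r: "0 < r" and Y: "compact Y" "Y \<noteq> {}" and "0 < \<epsilon>"
  shows "measure lborel (parallel_nbhd (f ` Y) \<epsilon>) = r ^ DIM('a) * measure lborel (parallel_nbhd Y (\<epsilon> / r))"
proof -
  note b = measure_parallel_nbhd_image_bounds[OF similarity_lipschitz[OF f] similarity_lipschitz[OF similarity_inv[OF f r]],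
      of Y \<epsilon>]
  show ?thesis
    using b similarity_surj[OF f r] inv_f_f[OF similarity_inj[OF f r]] assms by (intro antisym) auto
qed

lemma scaled_volume_similarity:
  fixes f :: "'a::euclidean_space \<Rightarrow> 'a"
  assumes f: "similarity r f" and r: "0 < r" and Y: "compact Y" "Y \<noteq> {}" and "0 < \<epsilon>"
  shows "scaled_volume \<delta> (f ` Y) \<epsilon> = r powr \<delta> * scaled_volume \<delta> Y (\<epsilon> / r)"
proof -
  have "r powr \<delta> * (\<epsilon> / r) powr (\<delta> - real DIM('a)) = \<epsilon> powr (\<delta> - real DIM('a)) * r ^ DIM('a)"
    using assms by (simp add: powr_divide powr_diff powr_realpow field_simps)
  then show ?thesis
    using measure_parallel_nbhd_similarity[OF assms] by (simp add: scaled_volume_def mult_ac)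
qed

lemma log_volume_eq_exp:
  "log_volume \<delta> (Y :: 'a::euclidean_space set) t =
     exp ((real DIM('a) - \<delta>) * t) * measure lborel (parallel_nbhd Y (exp (- t)))"
  by (simp add: log_volume_def scaled_volume_def powr_def algebra_simps)

locale self_similar =
  fixes \<phi> :: "'i \<Rightarrow> 'a::euclidean_space \<Rightarrow> 'a" and r :: "'i \<Rightarrow> real" and I :: "'i set" and K :: "'a set"
  assumes I: "finite I" "2 \<le> card I"
    and r: "\<And>i. i \<in> I \<Longrightarrow> 0 < r i \<and> r i < 1"
    and sim: "\<And>i. i \<in> I \<Longrightarrow> similarity (r i) (\<phi> i)"
    and K: "compact K" "K \<noteq> {}" "K = (\<Union>i\<in>I. \<phi> i ` K)"
    and sep: "disjoint_family_on (\<lambda>i. \<phi> i ` K) I"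
begin

lemma I_nonempty: "I \<noteq> {}"
  using I by auto

definition rmax :: real where "rmax = Max (r ` I)"

lemma r_le_rmax: "i \<in> I \<Longrightarrow> r i \<le> rmax"
  by (simp add: rmax_def I)

lemma rmax: "0 < rmax" "rmax < 1"
proof -
  have "rmax \<in> r ` I"
    unfolding rmax_def using I I_nonempty by (intro Max_in) auto
  then show "0 < rmax" "rmax < 1" using r by auto
qed

lemma compact_image: "i \<in> I \<Longrightarrow> compact (\<phi> i ` K)"
  using K r sim by (intro compact_continuous_image continuous_on_similarity) (auto intro: less_imp_le)

text \<open>The sum is the number of maps at exponent \<open>0\<close>, and it is at most \<open>1\<close> at the exponent where the largest
ratio has become the reciprocal of that number.\<close>

lemma similarity_dimension_exists: "\<exists>\<delta>>0. (\<Sum>i\<in>I. r i powr \<delta>) = 1"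
proof -
  define n where "n = real (card I)"
  have n: "2 \<le> n" using I by (simp add: n_def)
  define x where "x = - ln n / ln rmax"
  have "0 < x"
    using n rmax by (simp add: x_def divide_pos_neg)
  have "rmax powr x = 1 / n"
    using rmax n by (simp add: powr_def x_def exp_minus inverse_eq_divide)
  then have "(\<Sum>i\<in>I. r i powr x) \<le> (\<Sum>i\<in>I. 1 / n)"
    using r r_le_rmax \<open>0 < x\<close> by (intro sum_mono) (metis less_imp_le powr_mono2)
  then have hi: "(\<Sum>i\<in>I. r i powr x) \<le> 1"
    using n by (simp add: n_def)
  have zero: "(\<Sum>i\<in>I. r i powr 0) = n"
    using r by (subst sum.cong[of I _ _ "\<lambda>_. 1"]) (force simp: n_def)+
  then have lo: "1 \<le> (\<Sum>i\<in>I. r i powr 0)"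
    using n by simp
  have "continuous_on {0..x} (\<lambda>y. \<Sum>i\<in>I. r i powr y)"
    using r by (intro continuous_intros) force
  from IVT2'[OF hi lo less_imp_le[OF \<open>0 < x\<close>] this] obtain y where y: "0 \<le> y" "(\<Sum>i\<in>I. r i powr y) = 1"
    by blast
  with zero n have "y \<noteq> 0" by auto
  with y show ?thesis by (intro exI[of _ y]) auto
qed

definition \<delta> :: real where "\<delta> = (SOME x. 0 < x \<and> (\<Sum>i\<in>I. r i powr x) = 1)"

lemma \<delta>_pos: "0 < \<delta>" and sum_powr_\<delta>: "(\<Sum>i\<in>I. r i powr \<delta>) = 1"
  using someI_ex[OF similarity_dimension_exists] by (auto simp: \<delta>_def)

lemma renewal_equation:
  "\<forall>\<^sub>F t in at_top. log_volume \<delta> K t = (\<Sum>i\<in>I. r i powr \<delta> * log_volume \<delta> K (t - (- ln (r i))))"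
proof -
  have "\<forall>\<^sub>F \<epsilon> in at_right 0. measure lborel (parallel_nbhd (\<Union>i\<in>I. \<phi> i ` K) \<epsilon>) =
           (\<Sum>i\<in>I. measure lborel (parallel_nbhd (\<phi> i ` K) \<epsilon>))"
    using I I_nonempty K(2) compact_image sep by (intro separated_parallel_nbhds_UN) auto
  then have ev: "\<forall>\<^sub>F \<epsilon> in at_right 0. measure lborel (parallel_nbhd K \<epsilon>) =
           (\<Sum>i\<in>I. measure lborel (parallel_nbhd (\<phi> i ` K) \<epsilon>))"
    by (simp only: K(3)[symmetric])
  show ?thesis
    using eventually_compose_filterlim[OF ev filterlim_exp_minus_at_right]
  proof eventually_elim
    case (elim t)
    have "log_volume \<delta> K t = (\<Sum>i\<in>I. scaled_volume \<delta> (\<phi> i ` K) (exp (- t)))"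
      by (simp add: log_volume_def scaled_volume_def elim sum_distrib_left)
    also have "\<dots> = (\<Sum>i\<in>I. r i powr \<delta> * log_volume \<delta> K (t - (- ln (r i))))"
    proof (intro sum.cong refl)
      fix i assume i: "i \<in> I"
      have "exp (- t) / r i = exp (- (t - (- ln (r i))))"
        using r[OF i] by (simp add: exp_diff exp_minus exp_add field_simps)
      then show "scaled_volume \<delta> (\<phi> i ` K) (exp (- t)) = r i powr \<delta> * log_volume \<delta> K (t - (- ln (r i)))"
        using scaled_volume_similarity[OF sim[OF i] _ K(1,2), of "exp (- t)" \<delta>] r[OF i]
        by (simp add: log_volume_def)
    qed
    finally show ?case .
  qed
qed

lemma log_volume_bounded:
  "\<exists>a b. 0 < a \<and> (\<forall>\<^sub>F t in at_top. a \<le> log_volume \<delta> K t \<and> log_volume \<delta> K t \<le> b)"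
proof -
  obtain t1 where t1: "\<And>t. t1 \<le> t \<Longrightarrow>
      log_volume \<delta> K t = (\<Sum>i\<in>I. r i powr \<delta> * log_volume \<delta> K (t - (- ln (r i))))"
    using renewal_equation by (auto simp: eventually_at_top_linorder)
  define s where "s i = - ln (r i)" for i
  define b where "b = Max (s ` I)"
  define a where "a = Min (s ` I)"
  have "s i > 0" if "i \<in> I" for i using r[OF that] by (simp add: s_def)
  then have a: "0 < a" unfolding a_def using I I_nonempty by (subst Min_gr_iff) auto
  have s: "a \<le> s i \<and> s i \<le> b" if "i \<in> I" for i
    using that I by (auto simp: a_def b_def)
  define V where "V t = measure lborel (parallel_nbhd K (exp (- t)))" for t
  have V: "V u \<le> V t" if "t \<le> u" for t u
    unfolding V_def using that by (intro measure_parallel_nbhd_mono K) auto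
  have V0: "0 < V t" for t
    unfolding V_def by (intro measure_parallel_nbhd_pos K) auto
  \<comment> \<open>On the initial window the exponential factor of \<open>log_volume_eq_exp\<close> lies between \<open>e\<^sup>-\<^sup>c\<close> and \<open>e\<^sup>c\<close>.\<close>
  define c where "c = \<bar>real DIM('a) - \<delta>\<bar> * (\<bar>t1\<bar> + \<bar>b\<bar>)"
  have init: "exp (- c) * V t1 \<le> log_volume \<delta> K t \<and> log_volume \<delta> K t \<le> exp c * V (t1 - b)"
    if t: "t1 - b \<le> t" "t \<le> t1" for t
  proof -
    have "\<bar>t\<bar> \<le> \<bar>t1\<bar> + \<bar>b\<bar>" using t by linarith
    then have "\<bar>(real DIM('a) - \<delta>) * t\<bar> \<le> c"
      unfolding c_def abs_mult by (intro mult_left_mono) auto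
    then have "- c \<le> (real DIM('a) - \<delta>) * t" "(real DIM('a) - \<delta>) * t \<le> c"
      by linarith+
    then show ?thesis
      unfolding log_volume_eq_exp V_def[symmetric] using V t V0 less_imp_le[OF V0]
      by (intro conjI mult_mono) auto
  qed
  note av = I(1) powr_ge_zero sum_powr_\<delta> s a t1[folded s_def]
  have "exp (- c) * V t1 \<le> log_volume \<delta> K t \<and> log_volume \<delta> K t \<le> exp c * V (t1 - b)"
    if "t1 - b \<le> t" for t
    using averaging_le[OF av _ that] averaging_ge[OF av _ that] init by blast
  then have "\<forall>\<^sub>F t in at_top. exp (- c) * V t1 \<le> log_volume \<delta> K t \<and> log_volume \<delta> K t \<le> exp c * V (t1 - b)"
    unfolding eventually_at_top_linorder by blast
  then show ?thesis
    using V0[of t1] by (intro exI conjI) auto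
qed

text \<open>The mean is positive because \<open>log_volume \<delta> K\<close> is eventually bounded below by a positive constant.\<close>

lemma log_volume_has_mean: "\<exists>x>0. has_mean (log_volume \<delta> K) x"
proof -
  obtain t1 where t1: "\<And>t. t1 \<le> t \<Longrightarrow>
      log_volume \<delta> K t = (\<Sum>i\<in>I. r i powr \<delta> * log_volume \<delta> K (t - (- ln (r i))))"
    using renewal_equation by (auto simp: eventually_at_top_linorder)
  have int: "locally_integrable (log_volume \<delta> K)"
    by (intro locally_integrable_log_volume K)
  have "0 < r i powr \<delta>" "0 < - ln (r i)" if "i \<in> I" for i
    using r[OF that] by auto
  from averaging_has_mean[OF I(1) this(1) sum_powr_\<delta> this(2) int t1]
  have "\<exists>x. has_mean (log_volume \<delta> K) x"
    by blast
  then obtain x where x: "has_mean (log_volume \<delta> K) x" by blast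
  obtain a b where a: "0 < a" "\<forall>\<^sub>F t in at_top. a \<le> log_volume \<delta> K t \<and> log_volume \<delta> K t \<le> b"
    using log_volume_bounded by blast
  have "a \<le> x"
    using a(2) by (intro has_mean_mono[OF _ has_mean_const int x])
      (auto simp: locally_integrable_def elim: eventually_mono)
  with x a(1) show ?thesis by (intro exI[of _ x]) auto
qed

text \<open>Words of length \<open>n\<close> index the cylinders \<open>\<phi>\<^sub>w K\<close> of the \<open>n\<close>-th generation.  The first letter of a word
belongs to the map that is applied last, so that a cylinder lies in the piece of its first letter.\<close>

definition words :: "nat \<Rightarrow> 'i list set" where
  "words n = {w. set w \<subseteq> I \<and> length w = n}"

definition word_map :: "'i list \<Rightarrow> 'a \<Rightarrow> 'a" where
  "word_map w = foldr (\<lambda>i f. \<phi> i \<circ> f) w id"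

definition word_ratio :: "'i list \<Rightarrow> real" where
  "word_ratio w = prod_list (map r w)"

abbreviation cylinder :: "'i list \<Rightarrow> 'a set" where
  "cylinder w \<equiv> word_map w ` K"

lemma finite_words: "finite (words n)"
  unfolding words_def by (rule finite_lists_length_eq) (rule I)

lemma words_0: "words 0 = {[]}"
  by (auto simp: words_def)

lemma words_Suc: "words (Suc n) = (\<lambda>(i, w). i # w) ` (I \<times> words n)"
  unfolding words_def by (auto simp: length_Suc_conv image_iff)

lemma words_SucE:
  assumes "w \<in> words (Suc n)"
  obtains i v where "w = i # v" "i \<in> I" "v \<in> words n"
  using assms unfolding words_Suc by auto

lemma UN_words_Suc: "(\<Union>w\<in>words (Suc n). f w) = (\<Union>i\<in>I. \<Union>w\<in>words n. f (i # w))"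
  unfolding words_Suc by auto

lemma sum_words_Suc: "(\<Sum>w\<in>words (Suc n). f w) = (\<Sum>i\<in>I. \<Sum>w\<in>words n. f (i # w))"
proof -
  have "(\<Sum>w\<in>words (Suc n). f w) = (\<Sum>x\<in>I \<times> words n. f (case x of (i, w) \<Rightarrow> i # w))"
    unfolding words_Suc by (subst sum.reindex) (auto simp: inj_on_def o_def)
  then show ?thesis
    by (simp add: sum.cartesian_product split_def)
qed

lemma word_map_Nil: "word_map [] = id" and word_map_Cons: "word_map (i # w) = \<phi> i \<circ> word_map w"
  by (simp_all add: word_map_def)

lemma word_ratio_Nil: "word_ratio [] = 1" and word_ratio_Cons: "word_ratio (i # w) = r i * word_ratio w"
  by (simp_all add: word_ratio_def)

lemma word_ratio:
  assumes "w \<in> words n"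
  shows "0 < word_ratio w" "word_ratio w \<le> rmax ^ n"
proof -
  have "0 < word_ratio w \<and> word_ratio w \<le> rmax ^ n"
    using assms
  proof (induction n arbitrary: w)
    case 0
    then show ?case by (simp add: words_0 word_ratio_Nil)
  next
    case (Suc n)
    then obtain i v where w: "w = i # v" "i \<in> I" "v \<in> words n"
      by (auto simp: words_Suc)
    then show ?case
      using Suc.IH[OF w(3)] r[OF w(2)] r_le_rmax[OF w(2)] rmax
      by (auto simp: word_ratio_Cons intro!: mult_mono)
  qed
  then show "0 < word_ratio w" "word_ratio w \<le> rmax ^ n" by auto
qed

lemma similarity_word_map: "w \<in> words n \<Longrightarrow> similarity (word_ratio w) (word_map w)"
proof (induction n arbitrary: w)
  case 0
  then show ?case by (simp add: words_0 word_ratio_Nil word_map_Nil similarity_def)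
next
  case (Suc n)
  then obtain i v where w: "w = i # v" "i \<in> I" "v \<in> words n"
    by (auto simp: words_Suc)
  then show ?case
    using similarity_comp[OF sim[OF w(2)] Suc.IH[OF w(3)]] by (simp only: w(1) word_map_Cons word_ratio_Cons)
qed

lemma UN_cylinder: "(\<Union>w\<in>words n. cylinder w) = K"
proof (induction n)
  case 0
  then show ?case by (simp add: words_0 word_map_Nil)
next
  case (Suc n)
  have "(\<Union>w\<in>words (Suc n). cylinder w) = (\<Union>i\<in>I. \<Union>w\<in>words n. \<phi> i ` cylinder w)"
    by (simp only: UN_words_Suc word_map_Cons image_comp)
  also have "\<dots> = (\<Union>i\<in>I. \<phi> i ` (\<Union>w\<in>words n. cylinder w))"
    by (simp only: image_UN)
  also have "\<dots> = K"
    by (simp only: Suc K(3)[symmetric])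
  finally show ?case .
qed

lemma cylinder_subset: "w \<in> words n \<Longrightarrow> cylinder w \<subseteq> K"
  using UN_cylinder by blast

lemma disjoint_cylinders: "disjoint_family_on cylinder (words n)"
proof (induction n)
  case 0
  then show ?case by (simp add: words_0 disjoint_family_on_def)
next
  case (Suc n)
  show ?case
    unfolding disjoint_family_on_def
  proof (intro ballI impI)
    fix u w assume uw: "u \<in> words (Suc n)" "w \<in> words (Suc n)" "u \<noteq> w"
    then obtain i u' j w' where *: "u = i # u'" "i \<in> I" "u' \<in> words n" "w = j # w'" "j \<in> I" "w' \<in> words n"
      by (elim words_SucE) blast
    show "cylinder u \<inter> cylinder w = {}"
    proof (cases "i = j")
      case True
      then have "cylinder u' \<inter> cylinder w' = {}"
        using Suc uw * by (auto simp: disjoint_family_on_def)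
      moreover have "inj (\<phi> i)"
        using similarity_inj[OF sim] r * by blast
      ultimately have "\<phi> i ` cylinder u' \<inter> \<phi> i ` cylinder w' = {}"
        by (metis image_Int image_empty)
      then show ?thesis
        using True * by (simp add: word_map_Cons image_comp)
    next
      case False
      then have "\<phi> i ` K \<inter> \<phi> j ` K = {}"
        using sep * by (auto simp: disjoint_family_on_def)
      moreover have "cylinder u \<subseteq> \<phi> i ` K" "cylinder w \<subseteq> \<phi> j ` K"
        using cylinder_subset[OF *(3)] cylinder_subset[OF *(6)] * by (auto simp: word_map_Cons)
      ultimately show ?thesis by blast
    qed
  qed
qed

lemma compact_cylinder: "w \<in> words n \<Longrightarrow> compact (cylinder w)"
  using continuous_on_similarity[OF similarity_word_map less_imp_le[OF word_ratio(1)]] K(1)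
  by (blast intro: compact_continuous_image)

lemma sum_word_ratio_powr: "(\<Sum>w\<in>words n. word_ratio w powr \<delta>) = 1"
proof (induction n)
  case 0
  then show ?case by (simp add: words_0 word_ratio_Nil)
next
  case (Suc n)
  have "(\<Sum>w\<in>words (Suc n). word_ratio w powr \<delta>) =
      (\<Sum>i\<in>I. \<Sum>w\<in>words n. r i powr \<delta> * word_ratio w powr \<delta>)"
    unfolding sum_words_Suc word_ratio_Cons
    using r word_ratio(1) by (intro sum.cong refl powr_mult)
  also have "\<dots> = (\<Sum>i\<in>I. r i powr \<delta>) * (\<Sum>w\<in>words n. word_ratio w powr \<delta>)"
    by (simp add: sum_product)
  finally show ?case
    by (simp add: Suc sum_powr_\<delta>)
qed

end

section \<open>Hausdorff measure under similarities\<close>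

lemma diameter_similarity_image_le:
  fixes f :: "'a::euclidean_space \<Rightarrow> 'a"
  assumes "similarity r f" "0 \<le> r" "bounded X"
  shows "diameter (f ` X) \<le> r * diameter X"
proof (rule diameter_le)
  fix x y assume "x \<in> f ` X" "y \<in> f ` X"
  then obtain u v where "u \<in> X" "v \<in> X" "x = f u" "y = f v" by blast
  then show "norm (x - y) \<le> r * diameter X"
    using assms diameter_bounded_bound[of X u v]
    by (auto simp: similarity_def dist_norm[symmetric] intro: mult_left_mono)
qed (use assms diameter_ge_0 in auto)

lemma bounded_similarity_image:
  assumes "similarity r f" "bounded X" "0 \<le> r"
  shows "bounded (f ` X)"
proof -
  obtain e where "\<forall>x\<in>X. \<forall>y\<in>X. dist x y \<le> e"
    using assms(2) bounded_two_points by blast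
  then have "\<forall>x\<in>f ` X. \<forall>y\<in>f ` X. dist x y \<le> r * e"
    using assms by (auto simp: similarity_def mult_left_mono)
  then show ?thesis
    unfolding bounded_two_points by blast
qed

lemma hausdorff_weight_similarity_image_le:
  fixes f :: "'a::euclidean_space \<Rightarrow> 'a"
  assumes f: "similarity r f" "0 \<le> r" and X: "bounded X" and s: "0 < s"
  shows "hausdorff_weight s (f ` X) \<le> ennreal (r powr s) * hausdorff_weight s X"
proof (cases "X = {}")
  case False
  have "diameter (f ` X) powr s \<le> (r * diameter X) powr s"
    using s diameter_similarity_image_le[OF f X] diameter_ge_0[OF bounded_similarity_image[OF f(1) X f(2)]]
    by (intro powr_mono2) auto
  also have "\<dots> = r powr s * diameter X powr s"
    using f diameter_ge_0[OF X] by (simp add: powr_mult)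
  finally show ?thesis
    using False s by (simp add: hausdorff_weight_def ennreal_mult'[symmetric] ennreal_leI)
qed simp

text \<open>The images of a cover form a cover of the image.  One inequality is enough here, since equality for
cylinders follows later by summation.\<close>

lemma hausdorff_outer_similarity_image_le:
  fixes f :: "'a::euclidean_space \<Rightarrow> 'a"
  assumes f: "similarity r f" "0 < r" and s: "0 < s"
  shows "hausdorff_outer s (f ` A) \<le> ennreal (r powr s) * hausdorff_outer s A"
proof (rule hausdorff_outer_leI)
  fix \<eta> :: real assume \<eta>: "0 < \<eta>"
  define c where "c = r powr s"
  have c: "0 < c" using f by (simp add: c_def)
  have c_inv: "ennreal c * (ennreal (1 / c) * x) = x" "ennreal (1 / c) * (ennreal c * x) = x" for x
    using c by (simp_all flip: mult.assoc ennreal_mult')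
  have "ennreal (1 / c) * hausdorff_pre s \<eta> (f ` A) \<le> hausdorff_pre s (\<eta> / r) A"
  proof (rule le_hausdorff_pre)
    fix U :: "nat \<Rightarrow> 'a set"
    assume U: "A \<subseteq> (\<Union>i. U i)" "\<And>i. bounded (U i)" "\<And>i. diameter (U i) \<le> \<eta> / r"
    have "hausdorff_pre s \<eta> (f ` A) \<le> (\<Sum>i. hausdorff_weight s (f ` U i))"
    proof (rule hausdorff_pre_le)
      fix i
      have "diameter (f ` U i) \<le> r * diameter (U i)"
        using f U by (intro diameter_similarity_image_le) auto
      also have "\<dots> \<le> \<eta>"
        using U(3)[of i] f by (simp add: field_simps)
      finally show "diameter (f ` U i) \<le> \<eta>" .
      show "bounded (f ` U i)"
        using f U(2) by (intro bounded_similarity_image) auto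
      show "f ` A \<subseteq> (\<Union>i. f ` U i)"
        using U(1) by blast
    qed
    also have "\<dots> \<le> (\<Sum>i. ennreal c * hausdorff_weight s (U i))"
      unfolding c_def using f U s by (intro suminf_le hausdorff_weight_similarity_image_le) auto
    finally have "hausdorff_pre s \<eta> (f ` A) \<le> ennreal c * (\<Sum>i. hausdorff_weight s (U i))"
      by simp
    from mult_left_mono[OF this, of "ennreal (1 / c)"]
    show "ennreal (1 / c) * hausdorff_pre s \<eta> (f ` A) \<le> (\<Sum>i. hausdorff_weight s (U i))"
      by (simp add: c_inv)
  qed
  also have "\<dots> \<le> hausdorff_outer s A"
    using f \<eta> by (intro hausdorff_pre_le_outer) auto
  finally have "ennreal c * (ennreal (1 / c) * hausdorff_pre s \<eta> (f ` A)) \<le> ennreal c * hausdorff_outer s A"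
    by (rule mult_left_mono) simp
  then show "hausdorff_pre s \<eta> (f ` A) \<le> ennreal (r powr s) * hausdorff_outer s A"
    by (simp add: c_inv c_def[symmetric])
qed

lemma hausdorff_pre_le_finite:
  fixes U :: "'i \<Rightarrow> 'a::metric_space set"
  assumes J: "finite J" and U: "A \<subseteq> (\<Union>i\<in>J. U i)" "\<And>i. i \<in> J \<Longrightarrow> bounded (U i)"
    "\<And>i. i \<in> J \<Longrightarrow> diameter (U i) \<le> \<eta>" and "0 \<le> \<eta>"
  shows "hausdorff_pre s \<eta> A \<le> (\<Sum>i\<in>J. hausdorff_weight s (U i))"
proof -
  obtain h where h: "bij_betw h {0..<card J} J"
    using ex_bij_betw_nat_finite[OF J] by blast
  define V where "V n = (if n < card J then U (h n) else {})" for n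
  have hJ: "h n \<in> J" if "n < card J" for n
    using h that by (auto simp: bij_betw_def)
  have "A \<subseteq> (\<Union>n. V n)"
  proof
    fix x assume "x \<in> A"
    then obtain i where "i \<in> J" "x \<in> U i" using U by blast
    moreover have "i \<in> h ` {0..<card J}"
      using h \<open>i \<in> J\<close> by (simp add: bij_betw_def)
    then obtain n where "n < card J" "h n = i"
      by auto
    ultimately show "x \<in> (\<Union>n. V n)" by (auto simp: V_def intro!: exI[of _ n])
  qed
  moreover have "diameter ({} :: 'a set) \<le> \<eta>"
    using \<open>0 \<le> \<eta>\<close> by (simp add: diameter_def)
  ultimately have "hausdorff_pre s \<eta> A \<le> (\<Sum>n. hausdorff_weight s (V n))"
    using U(2,3) hJ by (intro hausdorff_pre_le) (auto simp: V_def)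
  also have "\<dots> = (\<Sum>n\<in>{0..<card J}. hausdorff_weight s (V n))"
    by (intro suminf_finite) (auto simp: V_def)
  also have "\<dots> = (\<Sum>n\<in>{0..<card J}. hausdorff_weight s (U (h n)))"
    by (intro sum.cong) (auto simp: V_def)
  also have "\<dots> = (\<Sum>i\<in>J. hausdorff_weight s (U i))"
    by (rule sum.reindex_bij_betw[OF h])
  finally show ?thesis .
qed

text \<open>Needed to pass from countable covers of a compact set to finite ones at an arbitrarily small cost.\<close>

lemma open_superset_hausdorff_weight:
  fixes U :: "'a::euclidean_space set"
  assumes U: "bounded U" and "0 < s" "0 < e"
  shows "\<exists>V. open V \<and> bounded V \<and> U \<subseteq> V \<and> ennreal (diameter V powr s) \<le> hausdorff_weight s U + ennreal e"
proof (cases "U = {}")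
  case True
  then show ?thesis by (intro exI[of _ "{}"]) (simp add: diameter_def)
next
  case False
  define d where "d = diameter U"
  have d: "0 \<le> d" using diameter_ge_0[OF U] by (simp add: d_def)
  have pos: "\<forall>\<^sub>F t::real in at_right 0. 0 < t"
    by (rule eventually_at_right_less)
  have "((\<lambda>t. d + 2 * t) \<longlongrightarrow> d + 2 * 0) (at_right 0)"
    by (intro tendsto_intros)
  then have "((\<lambda>t. (d + 2 * t) powr s) \<longlongrightarrow> (d + 2 * 0) powr s) (at_right 0)"
    by (rule tendsto_powr'[OF _ tendsto_const])
      (use d \<open>0 < s\<close> in \<open>auto intro!: eventually_mono[OF pos]\<close>)
  then have "\<forall>\<^sub>F t in at_right 0. (d + 2 * t) powr s < d powr s + e"
    using \<open>0 < e\<close> by (intro order_tendstoD(2)) auto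
  from eventually_happens[OF eventually_conj[OF this pos]]
  obtain t where t: "(d + 2 * t) powr s < d powr s + e" "0 < t"
    by auto
  define V where "V = (\<Union>x\<in>U. ball x t)"
  have dist: "dist x y \<le> d + 2 * t" if xy: "x \<in> V" "y \<in> V" for x y
  proof -
    obtain u v where "u \<in> U" "dist u x < t" "v \<in> U" "dist v y < t"
      using xy by (auto simp: V_def)
    moreover then have "dist u v \<le> d"
      using diameter_bounded_bound[OF U] by (simp add: d_def)
    ultimately show ?thesis
      using dist_triangle[of x y u] dist_triangle[of u y v] by (simp add: dist_commute)
  qed
  then have V: "bounded V"
    unfolding bounded_two_points by blast
  have "diameter V \<le> d + 2 * t"
    using d t dist by (intro diameter_le) (auto simp: dist_norm)
  then have "diameter V powr s \<le> (d + 2 * t) powr s"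
    using diameter_ge_0[OF V] \<open>0 < s\<close> by (intro powr_mono2) auto
  then have "ennreal (diameter V powr s) \<le> ennreal (d powr s + e)"
    using t by (intro ennreal_leI) auto
  then have "ennreal (diameter V powr s) \<le> hausdorff_weight s U + ennreal e"
    using False \<open>0 < s\<close> \<open>0 < e\<close> by (simp add: hausdorff_weight_def d_def)
  moreover have "open V" "U \<subseteq> V"
    using t by (auto simp: V_def)
  ultimately show ?thesis using V by blast
qed

section \<open>Hausdorff measure of a self-similar set\<close>

context self_similar
begin

lemma pieces_gap: "\<exists>D>0. \<forall>i\<in>I. \<forall>j\<in>I. i \<noteq> j \<longrightarrow> (\<forall>x\<in>\<phi> i ` K. \<forall>y\<in>\<phi> j ` K. D \<le> dist x y)"
proof -
  define P where "P = {p \<in> I \<times> I. fst p \<noteq> snd p}"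
  have "\<forall>p\<in>P. \<exists>d>0. \<forall>x\<in>\<phi> (fst p) ` K. \<forall>y\<in>\<phi> (snd p) ` K. d \<le> dist x y"
  proof
    fix p assume "p \<in> P"
    then have p: "fst p \<in> I" "snd p \<in> I" "fst p \<noteq> snd p"
      by (auto simp: P_def)
    then have "\<phi> (fst p) ` K \<inter> \<phi> (snd p) ` K = {}"
      using disjoint_family_onD[OF sep] by blast
    with p(1,2)
    show "\<exists>d>0. \<forall>x\<in>\<phi> (fst p) ` K. \<forall>y\<in>\<phi> (snd p) ` K. d \<le> dist x y"
      by (intro separate_compact_closed compact_image compact_imp_closed)
  qed
  from bchoice[OF this]
  obtain d where d: "\<And>p. p \<in> P \<Longrightarrow> d p > 0 \<and> (\<forall>x\<in>\<phi> (fst p) ` K. \<forall>y\<in>\<phi> (snd p) ` K. d p \<le> dist x y)"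
    by blast
  have "finite P" using I(1) by (auto simp: P_def)
  define D where "D = Min (insert 1 (d ` P))"
  have "0 < D" unfolding D_def using \<open>finite P\<close> d by (subst Min_gr_iff) auto
  moreover have "D \<le> dist x y" if "i \<in> I" "j \<in> I" "i \<noteq> j" "x \<in> \<phi> i ` K" "y \<in> \<phi> j ` K" for i j x y
  proof -
    have "(i, j) \<in> P" using that by (simp add: P_def)
    then have "D \<le> d (i, j)" using \<open>finite P\<close> by (simp add: D_def)
    also have "\<dots> \<le> dist x y" using d[OF \<open>(i, j) \<in> P\<close>] that by auto
    finally show ?thesis .
  qed
  ultimately show ?thesis by blast
qed

definition gap :: real where
  "gap = (SOME D. 0 < D \<and> (\<forall>i\<in>I. \<forall>j\<in>I. i \<noteq> j \<longrightarrow> (\<forall>x\<in>\<phi> i ` K. \<forall>y\<in>\<phi> j ` K. D \<le> dist x y)))"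

lemma gap: "0 < gap" "\<And>i j x y. i \<in> I \<Longrightarrow> j \<in> I \<Longrightarrow> i \<noteq> j \<Longrightarrow> x \<in> \<phi> i ` K \<Longrightarrow> y \<in> \<phi> j ` K \<Longrightarrow> gap \<le> dist x y"
  using someI_ex[OF pieces_gap, folded gap_def] by blast+

text \<open>An upper estimate for the self-similar probability of \<open>U\<close> that uses only cylinders of the \<open>n\<close>-th
generation.  It makes the mass distribution principle available before any measure is at hand.\<close>

definition mass :: "nat \<Rightarrow> 'a set \<Rightarrow> real" where
  "mass n U = (\<Sum>w\<in>words n. if cylinder w \<inter> U = {} then 0 else word_ratio w powr \<delta>)"

lemma mass_le_1: "mass n U \<le> 1"
  unfolding mass_def sum_word_ratio_powr[of n, symmetric] by (intro sum_mono) auto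

lemma mass_eq_0: "K \<inter> U = {} \<Longrightarrow> mass n U = 0"
  unfolding mass_def using cylinder_subset by (intro sum.neutral) fastforce

lemma mass_Suc: "mass (Suc n) U = (\<Sum>i\<in>I. r i powr \<delta> * mass n (\<phi> i -` U))"
  unfolding mass_def sum_words_Suc
proof (intro sum.cong refl)
  fix i assume i: "i \<in> I"
  show "(\<Sum>w\<in>words n. if cylinder (i # w) \<inter> U = {} then 0 else word_ratio (i # w) powr \<delta>) =
    r i powr \<delta> * (\<Sum>w\<in>words n. if cylinder w \<inter> \<phi> i -` U = {} then 0 else word_ratio w powr \<delta>)"
    unfolding sum_distrib_left
  proof (intro sum.cong refl)
    fix w assume w: "w \<in> words n"
    have "cylinder (i # w) \<inter> U = {} \<longleftrightarrow> cylinder w \<inter> \<phi> i -` U = {}"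
      by (auto simp: word_map_Cons)
    moreover have "word_ratio (i # w) powr \<delta> = r i powr \<delta> * word_ratio w powr \<delta>"
      unfolding word_ratio_Cons using r[OF i] word_ratio(1)[OF w] by (intro powr_mult) 
    ultimately show "(if cylinder (i # w) \<inter> U = {} then 0 else word_ratio (i # w) powr \<delta>) =
      r i powr \<delta> * (if cylinder w \<inter> \<phi> i -` U = {} then 0 else word_ratio w powr \<delta>)"
      by simp
  qed
qed

text \<open>A set whose diameter is less than \<open>gap\<close> meets at most one piece \<open>\<phi>\<^sub>j K\<close>; pulling it back by \<open>\<phi>\<^sub>j\<close>
divides the mass by \<open>r\<^sub>j\<^sup>\<delta>\<close> and the diameter by \<open>r\<^sub>j\<close>, so the claim follows from that for the previous
generation.  If the diameter is at least \<open>gap\<close>, the first term of the maximum is at least \<open>1\<close>; the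
second term accounts for generation \<open>0\<close>, where a single cylinder has mass \<open>1\<close>.\<close>

lemma mass_le:
  assumes "bounded U"
  shows "mass n U \<le> max ((diameter U / gap) powr \<delta>) ((rmax powr \<delta>) ^ n)"
  using assms
proof (induction n arbitrary: U)
  case 0
  then show ?case using mass_le_1[of 0 U] by (simp add: max_def)
next
  case (Suc n)
  define q where "q = rmax powr \<delta>"
  have q: "0 < q" using rmax by (simp add: q_def)
  show ?case
  proof (cases "gap \<le> diameter U")
    case True
    then have "1 \<le> (diameter U / gap) powr \<delta>"
      using gap(1) \<delta>_pos by (intro ge_one_powr_ge_zero) auto
    then show ?thesis using mass_le_1[of "Suc n" U] by linarith
  next
    case small: False
    show ?thesis
    proof (cases "\<exists>j\<in>I. \<phi> j ` K \<inter> U \<noteq> {}")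
      case False
      then have "mass n (\<phi> i -` U) = 0" if "i \<in> I" for i
        using that by (intro mass_eq_0) auto
      then have "mass (Suc n) U = 0"
        by (simp add: mass_Suc)
      then show ?thesis using q by (simp add: max_def q_def)
    next
      case True
      then obtain j where j: "j \<in> I" "\<phi> j ` K \<inter> U \<noteq> {}" by blast
      then obtain y where y: "y \<in> \<phi> j ` K" "y \<in> U" by blast
      have "K \<inter> \<phi> i -` U = {}" if i: "i \<in> I - {j}" for i
      proof (rule ccontr)
        assume "K \<inter> \<phi> i -` U \<noteq> {}"
        then obtain x where "x \<in> \<phi> i ` K" "x \<in> U" by blast
        then have "gap \<le> dist x y" "dist x y \<le> diameter U"
          using gap(2)[of i j x y] i j y diameter_bounded_bound[OF Suc.prems] by auto
        then show False using small by linarith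
      qed
      then have "(\<Sum>i\<in>I - {j}. r i powr \<delta> * mass n (\<phi> i -` U)) = 0"
        by (intro sum.neutral) (simp add: mass_eq_0)
      then have "mass (Suc n) U = r j powr \<delta> * mass n (\<phi> j -` U)"
        unfolding mass_Suc by (subst sum.remove[OF I(1) j(1)]) simp
      also have "\<dots> \<le> r j powr \<delta> * max ((diameter U / r j / gap) powr \<delta>) (q ^ n)"
      proof (rule mult_left_mono)
        have rj: "0 < r j" using r[OF j(1)] by simp
        have dist: "dist x y \<le> diameter U / r j" if "x \<in> \<phi> j -` U" "y \<in> \<phi> j -` U" for x y
        proof -
          have "r j * dist x y \<le> diameter U"
            using sim[OF j(1)] that diameter_bounded_bound[OF Suc.prems, of "\<phi> j x" "\<phi> j y"]
            by (simp add: similarity_def)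
          then show ?thesis using rj by (simp add: field_simps)
        qed
        then have b: "bounded (\<phi> j -` U)"
          unfolding bounded_two_points by blast
        have "diameter (\<phi> j -` U) \<le> diameter U / r j"
          using dist rj diameter_ge_0[OF Suc.prems] by (intro diameter_le) (auto simp: dist_norm)
        then have "(diameter (\<phi> j -` U) / gap) powr \<delta> \<le> (diameter U / r j / gap) powr \<delta>"
          using diameter_ge_0[OF b] gap(1) \<delta>_pos by (intro powr_mono2 divide_right_mono) auto
        with Suc.IH[OF b] show "mass n (\<phi> j -` U) \<le> max ((diameter U / r j / gap) powr \<delta>) (q ^ n)"
          by (simp add: q_def max_def split: if_splits)
      qed auto
      also have "\<dots> \<le> max ((diameter U / gap) powr \<delta>) (q ^ Suc n)"
      proof -
        have "r j powr \<delta> * (diameter U / r j / gap) powr \<delta> = (diameter U / gap) powr \<delta>"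
          using r[OF j(1)] diameter_ge_0[OF Suc.prems] gap(1) by (simp flip: powr_mult)
        moreover have "r j powr \<delta> * q ^ n \<le> q ^ Suc n"
          using r[OF j(1)] r_le_rmax[OF j(1)] \<delta>_pos q
          by (auto simp: q_def intro!: mult_right_mono powr_mono2)
        ultimately show ?thesis
          by (simp add: max_mult_distrib_left max_def)
      qed
      finally show ?thesis by (simp add: q_def)
    qed
  qed
qed

text \<open>The mass distribution principle.  A finite cover of \<open>K\<close> by sets \<open>V\<^sub>i\<close> has total mass at least \<open>1\<close> in
every generation, and by \<open>mass_le\<close> that total is at most \<open>\<Sum>\<^sub>i (diam V\<^sub>i / gap)\<^sup>\<delta>\<close> in the limit.\<close>

lemma hausdorff_pre_ge: "ennreal (gap powr \<delta>) \<le> hausdorff_pre \<delta> \<eta> K"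
proof (rule le_hausdorff_pre)
  fix U :: "nat \<Rightarrow> 'a set"
  assume U: "K \<subseteq> (\<Union>i. U i)" "\<And>i. bounded (U i)" "\<And>i. diameter (U i) \<le> \<eta>"
  show "ennreal (gap powr \<delta>) \<le> (\<Sum>i. hausdorff_weight \<delta> (U i))"
  proof (rule ennreal_le_epsilon)
    fix e :: real assume "e > 0"
    \<comment> \<open>The sets of the cover are enlarged to open ones at a total cost of \<open>e\<close>.\<close>
    define d where "d n = e * (1 / 2) ^ Suc n" for n
    have d: "d n > 0" for n using \<open>e > 0\<close> by (simp add: d_def)
    have "d sums (e * 1)"
      unfolding d_def by (intro sums_mult power_half_series)
    then have d_sum: "(\<Sum>n. ennreal (d n)) = ennreal e"
      using d by (simp add: suminf_ennreal2 sums_iff less_imp_le)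
    have "\<forall>i. \<exists>V. open V \<and> bounded V \<and> U i \<subseteq> V \<and>
        ennreal (diameter V powr \<delta>) \<le> hausdorff_weight \<delta> (U i) + ennreal (d i)"
      using open_superset_hausdorff_weight[OF U(2) \<delta>_pos d] by blast
    then obtain V where V: "\<And>i. open (V i)" "\<And>i. bounded (V i)" "\<And>i. U i \<subseteq> V i"
        "\<And>i. ennreal (diameter (V i) powr \<delta>) \<le> hausdorff_weight \<delta> (U i) + ennreal (d i)"
      by metis
    have "K \<subseteq> (\<Union>i\<in>UNIV. V i)"
      by (rule subset_trans[OF U(1)]) (intro UN_mono subset_refl V)
    then obtain J where "J \<subseteq> UNIV" and J: "finite J" "K \<subseteq> (\<Union>i\<in>J. V i)"
      by (rule compactE_image[OF K(1) V(1)])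
    have "1 \<le> (\<Sum>i\<in>J. (diameter (V i) / gap) powr \<delta> + (rmax powr \<delta>) ^ n)" for n
    proof -
      have "1 = (\<Sum>w\<in>words n. word_ratio w powr \<delta>)"
        by (simp add: sum_word_ratio_powr)
      also have "\<dots> \<le> (\<Sum>w\<in>words n. \<Sum>i\<in>J. if cylinder w \<inter> V i = {} then 0 else word_ratio w powr \<delta>)"
      proof (rule sum_mono)
        fix w assume w: "w \<in> words n"
        obtain x where "x \<in> cylinder w" using K(2) by blast
        then obtain i where i: "i \<in> J" "x \<in> V i"
          using cylinder_subset[OF w] J(2) by blast
        then have "word_ratio w powr \<delta> = (if cylinder w \<inter> V i = {} then 0 else word_ratio w powr \<delta>)"
          using \<open>x \<in> cylinder w\<close> by auto
        also have "\<dots> \<le> (\<Sum>i\<in>J. if cylinder w \<inter> V i = {} then 0 else word_ratio w powr \<delta>)"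
          using J(1) i by (intro member_le_sum) auto
        finally show "word_ratio w powr \<delta> \<le> (\<Sum>i\<in>J. if cylinder w \<inter> V i = {} then 0 else word_ratio w powr \<delta>)" .
      qed
      also have "\<dots> = (\<Sum>i\<in>J. mass n (V i))"
        unfolding mass_def by (rule sum.swap)
      also have "\<dots> \<le> (\<Sum>i\<in>J. (diameter (V i) / gap) powr \<delta> + (rmax powr \<delta>) ^ n)"
      proof (rule sum_mono)
        fix i
        have "0 \<le> (diameter (V i) / gap) powr \<delta>" "0 \<le> (rmax powr \<delta>) ^ n" by auto
        then show "mass n (V i) \<le> (diameter (V i) / gap) powr \<delta> + (rmax powr \<delta>) ^ n"
          using mass_le[OF V(2), of n i] by linarith
      qed
      finally show ?thesis .
    qed
    moreover have "rmax powr \<delta> < 1"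
      using rmax \<delta>_pos powr_less_mono2[of \<delta> rmax 1] by simp
    then have "(\<lambda>n. \<Sum>i\<in>J. (diameter (V i) / gap) powr \<delta> + (rmax powr \<delta>) ^ n) \<longlonglongrightarrow>
        (\<Sum>i\<in>J. (diameter (V i) / gap) powr \<delta> + 0)"
      by (intro tendsto_sum tendsto_add tendsto_const LIMSEQ_power_zero) auto
    ultimately have "1 \<le> (\<Sum>i\<in>J. (diameter (V i) / gap) powr \<delta> + 0)"
      by (intro LIMSEQ_le_const) auto
    then have "1 \<le> (\<Sum>i\<in>J. (diameter (V i) / gap) powr \<delta>)"
      by simp
    also have "\<dots> = (\<Sum>i\<in>J. diameter (V i) powr \<delta>) / gap powr \<delta>"
      using gap(1) diameter_ge_0[OF V(2)] by (simp add: powr_divide sum_divide_distrib)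
    finally have "gap powr \<delta> \<le> (\<Sum>i\<in>J. diameter (V i) powr \<delta>)"
      using gap(1) by (simp add: field_simps)
    then have "ennreal (gap powr \<delta>) \<le> ennreal (\<Sum>i\<in>J. diameter (V i) powr \<delta>)"
      by (rule ennreal_leI)
    also have "\<dots> = (\<Sum>i\<in>J. ennreal (diameter (V i) powr \<delta>))"
      by (simp add: sum_ennreal)
    also have "\<dots> \<le> (\<Sum>i\<in>J. hausdorff_weight \<delta> (U i) + ennreal (d i))"
      by (intro sum_mono V)
    also have "\<dots> \<le> (\<Sum>i. hausdorff_weight \<delta> (U i) + ennreal (d i))"
      using J(1) by (intro sum_le_suminf) auto
    also have "\<dots> = (\<Sum>i. hausdorff_weight \<delta> (U i)) + ennreal e"
      unfolding d_sum[symmetric] by (intro suminf_add[symmetric]) auto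
    finally show "ennreal (gap powr \<delta>) \<le> (\<Sum>i. hausdorff_weight \<delta> (U i)) + ennreal e" .
  qed
qed

lemma hausdorff_outer_K_pos: "0 < hausdorff_outer \<delta> K"
proof -
  have "0 < ennreal (gap powr \<delta>)" using gap(1) by simp
  also have "\<dots> \<le> hausdorff_pre \<delta> 1 K" by (rule hausdorff_pre_ge)
  also have "\<dots> \<le> hausdorff_outer \<delta> K" by (rule hausdorff_pre_le_outer) simp
  finally show ?thesis .
qed

lemma diameter_cylinder_le: "w \<in> words n \<Longrightarrow> diameter (cylinder w) \<le> rmax ^ n * diameter K"
  using diameter_similarity_image_le[OF similarity_word_map less_imp_le[OF word_ratio(1)] compact_imp_bounded[OF K(1)]]
    mult_right_mono[OF word_ratio(2) diameter_ge_0[OF compact_imp_bounded[OF K(1)]]] order_trans by blast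

lemma exists_small_cylinders: "0 < \<eta> \<Longrightarrow> \<exists>n. \<forall>w\<in>words n. diameter (cylinder w) < \<eta>"
proof -
  assume "0 < \<eta>"
  have "(\<lambda>n. rmax ^ n * diameter K) \<longlonglongrightarrow> 0 * diameter K"
    using rmax by (intro tendsto_mult LIMSEQ_power_zero tendsto_const) auto
  then have "\<forall>\<^sub>F n in sequentially. rmax ^ n * diameter K < \<eta>"
    using \<open>0 < \<eta>\<close> by (intro order_tendstoD(2)) auto
  then obtain n where "rmax ^ n * diameter K < \<eta>"
    by (auto simp: eventually_sequentially)
  then show ?thesis
    using diameter_cylinder_le by (meson le_less_trans)
qed

text \<open>The cylinders of a late generation are a fine cover, and their weights sum up to
\<open>\<Sum>\<^sub>w r\<^sub>w\<^sup>\<delta> (diam K)\<^sup>\<delta> = (diam K)\<^sup>\<delta>\<close>.\<close>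

lemma hausdorff_outer_K_finite: "hausdorff_outer \<delta> K < top"
proof -
  have "hausdorff_outer \<delta> K \<le> ennreal (diameter K powr \<delta>)"
  proof (rule hausdorff_outer_leI)
    fix \<eta> :: real assume "0 < \<eta>"
    then obtain n where n: "\<And>w. w \<in> words n \<Longrightarrow> diameter (cylinder w) < \<eta>"
      using exists_small_cylinders by blast
    have "hausdorff_pre \<delta> \<eta> K \<le> (\<Sum>w\<in>words n. hausdorff_weight \<delta> (cylinder w))"
      using n \<open>0 < \<eta>\<close> finite_words UN_cylinder[of n] compact_imp_bounded[OF compact_cylinder]
      by (intro hausdorff_pre_le_finite) (auto intro: less_imp_le)
    also have "\<dots> \<le> (\<Sum>w\<in>words n. ennreal (word_ratio w powr \<delta>) * hausdorff_weight \<delta> K)"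
      by (intro sum_mono hausdorff_weight_similarity_image_le[OF similarity_word_map less_imp_le[OF word_ratio(1)]]
          compact_imp_bounded K \<delta>_pos)
    also have "\<dots> = (\<Sum>w\<in>words n. ennreal (word_ratio w powr \<delta>)) * hausdorff_weight \<delta> K"
      by (rule sum_distrib_right[symmetric])
    also have "(\<Sum>w\<in>words n. ennreal (word_ratio w powr \<delta>)) = 1"
      by (simp add: sum_ennreal sum_word_ratio_powr)
    finally show "hausdorff_pre \<delta> \<eta> K \<le> ennreal (diameter K powr \<delta>)"
      using K(2) \<delta>_pos by (simp add: hausdorff_weight_def)
  qed
  then show ?thesis
    by (simp add: le_less_trans)
qed

text \<open>Scaling gives one inequality for each word.  By additivity both sides have the same finite sum over
all words of length \<open>n\<close>, which forces equality for each of them.\<close>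

lemma hausdorff_outer_cylinder:
  assumes "w \<in> words n"
  shows "hausdorff_outer \<delta> (cylinder w) = ennreal (word_ratio w powr \<delta>) * hausdorff_outer \<delta> K"
proof -
  define h where "h w = enn2real (hausdorff_outer \<delta> (cylinder w))" for w
  define k where "k = enn2real (hausdorff_outer \<delta> K)"
  have fin: "hausdorff_outer \<delta> (cylinder w) < top" if "w \<in> words n" for w
    using hausdorff_outer_mono[OF cylinder_subset[OF that]] hausdorff_outer_K_finite by (rule le_less_trans)
  have k: "hausdorff_outer \<delta> K = ennreal k" "0 \<le> k"
    using hausdorff_outer_K_finite by (simp_all add: k_def)
  have h: "hausdorff_outer \<delta> (cylinder w) = ennreal (h w)" if "w \<in> words n" for w
    using fin[OF that] by (simp add: h_def)
  have h0: "0 \<le> h w" for w by (simp add: h_def)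
  have le: "h w \<le> word_ratio w powr \<delta> * k" if w: "w \<in> words n" for w
  proof -
    have "ennreal (h w) \<le> ennreal (word_ratio w powr \<delta>) * ennreal k"
      using hausdorff_outer_similarity_image_le[OF similarity_word_map[OF w] word_ratio(1)[OF w] \<delta>_pos, of K]
        h[OF w] k by simp
    then show ?thesis
      using k(2) by (simp add: ennreal_mult'[symmetric] ennreal_le_iff)
  qed
  have "ennreal (\<Sum>w\<in>words n. h w) = (\<Sum>w\<in>words n. emeasure (hausdorff_measure \<delta>) (cylinder w))"
    using compact_cylinder h h0 by (simp add: emeasure_hausdorff_measure borel_compact flip: sum_ennreal)
  also have "\<dots> = emeasure (hausdorff_measure \<delta>) (\<Union>w\<in>words n. cylinder w)"
    using compact_cylinder disjoint_cylinders finite_words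
    by (intro sum_emeasure) (auto simp: borel_compact)
  also have "\<dots> = ennreal k"
    using K(1) k by (simp add: UN_cylinder emeasure_hausdorff_measure borel_compact)
  finally have sum_h: "(\<Sum>w\<in>words n. h w) = k"
    using h0 k(2) by (simp add: sum_nonneg)
  have "(\<Sum>w\<in>words n. word_ratio w powr \<delta> * k) = (\<Sum>w\<in>words n. word_ratio w powr \<delta>) * k"
    by (rule sum_distrib_right[symmetric])
  also have "\<dots> = k"
    by (simp only: sum_word_ratio_powr mult_1)
  finally have "(\<Sum>w\<in>words n. h w) = (\<Sum>w\<in>words n. word_ratio w powr \<delta> * k)"
    by (simp only: sum_h)
  then have "h w = word_ratio w powr \<delta> * k"
    by (rule sum_mono_inv) (use le assms finite_words in blast)+
  then show ?thesis
    using h[OF assms] k by (simp add: ennreal_mult')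
qed

lemma sets_normalised_hausdorff [simp, measurable_cong]:
  "sets (normalised_hausdorff \<delta> K) = sets borel"
  by (simp add: normalised_hausdorff_def)

lemma emeasure_normalised_cylinder:
  assumes "w \<in> words n"
  shows "emeasure (normalised_hausdorff \<delta> K) (cylinder w) = ennreal (word_ratio w powr \<delta>)"
proof -
  have "emeasure (normalised_hausdorff \<delta> K) (cylinder w) =
      emeasure (hausdorff_measure \<delta>) (K \<inter> cylinder w) / emeasure (hausdorff_measure \<delta>) K"
    unfolding normalised_hausdorff_def using compact_cylinder[OF assms] K(1)
    by (intro emeasure_uniform_measure) (auto simp: borel_compact)
  also have "K \<inter> cylinder w = cylinder w"
    using cylinder_subset[OF assms] by blast
  also have "emeasure (hausdorff_measure \<delta>) (cylinder w) / emeasure (hausdorff_measure \<delta>) K =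
      ennreal (word_ratio w powr \<delta>) * hausdorff_outer \<delta> K / hausdorff_outer \<delta> K"
    using compact_cylinder[OF assms] K(1)
    by (simp add: emeasure_hausdorff_measure borel_compact hausdorff_outer_cylinder[OF assms])
  also have "\<dots> = ennreal (word_ratio w powr \<delta>)"
    using hausdorff_outer_K_pos hausdorff_outer_K_finite by (simp add: ennreal_mult_divide_eq less_top)
  finally show ?thesis .
qed

lemma integral_cylinder_bounds:
  fixes f :: "'a \<Rightarrow> real"
  assumes f: "continuous_on K f" and w: "w \<in> words n"
    and bounds: "\<And>x. x \<in> cylinder w \<Longrightarrow> a \<le> f x \<and> f x \<le> b"
  shows "a * word_ratio w powr \<delta> \<le> (LINT x:cylinder w|normalised_hausdorff \<delta> K. f x)"
    and "(LINT x:cylinder w|normalised_hausdorff \<delta> K. f x) \<le> b * word_ratio w powr \<delta>"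
    and "set_integrable (normalised_hausdorff \<delta> K) (cylinder w) f"
proof -
  define M where "M = normalised_hausdorff \<delta> K"
  define A where "A = cylinder w"
  have A: "A \<in> sets M" "emeasure M A = ennreal (word_ratio w powr \<delta>)"
    using compact_cylinder[OF w] emeasure_normalised_cylinder[OF w] by (auto simp: A_def M_def borel_compact)
  have mA: "measure M A = word_ratio w powr \<delta>"
    using A by (simp add: measure_def)
  have "continuous_on A f"
    using f cylinder_subset[OF w] unfolding A_def by (rule continuous_on_subset)
  then have "(\<lambda>x. indicator A x *\<^sub>R f x) \<in> borel_measurable borel"
    using A by (intro borel_measurable_continuous_on_indicator) (auto simp: M_def)
  then have meas: "(\<lambda>x. indicator A x *\<^sub>R f x) \<in> borel_measurable M"
    by (simp add: M_def cong: measurable_cong_sets)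
  have int: "set_integrable M A f"
    unfolding set_integrable_def
  proof (rule integrableI_bounded_set[where A = A and B = "\<bar>a\<bar> + \<bar>b\<bar>"])
    have "norm (indicator A x *\<^sub>R f x) \<le> \<bar>a\<bar> + \<bar>b\<bar>" if "x \<in> A" for x
      using bounds[of x] that by (auto simp: A_def)
    then show "AE x in M. x \<in> A \<longrightarrow> norm (indicator A x *\<^sub>R f x) \<le> \<bar>a\<bar> + \<bar>b\<bar>"
      by auto
  qed (use A meas in auto)
  have const: "set_integrable M A (\<lambda>x. c)" "(LINT x:A|M. c) = c * word_ratio w powr \<delta>" for c :: real
    using A mA by (auto simp: set_integrable_def set_lebesgue_integral_def)
  have "(LINT x:A|M. a) \<le> (LINT x:A|M. f x)" "(LINT x:A|M. f x) \<le> (LINT x:A|M. b)"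
    using int const(1) bounds by (auto intro!: set_integral_mono simp: A_def)
  then have "a * word_ratio w powr \<delta> \<le> (LINT x:A|M. f x)" "(LINT x:A|M. f x) \<le> b * word_ratio w powr \<delta>"
    unfolding const(2) .
  then show "a * word_ratio w powr \<delta> \<le> (LINT x:cylinder w|normalised_hausdorff \<delta> K. f x)"
    "(LINT x:cylinder w|normalised_hausdorff \<delta> K. f x) \<le> b * word_ratio w powr \<delta>"
    "set_integrable (normalised_hausdorff \<delta> K) (cylinder w) f"
    using int unfolding A_def M_def .
qed

lemma integral_K_bounds:
  fixes f :: "'a \<Rightarrow> real"
  assumes f: "continuous_on K f"
    and bounds: "\<And>w x. w \<in> words n \<Longrightarrow> x \<in> cylinder w \<Longrightarrow> a w \<le> f x \<and> f x \<le> b w"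
  shows "(\<Sum>w\<in>words n. a w * word_ratio w powr \<delta>) \<le> (LINT x:K|normalised_hausdorff \<delta> K. f x)"
    and "(LINT x:K|normalised_hausdorff \<delta> K. f x) \<le> (\<Sum>w\<in>words n. b w * word_ratio w powr \<delta>)"
proof -
  have "(LINT x:K|normalised_hausdorff \<delta> K. f x) = (LINT x:(\<Union>w\<in>words n. cylinder w)|normalised_hausdorff \<delta> K. f x)"
    by (simp add: UN_cylinder)
  also have "\<dots> = (\<Sum>w\<in>words n. LINT x:cylinder w|normalised_hausdorff \<delta> K. f x)"
    using finite_words disjoint_cylinders compact_cylinder integral_cylinder_bounds(3)[OF f _ bounds]
    by (intro set_integral_finite_Union) (auto simp: borel_compact)
  finally have eq: "(LINT x:K|normalised_hausdorff \<delta> K. f x) =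
      (\<Sum>w\<in>words n. LINT x:cylinder w|normalised_hausdorff \<delta> K. f x)" .
  show "(\<Sum>w\<in>words n. a w * word_ratio w powr \<delta>) \<le> (LINT x:K|normalised_hausdorff \<delta> K. f x)"
    "(LINT x:K|normalised_hausdorff \<delta> K. f x) \<le> (\<Sum>w\<in>words n. b w * word_ratio w powr \<delta>)"
    unfolding eq using integral_cylinder_bounds(1,2)[OF f _ bounds] by (auto intro!: sum_mono)
qed

end

section \<open>Conformal images of self-similar sets\<close>

text \<open>This collects what is used about a conformal map \<open>g\<close> with scaling ratio \<open>s\<close>: a comparison of parallel
neighbourhoods of sets on which \<open>s\<close> is nearly constant.\<close>

locale conformal_image = self_similar \<phi> r I K
  for \<phi> :: "'i \<Rightarrow> 'a::euclidean_space \<Rightarrow> 'a" and r I K +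
  fixes g :: "'a \<Rightarrow> 'a" and s :: "'a \<Rightarrow> real"
  assumes g: "continuous_on K g" "inj_on g K"
    and s: "continuous_on K s" "\<And>x. x \<in> K \<Longrightarrow> 0 < s x"
    and comparison: "\<And>Y m M. compact Y \<Longrightarrow> Y \<noteq> {} \<Longrightarrow> Y \<subseteq> K \<Longrightarrow> 0 < m \<Longrightarrow>
      (\<And>x. x \<in> Y \<Longrightarrow> m < s x \<and> s x < M) \<Longrightarrow>
      \<forall>\<^sub>F \<epsilon> in at_right 0.
        m ^ DIM('a) * measure lborel (parallel_nbhd Y (\<epsilon> / M)) \<le> measure lborel (parallel_nbhd (g ` Y) \<epsilon>) \<and>
        measure lborel (parallel_nbhd (g ` Y) \<epsilon>) \<le> M ^ DIM('a) * measure lborel (parallel_nbhd Y (\<epsilon> / m))"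
begin

definition weight :: real where
  "weight = (LINT x:K|normalised_hausdorff \<delta> K. s x powr \<delta>)"

lemma continuous_on_s_powr: "continuous_on K (\<lambda>x. s x powr \<delta>)"
  using s by (intro continuous_on_powr continuous_on_const) force+

lemma s_lower_bound: "\<exists>c>0. \<forall>x\<in>K. c \<le> s x"
proof -
  obtain x where "x \<in> K" "\<forall>y\<in>K. s x \<le> s y"
    using continuous_attains_inf[OF K(1,2) s(1)] by blast
  then show ?thesis using s(2) by blast
qed

lemma weight_pos: "0 < weight"
proof -
  obtain c where c: "0 < c" "\<And>x. x \<in> K \<Longrightarrow> c \<le> s x"
    using s_lower_bound by blast
  obtain b where b: "\<And>x. x \<in> K \<Longrightarrow> s x powr \<delta> \<le> b"
    using continuous_attains_sup[OF K(1,2) continuous_on_s_powr] by blast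
  have "(\<Sum>w\<in>words 0. c powr \<delta> * word_ratio w powr \<delta>) \<le> weight"
    unfolding weight_def
  proof (rule integral_K_bounds(1)[OF continuous_on_s_powr])
    fix w x assume "w \<in> words 0" "x \<in> cylinder w"
    then have "x \<in> K" using cylinder_subset by blast
    then show "c powr \<delta> \<le> s x powr \<delta> \<and> s x powr \<delta> \<le> b"
      using b c \<delta>_pos by (auto intro: powr_mono2)
  qed
  then have "c powr \<delta> \<le> weight"
    by (simp add: words_0 word_ratio_Nil)
  moreover have "0 < c powr \<delta>" using c by simp
  ultimately show ?thesis by linarith
qed

text \<open>By uniform continuity, \<open>s\<close> varies by less than \<open>2 \<eta>\<close> on small cylinders.  With \<open>c\<close> a lower bound of
\<open>s\<close>, the value \<open>\<eta> = c (\<theta> - 1) / (\<theta> + 1)\<close> is the one for which \<open>c + \<eta> = \<theta> (c - \<eta>)\<close>.\<close>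

lemma fine_partition:
  assumes \<theta>: "1 < \<theta>"
  shows "\<exists>n m. \<forall>w\<in>words n. 0 < m w \<and> (\<forall>x\<in>cylinder w. m w < s x \<and> s x < \<theta> * m w)"
proof -
  obtain c where c: "0 < c" "\<And>x. x \<in> K \<Longrightarrow> c \<le> s x"
    using s_lower_bound by blast
  define \<eta> where "\<eta> = c * (\<theta> - 1) / (\<theta> + 1)"
  have \<eta>: "0 < \<eta>" "\<eta> < c" "\<eta> * (\<theta> + 1) = c * (\<theta> - 1)"
    using c \<theta> by (auto simp: \<eta>_def field_simps)
  have "uniformly_continuous_on K s"
    by (rule compact_uniformly_continuous[OF s(1) K(1)])
  then obtain d where d: "0 < d" "\<And>x y. x \<in> K \<Longrightarrow> y \<in> K \<Longrightarrow> dist y x < d \<Longrightarrow> dist (s y) (s x) < \<eta>"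
    using \<eta>(1) unfolding uniformly_continuous_on_def by blast
  obtain n where n: "\<And>w. w \<in> words n \<Longrightarrow> diameter (cylinder w) < d"
    using exists_small_cylinders[OF d(1)] by blast
  obtain x0 where "x0 \<in> K" using K(2) by blast
  define m where "m w = s (word_map w x0) - \<eta>" for w
  have "0 < m w \<and> (\<forall>x\<in>cylinder w. m w < s x \<and> s x < \<theta> * m w)" if w: "w \<in> words n" for w
  proof -
    define y where "y = word_map w x0"
    have y: "y \<in> cylinder w" "y \<in> K"
      using \<open>x0 \<in> K\<close> cylinder_subset[OF w] by (auto simp: y_def)
    have "m w < s x \<and> s x < \<theta> * m w" if x: "x \<in> cylinder w" for x
    proof -
      have "dist x y \<le> diameter (cylinder w)"
        by (intro diameter_bounded_bound compact_imp_bounded compact_cylinder[OF w] x y)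
      then have "dist (s x) (s y) < \<eta>"
        using n[OF w] x y cylinder_subset[OF w] by (intro d(2)) auto
      then have *: "\<bar>s x - s y\<bar> < \<eta>" by (simp add: dist_real_def)
      have "s y + \<eta> \<le> \<theta> * (s y - \<eta>)"
      proof -
        have "c * (\<theta> - 1) \<le> s y * (\<theta> - 1)"
          using c(2)[OF y(2)] \<theta> by (intro mult_right_mono) auto
        then show ?thesis using \<eta>(3) by (simp add: algebra_simps)
      qed
      with * show ?thesis by (auto simp: m_def y_def[symmetric])
    qed
    moreover have "0 < m w"
      using c(2)[OF y(2)] \<eta>(2) by (simp add: m_def y_def[symmetric])
    ultimately show ?thesis by blast
  qed
  then show ?thesis by blast
qed

lemma compact_image_g: "compact Y \<Longrightarrow> Y \<subseteq> K \<Longrightarrow> compact (g ` Y)"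
  using g(1) by (meson compact_continuous_image continuous_on_subset)

lemma eventually_measure_image_parallel_nbhd:
  "\<forall>\<^sub>F \<epsilon> in at_right 0. measure lborel (parallel_nbhd (g ` K) \<epsilon>) =
     (\<Sum>w\<in>words n. measure lborel (parallel_nbhd (g ` cylinder w) \<epsilon>))"
proof -
  have "words n \<noteq> {}"
    using sum_word_ratio_powr[of n] by auto
  moreover have "disjoint_family_on (\<lambda>w. g ` cylinder w) (words n)"
    unfolding disjoint_family_on_def
  proof (intro ballI impI)
    fix u w assume uw: "u \<in> words n" "w \<in> words n" "u \<noteq> w"
    then have "cylinder u \<inter> cylinder w = {}"
      using disjoint_cylinders[of n] by (auto simp: disjoint_family_on_def)
    then show "g ` cylinder u \<inter> g ` cylinder w = {}"
      using inj_on_image_Int[OF g(2) cylinder_subset[OF uw(1)] cylinder_subset[OF uw(2)]] by simp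
  qed
  ultimately have "\<forall>\<^sub>F \<epsilon> in at_right 0. measure lborel (parallel_nbhd (\<Union>w\<in>words n. g ` cylinder w) \<epsilon>) =
     (\<Sum>w\<in>words n. measure lborel (parallel_nbhd (g ` cylinder w) \<epsilon>))"
    using K(2) by (intro separated_parallel_nbhds_UN finite_words compact_image_g compact_cylinder cylinder_subset) auto
  moreover have "(\<Union>w\<in>words n. g ` cylinder w) = g ` K"
    by (simp only: image_UN[symmetric] UN_cylinder)
  ultimately show ?thesis by simp
qed

lemma scaled_volume_cylinder:
  assumes w: "w \<in> words n" and k: "0 < k" and "0 < \<epsilon>"
  shows "\<epsilon> powr (\<delta> - real DIM('a)) * (c ^ DIM('a) * measure lborel (parallel_nbhd (cylinder w) (\<epsilon> / k))) =
    (c / k) ^ DIM('a) * k powr \<delta> * word_ratio w powr \<delta> * scaled_volume \<delta> K (\<epsilon> / (k * word_ratio w))"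
proof -
  have "\<epsilon> powr (\<delta> - real DIM('a)) = (\<epsilon> / k) powr (\<delta> - real DIM('a)) * k powr \<delta> / k ^ DIM('a)"
    using k \<open>0 < \<epsilon>\<close> by (simp add: powr_divide powr_diff powr_realpow field_simps)
  then have "\<epsilon> powr (\<delta> - real DIM('a)) * (c ^ DIM('a) * measure lborel (parallel_nbhd (cylinder w) (\<epsilon> / k))) =
      (c / k) ^ DIM('a) * k powr \<delta> * scaled_volume \<delta> (cylinder w) (\<epsilon> / k)"
    by (simp add: scaled_volume_def power_divide)
  also have "scaled_volume \<delta> (cylinder w) (\<epsilon> / k) =
      word_ratio w powr \<delta> * scaled_volume \<delta> K (\<epsilon> / k / word_ratio w)"
    using word_ratio(1)[OF w] k \<open>0 < \<epsilon>\<close>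
    by (intro scaled_volume_similarity similarity_word_map[OF w] K(1,2)) auto
  finally show ?thesis by (simp add: mult_ac)
qed

text \<open>On the cylinder of \<open>w\<close> let \<open>m\<^sub>w < s < M\<^sub>w = \<theta> m\<^sub>w\<close>.  The comparison bounds the rescaled volume of its
image by that of \<open>K\<close> at the radius \<open>\<epsilon> / (m\<^sub>w r\<^sub>w)\<close> from above and \<open>\<epsilon> / (M\<^sub>w r\<^sub>w)\<close> from below, with the
coefficients \<open>\<theta>\<^sup>D m\<^sub>w\<^sup>\<delta> r\<^sub>w\<^sup>\<delta>\<close> and \<open>\<theta>\<^sup>-\<^sup>D M\<^sub>w\<^sup>\<delta> r\<^sub>w\<^sup>\<delta>\<close>.  Since \<open>r\<^sub>w\<^sup>\<delta>\<close> is the measure of the cylinder, the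
sums of \<open>m\<^sub>w\<^sup>\<delta> r\<^sub>w\<^sup>\<delta>\<close> and \<open>M\<^sub>w\<^sup>\<delta> r\<^sub>w\<^sup>\<delta>\<close> enclose the integral of \<open>s\<^sup>\<delta>\<close>.\<close>

lemma log_volume_image_sandwich:
  assumes \<theta>: "1 < \<theta>"
  obtains n a b \<sigma> \<tau> where
    "\<forall>w\<in>words n. 0 \<le> a w \<and> 0 \<le> b w"
    "weight / \<theta> ^ DIM('a) \<le> (\<Sum>w\<in>words n. a w)" "(\<Sum>w\<in>words n. b w) \<le> weight * \<theta> ^ DIM('a)"
    "\<forall>\<^sub>F t in at_top. (\<Sum>w\<in>words n. a w * log_volume \<delta> K (t - \<sigma> w)) \<le> log_volume \<delta> (g ` K) t \<and>
       log_volume \<delta> (g ` K) t \<le> (\<Sum>w\<in>words n. b w * log_volume \<delta> K (t - \<tau> w))"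
proof -
  obtain n m where m: "\<And>w. w \<in> words n \<Longrightarrow> 0 < m w"
    "\<And>w x. w \<in> words n \<Longrightarrow> x \<in> cylinder w \<Longrightarrow> m w < s x \<and> s x < \<theta> * m w"
    using fine_partition[OF \<theta>] by blast
  define M where "M w = \<theta> * m w" for w
  have M: "0 < M w" if "w \<in> words n" for w using m(1)[OF that] \<theta> by (simp add: M_def)
  define a where "a w = (m w / M w) ^ DIM('a) * M w powr \<delta> * word_ratio w powr \<delta>" for w
  define b where "b w = (M w / m w) ^ DIM('a) * m w powr \<delta> * word_ratio w powr \<delta>" for w
  define \<sigma> where "\<sigma> w = - ln (M w * word_ratio w)" for w
  define \<tau> where "\<tau> w = - ln (m w * word_ratio w)" for w
  have bnd: "m w powr \<delta> \<le> s x powr \<delta> \<and> s x powr \<delta> \<le> M w powr \<delta>"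
    if "w \<in> words n" "x \<in> cylinder w" for w x
  proof -
    have "0 < m w" "m w < s x" "s x < M w"
      using m(1)[OF that(1)] m(2)[OF that] by (simp_all add: M_def)
    then show ?thesis
      using \<delta>_pos by (intro conjI powr_mono2) auto
  qed
  have "a w = M w powr \<delta> * word_ratio w powr \<delta> / \<theta> ^ DIM('a)" if "w \<in> words n" for w
    using m(1)[OF that] \<theta> by (simp add: a_def M_def power_divide)
  then have "(\<Sum>w\<in>words n. a w) = (\<Sum>w\<in>words n. M w powr \<delta> * word_ratio w powr \<delta>) / \<theta> ^ DIM('a)"
    by (simp add: sum_divide_distrib)
  moreover have "weight \<le> (\<Sum>w\<in>words n. M w powr \<delta> * word_ratio w powr \<delta>)"
    unfolding weight_def by (rule integral_K_bounds(2)[OF continuous_on_s_powr bnd])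
  ultimately have sum_a: "weight / \<theta> ^ DIM('a) \<le> (\<Sum>w\<in>words n. a w)"
    using \<theta> by (simp add: divide_right_mono)
  have "b w = m w powr \<delta> * word_ratio w powr \<delta> * \<theta> ^ DIM('a)" if "w \<in> words n" for w
    using m(1)[OF that] \<theta> by (simp add: b_def M_def)
  then have "(\<Sum>w\<in>words n. b w) = (\<Sum>w\<in>words n. m w powr \<delta> * word_ratio w powr \<delta>) * \<theta> ^ DIM('a)"
    by (simp add: sum_distrib_right)
  moreover have "(\<Sum>w\<in>words n. m w powr \<delta> * word_ratio w powr \<delta>) \<le> weight"
    unfolding weight_def by (rule integral_K_bounds(1)[OF continuous_on_s_powr bnd])
  ultimately have sum_b: "(\<Sum>w\<in>words n. b w) \<le> weight * \<theta> ^ DIM('a)"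
    using \<theta> by (simp add: mult_right_mono)
  have "\<forall>\<^sub>F \<epsilon> in at_right 0. \<forall>w\<in>words n.
      m w ^ DIM('a) * measure lborel (parallel_nbhd (cylinder w) (\<epsilon> / M w))
        \<le> measure lborel (parallel_nbhd (g ` cylinder w) \<epsilon>) \<and>
      measure lborel (parallel_nbhd (g ` cylinder w) \<epsilon>)
        \<le> M w ^ DIM('a) * measure lborel (parallel_nbhd (cylinder w) (\<epsilon> / m w))"
    using K(2) m by (intro eventually_ball_finite finite_words ballI comparison compact_cylinder cylinder_subset)
      (auto simp: M_def)
  then have "\<forall>\<^sub>F \<epsilon> in at_right 0.
      (\<Sum>w\<in>words n. a w * scaled_volume \<delta> K (\<epsilon> / (M w * word_ratio w))) \<le> scaled_volume \<delta> (g ` K) \<epsilon> \<and>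
      scaled_volume \<delta> (g ` K) \<epsilon> \<le> (\<Sum>w\<in>words n. b w * scaled_volume \<delta> K (\<epsilon> / (m w * word_ratio w)))"
    using eventually_measure_image_parallel_nbhd[of n] eventually_at_right_less[of 0]
  proof eventually_elim
    case (elim \<epsilon>)
    define q where "q = \<epsilon> powr (\<delta> - real DIM('a))"
    have q: "0 \<le> q" by (simp add: q_def)
    have sv: "scaled_volume \<delta> (g ` K) \<epsilon> = (\<Sum>w\<in>words n. q * measure lborel (parallel_nbhd (g ` cylinder w) \<epsilon>))"
      by (simp add: scaled_volume_def q_def elim(2) sum_distrib_left)
    have A: "a w * scaled_volume \<delta> K (\<epsilon> / (M w * word_ratio w)) \<le> q * measure lborel (parallel_nbhd (g ` cylinder w) \<epsilon>)"
      if w: "w \<in> words n" for w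
    proof -
      have "q * (m w ^ DIM('a) * measure lborel (parallel_nbhd (cylinder w) (\<epsilon> / M w)))
          \<le> q * measure lborel (parallel_nbhd (g ` cylinder w) \<epsilon>)"
        using elim(1) w q by (intro mult_left_mono) auto
      then show ?thesis
        unfolding a_def q_def using scaled_volume_cylinder[OF w M[OF w] elim(3)] by simp
    qed
    have B: "q * measure lborel (parallel_nbhd (g ` cylinder w) \<epsilon>) \<le> b w * scaled_volume \<delta> K (\<epsilon> / (m w * word_ratio w))"
      if w: "w \<in> words n" for w
    proof -
      have "q * measure lborel (parallel_nbhd (g ` cylinder w) \<epsilon>)
          \<le> q * (M w ^ DIM('a) * measure lborel (parallel_nbhd (cylinder w) (\<epsilon> / m w)))"
        using elim(1) w q by (intro mult_left_mono) auto
      then show ?thesis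
        unfolding b_def q_def using scaled_volume_cylinder[OF w m(1)[OF w] elim(3)] by simp
    qed
    show ?case
      unfolding sv using A B by (auto intro!: sum_mono)
  qed
  from eventually_compose_filterlim[OF this filterlim_exp_minus_at_right]
  have ev: "\<forall>\<^sub>F t in at_top. (\<Sum>w\<in>words n. a w * log_volume \<delta> K (t - \<sigma> w)) \<le> log_volume \<delta> (g ` K) t \<and>
       log_volume \<delta> (g ` K) t \<le> (\<Sum>w\<in>words n. b w * log_volume \<delta> K (t - \<tau> w))"
  proof eventually_elim
    case (elim t)
    have "exp (- t) / (M w * word_ratio w) = exp (- (t - \<sigma> w))"
      "exp (- t) / (m w * word_ratio w) = exp (- (t - \<tau> w))" if "w \<in> words n" for w
      using m(1)[OF that] M[OF that] word_ratio(1)[OF that]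
      by (simp_all add: \<sigma>_def \<tau>_def exp_diff exp_minus exp_add divide_simps)
    with elim show ?case by (simp add: log_volume_def)
  qed
  show thesis
  proof (rule that[OF _ sum_a sum_b ev])
    show "\<forall>w\<in>words n. 0 \<le> a w \<and> 0 \<le> b w"
      using m(1) M by (auto simp: a_def b_def less_imp_le)
  qed
qed

lemma locally_integrable_K: "locally_integrable (log_volume \<delta> K)"
  by (intro locally_integrable_log_volume K)

lemma shift_mean: "has_mean (log_volume \<delta> K) x \<Longrightarrow> finite W \<Longrightarrow>
    locally_integrable (\<lambda>t. \<Sum>w\<in>W. a w * log_volume \<delta> K (t - \<sigma> w)) \<and>
    has_mean (\<lambda>t. \<Sum>w\<in>W. a w * log_volume \<delta> K (t - \<sigma> w)) ((\<Sum>w\<in>W. a w) * x)"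
proof
  assume x: "has_mean (log_volume \<delta> K) x" and W: "finite W"
  have int: "locally_integrable (\<lambda>t. log_volume \<delta> K (t - \<sigma> w))" for w
    by (intro locally_integrable_shift locally_integrable_K)
  then show "locally_integrable (\<lambda>t. \<Sum>w\<in>W. a w * log_volume \<delta> K (t - \<sigma> w))"
    by (intro locally_integrable_sum W)
  have "locally_integrable (\<lambda>t. a w * log_volume \<delta> K (t - \<sigma> w))" for w
    using locally_integrable_sum[of "{w}" "\<lambda>w t. log_volume \<delta> K (t - \<sigma> w)" a] int by simp
  then show "has_mean (\<lambda>t. \<Sum>w\<in>W. a w * log_volume \<delta> K (t - \<sigma> w)) ((\<Sum>w\<in>W. a w) * x)"
    unfolding sum_distrib_right
    by (intro has_mean_sum W has_mean_cmult has_mean_shift locally_integrable_K x)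
qed

lemma distortion_close_to_1:
  assumes "0 < \<eta>" "0 \<le> x"
  obtains \<theta> where "1 < \<theta>" "x * weight - \<eta> \<le> weight / \<theta> ^ DIM('a) * x" "weight * \<theta> ^ DIM('a) * x \<le> x * weight + \<eta>"
proof -
  have "((\<lambda>\<theta>. weight * \<theta> ^ DIM('a) * x) \<longlongrightarrow> weight * 1 ^ DIM('a) * x) (at_right 1)"
    "((\<lambda>\<theta>. weight / \<theta> ^ DIM('a) * x) \<longlongrightarrow> weight / 1 ^ DIM('a) * x) (at_right 1)"
    by (intro tendsto_intros; simp)+
  then have "\<forall>\<^sub>F \<theta> in at_right 1. weight * \<theta> ^ DIM('a) * x < x * weight + \<eta>"
    "\<forall>\<^sub>F \<theta> in at_right 1. x * weight - \<eta> < weight / \<theta> ^ DIM('a) * x"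
    using assms by (auto intro!: order_tendstoD simp: mult.commute)
  then have "\<forall>\<^sub>F \<theta> in at_right 1. 1 < \<theta> \<and> x * weight - \<eta> < weight / \<theta> ^ DIM('a) * x \<and> weight * \<theta> ^ DIM('a) * x < x * weight + \<eta>"
    using eventually_at_right_less[of "1::real"] by eventually_elim simp
  from eventually_happens[OF this] show thesis
    using that by (auto intro: less_imp_le)
qed

lemma image_has_mean:
  assumes x: "has_mean (log_volume \<delta> K) x" "0 \<le> x"
  shows "has_mean (log_volume \<delta> (g ` K)) (x * weight)"
proof (rule has_mean_squeeze)
  show "locally_integrable (log_volume \<delta> (g ` K))"
    using K by (intro locally_integrable_log_volume compact_image_g) auto
  fix \<eta> :: real assume "0 < \<eta>"
  obtain \<theta> where \<theta>: "1 < \<theta>" "x * weight - \<eta> \<le> weight / \<theta> ^ DIM('a) * x" "weight * \<theta> ^ DIM('a) * x \<le> x * weight + \<eta>"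
    by (rule distortion_close_to_1[OF \<open>0 < \<eta>\<close> x(2)])
  obtain n a b \<sigma> \<tau> where *: "\<forall>w\<in>words n. 0 \<le> a w \<and> 0 \<le> b w"
    "weight / \<theta> ^ DIM('a) \<le> (\<Sum>w\<in>words n. a w)" "(\<Sum>w\<in>words n. b w) \<le> weight * \<theta> ^ DIM('a)"
    "\<forall>\<^sub>F t in at_top. (\<Sum>w\<in>words n. a w * log_volume \<delta> K (t - \<sigma> w)) \<le> log_volume \<delta> (g ` K) t \<and>
       log_volume \<delta> (g ` K) t \<le> (\<Sum>w\<in>words n. b w * log_volume \<delta> K (t - \<tau> w))"
    by (rule log_volume_image_sandwich[OF \<theta>(1)])
  have "x * weight - \<eta> \<le> (\<Sum>w\<in>words n. a w) * x"
    using \<theta>(2) mult_right_mono[OF *(2) x(2)] by linarith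
  moreover have "(\<Sum>w\<in>words n. b w) * x \<le> x * weight + \<eta>"
    using \<theta>(3) mult_right_mono[OF *(3) x(2)] by linarith
  ultimately show "\<exists>l u x' y. locally_integrable l \<and> locally_integrable u \<and> has_mean l x' \<and> has_mean u y \<and>
      x * weight - \<eta> \<le> x' \<and> y \<le> x * weight + \<eta> \<and>
      (\<forall>\<^sub>F t in at_top. l t \<le> log_volume \<delta> (g ` K) t \<and> log_volume \<delta> (g ` K) t \<le> u t)"
    using shift_mean[OF x(1), of "words n" a \<sigma>, OF finite_words] shift_mean[OF x(1), of "words n" b \<tau>, OF finite_words] *(4)
    by (intro exI[of _ "\<lambda>t. \<Sum>w\<in>words n. a w * log_volume \<delta> K (t - \<sigma> w)"]
        exI[of _ "\<lambda>t. \<Sum>w\<in>words n. b w * log_volume \<delta> K (t - \<tau> w)"]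
        exI[of _ "(\<Sum>w\<in>words n. a w) * x"] exI[of _ "(\<Sum>w\<in>words n. b w) * x"]) auto
qed

lemma shift_tendsto:
  assumes "(log_volume \<delta> K \<longlongrightarrow> x) at_top"
  shows "((\<lambda>t. \<Sum>w\<in>W. a w * log_volume \<delta> K (t - \<sigma> w)) \<longlongrightarrow> (\<Sum>w\<in>W. a w) * x) at_top"
  unfolding sum_distrib_right
proof (intro tendsto_sum tendsto_mult tendsto_const)
  fix w
  have "filterlim (\<lambda>t. t - \<sigma> w) at_top at_top"
    using filterlim_tendsto_add_at_top[OF tendsto_const[of "- \<sigma> w"] filterlim_ident] by simp
  then show "((\<lambda>t. log_volume \<delta> K (t - \<sigma> w)) \<longlongrightarrow> x) at_top"
    by (rule filterlim_compose[OF assms])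
qed

lemma image_tendsto:
  assumes x: "(log_volume \<delta> K \<longlongrightarrow> x) at_top" "0 \<le> x"
  shows "(log_volume \<delta> (g ` K) \<longlongrightarrow> x * weight) at_top"
proof (rule tendsto_squeeze_approx)
  fix \<eta> :: real assume "0 < \<eta>"
  obtain \<theta> where \<theta>: "1 < \<theta>" "x * weight - \<eta> \<le> weight / \<theta> ^ DIM('a) * x" "weight * \<theta> ^ DIM('a) * x \<le> x * weight + \<eta>"
    by (rule distortion_close_to_1[OF \<open>0 < \<eta>\<close> x(2)])
  obtain n a b \<sigma> \<tau> where *: "\<forall>w\<in>words n. 0 \<le> a w \<and> 0 \<le> b w"
    "weight / \<theta> ^ DIM('a) \<le> (\<Sum>w\<in>words n. a w)" "(\<Sum>w\<in>words n. b w) \<le> weight * \<theta> ^ DIM('a)"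
    "\<forall>\<^sub>F t in at_top. (\<Sum>w\<in>words n. a w * log_volume \<delta> K (t - \<sigma> w)) \<le> log_volume \<delta> (g ` K) t \<and>
       log_volume \<delta> (g ` K) t \<le> (\<Sum>w\<in>words n. b w * log_volume \<delta> K (t - \<tau> w))"
    by (rule log_volume_image_sandwich[OF \<theta>(1)])
  have "x * weight - \<eta> \<le> (\<Sum>w\<in>words n. a w) * x"
    using \<theta>(2) mult_right_mono[OF *(2) x(2)] by linarith
  moreover have "(\<Sum>w\<in>words n. b w) * x \<le> x * weight + \<eta>"
    using \<theta>(3) mult_right_mono[OF *(3) x(2)] by linarith
  ultimately show "\<exists>l u x' y. (l \<longlongrightarrow> x') at_top \<and> (u \<longlongrightarrow> y) at_top \<and>
      x * weight - \<eta> \<le> x' \<and> y \<le> x * weight + \<eta> \<and>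
      (\<forall>\<^sub>F t in at_top. l t \<le> log_volume \<delta> (g ` K) t \<and> log_volume \<delta> (g ` K) t \<le> u t)"
    using shift_tendsto[OF x(1), of a \<sigma> "words n"] shift_tendsto[OF x(1), of b \<tau> "words n"] *(4)
    by (intro exI[of _ "\<lambda>t. \<Sum>w\<in>words n. a w * log_volume \<delta> K (t - \<sigma> w)"]
        exI[of _ "\<lambda>t. \<Sum>w\<in>words n. b w * log_volume \<delta> K (t - \<tau> w)"]
        exI[of _ "(\<Sum>w\<in>words n. a w) * x"] exI[of _ "(\<Sum>w\<in>words n. b w) * x"]) auto
qed

text \<open>Any fixed distortion is good enough here; the sandwich is used with \<open>\<theta> = 2\<close>.\<close>

lemma image_log_volume_bounded:
  "\<exists>a b. 0 < a \<and> (\<forall>\<^sub>F t in at_top. a \<le> log_volume \<delta> (g ` K) t \<and> log_volume \<delta> (g ` K) t \<le> b)"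
proof -
  obtain a0 b0 where ab: "0 < a0" "\<forall>\<^sub>F t in at_top. a0 \<le> log_volume \<delta> K t \<and> log_volume \<delta> K t \<le> b0"
    using log_volume_bounded by blast
  obtain n a b \<sigma> \<tau> where *: "\<forall>w\<in>words n. 0 \<le> a w \<and> 0 \<le> b w"
    "weight / 2 ^ DIM('a) \<le> (\<Sum>w\<in>words n. a w)" "(\<Sum>w\<in>words n. b w) \<le> weight * 2 ^ DIM('a)"
    "\<forall>\<^sub>F t in at_top. (\<Sum>w\<in>words n. a w * log_volume \<delta> K (t - \<sigma> w)) \<le> log_volume \<delta> (g ` K) t \<and>
       log_volume \<delta> (g ` K) t \<le> (\<Sum>w\<in>words n. b w * log_volume \<delta> K (t - \<tau> w))"
    by (rule log_volume_image_sandwich[of 2]) auto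
  have shift: "\<forall>\<^sub>F t in at_top. \<forall>w\<in>words n. a0 \<le> log_volume \<delta> K (t - \<rho> w) \<and> log_volume \<delta> K (t - \<rho> w) \<le> b0" for \<rho>
  proof (intro eventually_ball_finite finite_words ballI)
    fix w
    have "filterlim (\<lambda>t. t - \<rho> w) at_top at_top"
      using filterlim_tendsto_add_at_top[OF tendsto_const[of "- \<rho> w"] filterlim_ident] by simp
    then show "\<forall>\<^sub>F t in at_top. a0 \<le> log_volume \<delta> K (t - \<rho> w) \<and> log_volume \<delta> K (t - \<rho> w) \<le> b0"
      by (rule eventually_compose_filterlim[OF ab(2)])
  qed
  have "0 < weight / 2 ^ DIM('a)" using weight_pos by simp
  with *(2) have "0 < (\<Sum>w\<in>words n. a w)" by linarith
  then have "0 < (\<Sum>w\<in>words n. a w) * a0" using ab(1) by simp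
  moreover have "\<forall>\<^sub>F t in at_top. (\<Sum>w\<in>words n. a w) * a0 \<le> log_volume \<delta> (g ` K) t \<and>
      log_volume \<delta> (g ` K) t \<le> (\<Sum>w\<in>words n. b w) * b0"
    using *(4) shift[of \<sigma>] shift[of \<tau>]
  proof eventually_elim
    case (elim t)
    have "(\<Sum>w\<in>words n. a w) * a0 \<le> (\<Sum>w\<in>words n. a w * log_volume \<delta> K (t - \<sigma> w))"
      unfolding sum_distrib_right using elim *(1) by (intro sum_mono mult_left_mono) auto
    moreover have "(\<Sum>w\<in>words n. b w * log_volume \<delta> K (t - \<tau> w)) \<le> (\<Sum>w\<in>words n. b w) * b0"
      unfolding sum_distrib_right using elim *(1) by (intro sum_mono mult_left_mono) auto
    ultimately show ?case using elim(1) by linarith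
  qed
  ultimately show ?thesis by blast
qed

end

theorem theorem1p6:
  fixes \<phi> :: "nat \<Rightarrow> real^'d \<Rightarrow> real^'d" and r :: "nat \<Rightarrow> real" and N :: nat
    and K F U :: "(real^'d) set" and g :: "real^'d \<Rightarrow> real^'d" and \<alpha> \<delta> :: real
  assumes "N \<ge> 2"
    and "\<And>i. i \<in> {1..N} \<Longrightarrow> 0 < r i \<and> r i < 1"
    and "\<And>i. i \<in> {1..N} \<Longrightarrow> similarity (r i) (\<phi> i)"
    and "invariant_set N \<phi> K"
    and "strong_separation N \<phi> K"
    and "open U"
    and "parallel_nbhd K (1/2) \<subseteq> U"
    and "diffeo_onto_image U g"
    and "conformal_on U g"
    and "\<alpha> > 0"
    and "holder_on \<alpha> U (scaling_ratio g)"
    and "F = g ` K"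
    and "\<delta> = minkowski_dim K"
  shows "(has_average_content K \<and> 0 < average_content K \<and> average_content K < \<infinity> \<and>
          has_average_content F \<and> 0 < average_content F \<and> average_content F < \<infinity> \<and>
          average_content F =
            average_content K *
            ereal (LINT x:K|normalised_hausdorff \<delta> K. scaling_ratio g x powr \<delta>)) \<and>
         (minkowski_measurable K \<longrightarrow>
          minkowski_measurable F \<and>
          minkowski_content K = average_content K \<and>
          minkowski_content F = average_content F)"
proof -
  have "K \<subseteq> U"
    using assms(7) by (auto simp: parallel_nbhd_def)
  have g: "inj_on g U" "C1_on U g"
    using assms(8) by (auto simp: diffeo_onto_image_def)
  interpret S: self_similar \<phi> r "{1..N}" K
    using assms(1-5)
    by unfold_locales (auto simp: invariant_set_def strong_separation_def disjoint_family_on_def)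
  interpret C: conformal_image \<phi> r "{1..N}" K g "scaling_ratio g"
  proof unfold_locales
    have "continuous_on U g"
      using g(2) unfolding C1_on_def
      by (intro continuous_at_imp_continuous_on ballI differentiable_imp_continuous_within) auto
    then show "continuous_on K g"
      using \<open>K \<subseteq> U\<close> by (rule continuous_on_subset)
    show "inj_on g K"
      using g(1) \<open>K \<subseteq> U\<close> by (rule inj_on_subset)
    show "continuous_on K (scaling_ratio g)"
      using continuous_on_scaling_ratio[OF assms(9) g(2)] \<open>K \<subseteq> U\<close> by (rule continuous_on_subset)
    show "0 < scaling_ratio g x" if "x \<in> K" for x
      using scaling_ratio_pos[OF assms(6,8,9)] that \<open>K \<subseteq> U\<close> by blast
    show "\<forall>\<^sub>F \<epsilon> in at_right 0.
        m ^ DIM(real^'d) * measure lborel (parallel_nbhd Y (\<epsilon> / M)) \<le> measure lborel (parallel_nbhd (g ` Y) \<epsilon>) \<and>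
        measure lborel (parallel_nbhd (g ` Y) \<epsilon>) \<le> M ^ DIM(real^'d) * measure lborel (parallel_nbhd Y (\<epsilon> / m))"
      if "compact Y" "Y \<noteq> {}" "Y \<subseteq> K" "0 < m" "\<And>x. x \<in> Y \<Longrightarrow> m < scaling_ratio g x \<and> scaling_ratio g x < M" for Y m M
      using conformal_parallel_nbhd_bounds[OF assms(6,8,9) that(1,2) _ that(4,5)] that(3) \<open>K \<subseteq> U\<close> by simp
  qed
  have K: "compact K" "K \<noteq> {}" and F: "compact F" "F \<noteq> {}"
    using S.K C.compact_image_g[of K] by (auto simp: assms(12))
  obtain a b where ab: "0 < a" "\<forall>\<^sub>F t in at_top. a \<le> log_volume S.\<delta> K t \<and> log_volume S.\<delta> K t \<le> b"
    using S.log_volume_bounded by blast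
  obtain a' b' where ab': "0 < a'" "\<forall>\<^sub>F t in at_top. a' \<le> log_volume S.\<delta> F t \<and> log_volume S.\<delta> F t \<le> b'"
    using C.image_log_volume_bounded unfolding assms(12) by blast
  have dimK: "has_minkowski_dim K S.\<delta>"
    by (rule has_minkowski_dimI[OF K ab(1) eventually_scaled_volume_bounds[OF ab(2)]])
  have dimF: "has_minkowski_dim F S.\<delta>"
    by (rule has_minkowski_dimI[OF F ab'(1) eventually_scaled_volume_bounds[OF ab'(2)]])
  have \<delta>: "\<delta> = S.\<delta>"
    using minkowski_dim_eq[OF dimK] assms(13) by simp
  obtain x where x: "0 < x" "has_mean (log_volume S.\<delta> K) x"
    using S.log_volume_has_mean by blast
  have xF: "has_mean (log_volume S.\<delta> F) (x * C.weight)"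
    unfolding assms(12) using x by (intro C.image_has_mean) auto
  note avK = average_contentI[OF K dimK x(2)]
  note avF = average_contentI[OF F dimF xF]
  have "minkowski_measurable F \<and> minkowski_content K = average_content K \<and> minkowski_content F = average_content F"
    if meas: "minkowski_measurable K"
  proof -
    obtain y where y: "(log_volume S.\<delta> K \<longlongrightarrow> y) at_top"
      using minkowski_measurable_imp_tendsto[OF dimK meas eventually_scaled_volume_bounds[OF ab(2)]] by blast
    have "has_mean (log_volume S.\<delta> K) y"
      by (rule tendsto_imp_has_mean[OF C.locally_integrable_K y])
    then have "y = x"
      using x(2) unfolding has_mean_def by (rule tendsto_unique[OF trivial_limit_at_top_linorder])
    with y have lim: "(log_volume S.\<delta> K \<longlongrightarrow> x) at_top" by simp
    have limF: "(log_volume S.\<delta> F \<longlongrightarrow> x * C.weight) at_top"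
      unfolding assms(12) using x lim by (intro C.image_tendsto) auto
    show ?thesis
      using minkowski_contentI[OF dimK lim] minkowski_contentI[OF dimF limF] avK(2) avF(2) by simp
  qed
  moreover have "0 < x * C.weight"
    using x(1) C.weight_pos by simp
  moreover have "C.weight = (LINT x:K|normalised_hausdorff \<delta> K. scaling_ratio g x powr \<delta>)"
    unfolding \<delta> by (rule C.weight_def)
  ultimately show ?thesis
    using avK avF x(1) by simp
qed

end
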